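(* Let $H$ be a finite dimensional Hopf algebra over a field $k$, let $A$ be a left $H$-module algebra which is $H^*$-Galois, and let $E=\operatorname{End}_H A$ be the algebra of all $H$-module endomorphisms of $A$, acting on $A$ from the left. Then there is a unique comultiplication on the algebra $E$ with respect to which $E$ is a Hopf algebra and $A$ is a left $E$-module algebra. With respect to this Hopf algebra structure the algebra $A$ is $E^*$-Galois, and the canonical map $H\to\operatorname{End}_E A$ (sending $h$ to the operator $a\mapsto ha$) is bijective.
   Context: All tensor products, $\operatorname{Hom}$ and $\operatorname{End}$ without subscript are over $k$. For a finite dimensional Hopf algebra $H$ write $\Delta h=\sum_{(h)}h'\otimes h''$; $\varepsilon$ and $S$ are the counit and antipode. A left $H$-module algebra is a unital associative algebra $A$ with a left $H$-module structure such that $h(ab)=\sum_{(h)}(h'a)(h''b)$ and $h1=\varepsilon(h)1$. Algebras considered are extensions of $k$ (so $A\ne0$ and $k$ is identified with $k1_A$). For a left $H$-module algebra $A$ consider the linear maps $\pi,\pi':A\otimes H\to\operatorname{End}A$ and $\gamma,\gamma':A\otimes A\to A\otimes H^*\cong\operatorname{Hom}(H,A)$ given by $\pi(a\otimes h)(b)=a(hb)$, $\pi'(a\otimes h)(b)=(hb)a$, $\gamma(a\otimes b)(h)=a(hb)$, $\gamma'(a\otimes b)(h)=(ha)b$. The algebra $A$ is called $H^*$-Galois if $\pi,\pi',\gamma,\gamma'$ are bijective (it is known that if one of them is bijective then all are, and that then $\dim A<\infty$). The same definition is used for $E$ in place of $H$. *)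

theory Defs
  imports "HOL.Vector_Spaces" "HOL-Library.Function_Algebras" "HOL-Library.FuncSet"
begin

section \<open>Vector spaces, linear and bilinear maps\<close>

text \<open>A vector space is a subspace \<open>vcarrier V\<close> of an ambient type, with the addition of that type.
  Nothing is assumed of the operations outside the carrier, apart from those of an ambient vector
  space (which may be the carrier itself). Carriers are needed because the algebra of module
  endomorphisms is a set of functions and not a type.\<close>

record ('k, 'v) vspace =
  vcarrier :: "'v set"
  vscale :: "'k \<Rightarrow> 'v \<Rightarrow> 'v"

locale vspace =
  fixes V :: "('k::field, 'v::ab_group_add, 'z) vspace_scheme"
  assumes ambient: "vector_space (vscale V)"
    and subspace_carrier: "module.subspace (vscale V) (vcarrier V)"

definition ground :: "('k::field, 'k) vspace" where
  "ground = \<lparr>vcarrier = UNIV, vscale = (*)\<rparr>"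

definition fin_dim :: "('k::field, 'v::ab_group_add, 'z) vspace_scheme \<Rightarrow> bool" where
  "fin_dim V \<longleftrightarrow> (\<exists>B. finite B \<and> module.span (vscale V) B = vcarrier V)"

definition linear_map ::
  "('k::field, 'v::ab_group_add, 'y) vspace_scheme \<Rightarrow> ('k, 'w::ab_group_add, 'z) vspace_scheme \<Rightarrow>
   ('v \<Rightarrow> 'w) \<Rightarrow> bool" where
  "linear_map V W f \<longleftrightarrow> f \<in> vcarrier V \<rightarrow> vcarrier W \<and>
     (\<forall>x\<in>vcarrier V. \<forall>y\<in>vcarrier V. f (x + y) = f x + f y) \<and>
     (\<forall>c. \<forall>x\<in>vcarrier V. f (vscale V c x) = vscale W c (f x))"

text \<open>The set \<open>Hom(V, W)\<close>; a map is made unique by its value \<open>undefined\<close> outside the carrier of \<open>V\<close>.\<close>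

definition linear_maps ::
  "('k::field, 'v::ab_group_add, 'y) vspace_scheme \<Rightarrow> ('k, 'w::ab_group_add, 'z) vspace_scheme \<Rightarrow>
   ('v \<Rightarrow> 'w) set" where
  "linear_maps V W = {f \<in> extensional (vcarrier V). linear_map V W f}"

definition bilinear_map ::
  "('k::field, 'v::ab_group_add, 'x) vspace_scheme \<Rightarrow> ('k, 'w::ab_group_add, 'y) vspace_scheme \<Rightarrow>
   ('k, 'u::ab_group_add, 'z) vspace_scheme \<Rightarrow> ('v \<Rightarrow> 'w \<Rightarrow> 'u) \<Rightarrow> bool" where
  "bilinear_map V W U f \<longleftrightarrow>
     (\<forall>v\<in>vcarrier V. linear_map W U (f v)) \<and> (\<forall>w\<in>vcarrier W. linear_map V U (\<lambda>v. f v w))"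

section \<open>Tensor products\<close>

text \<open>\<open>V \<otimes> W\<close> is realised inside the dual of the space of bilinear forms on \<open>V \<times> W\<close>: it is spanned
  by the evaluations \<open>v \<otimes> w: \<beta> \<mapsto> \<beta> v w\<close>. That this has the universal property of the tensor
  product is proved below (\<open>tensor_universal\<close>, \<open>tensor_lift_linear\<close>, \<open>tensor_lift_tensor\<close>).\<close>

definition tensor ::
  "('k::field, 'v::ab_group_add, 'y) vspace_scheme \<Rightarrow> ('k, 'w::ab_group_add, 'z) vspace_scheme \<Rightarrow>
   'v \<Rightarrow> 'w \<Rightarrow> (('v \<Rightarrow> 'w \<Rightarrow> 'k) \<Rightarrow> 'k)" where
  "tensor V W v w = (\<lambda>\<beta>. if bilinear_map V W ground \<beta> then \<beta> v w else 0)"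

definition tensor_space ::
  "('k::field, 'v::ab_group_add, 'y) vspace_scheme \<Rightarrow> ('k, 'w::ab_group_add, 'z) vspace_scheme \<Rightarrow>
   ('k, ('v \<Rightarrow> 'w \<Rightarrow> 'k) \<Rightarrow> 'k) vspace" where
  "tensor_space V W =
     \<lparr>vcarrier = module.span (\<lambda>c t \<beta>. c * t \<beta>)
        {tensor V W v w | v w. v \<in> vcarrier V \<and> w \<in> vcarrier W},
      vscale = (\<lambda>c t \<beta>. c * t \<beta>)\<rparr>"

text \<open>The linear map on \<open>V \<otimes> W\<close> induced by a bilinear \<open>f\<close>, i.e. the value \<open>\<Sum> f t' t''\<close> for
  \<open>t = \<Sum> t' \<otimes> t''\<close>. For \<open>t = \<Delta> h\<close> this is the Sweedler sum \<open>\<Sum> f h' h''\<close>.\<close>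

definition tensor_lift ::
  "('k::field, 'v::ab_group_add, 'y) vspace_scheme \<Rightarrow> ('k, 'w::ab_group_add, 'z) vspace_scheme \<Rightarrow>
   ('v \<Rightarrow> 'w \<Rightarrow> 'u::ab_group_add) \<Rightarrow> (('v \<Rightarrow> 'w \<Rightarrow> 'k) \<Rightarrow> 'k) \<Rightarrow> 'u" where
  "tensor_lift V W f t =
     (THE x. \<exists>ps. set ps \<subseteq> vcarrier V \<times> vcarrier W \<and>
        t = (\<Sum>(v, w)\<leftarrow>ps. tensor V W v w) \<and> x = (\<Sum>(v, w)\<leftarrow>ps. f v w))"

definition tensor_map ::
  "('k::field, 'v::ab_group_add, 'y) vspace_scheme \<Rightarrow> ('k, 'w::ab_group_add, 'z) vspace_scheme \<Rightarrow>
   ('k, 'v1::ab_group_add, 'y1) vspace_scheme \<Rightarrow> ('k, 'w1::ab_group_add, 'z1) vspace_scheme \<Rightarrow>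
   ('v \<Rightarrow> 'v1) \<Rightarrow> ('w \<Rightarrow> 'w1) \<Rightarrow>
   (('v \<Rightarrow> 'w \<Rightarrow> 'k) \<Rightarrow> 'k) \<Rightarrow> (('v1 \<Rightarrow> 'w1 \<Rightarrow> 'k) \<Rightarrow> 'k)" where
  "tensor_map V W V1 W1 f g = tensor_lift V W (\<lambda>v w. tensor V1 W1 (f v) (g w))"

text \<open>The associativity isomorphism \<open>(U \<otimes> V) \<otimes> W \<rightarrow> U \<otimes> (V \<otimes> W)\<close>.\<close>

definition tensor_assoc ::
  "('k::field, 'u::ab_group_add, 'x) vspace_scheme \<Rightarrow> ('k, 'v::ab_group_add, 'y) vspace_scheme \<Rightarrow>
   ('k, 'w::ab_group_add, 'z) vspace_scheme \<Rightarrow>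
   (((('u \<Rightarrow> 'v \<Rightarrow> 'k) \<Rightarrow> 'k) \<Rightarrow> 'w \<Rightarrow> 'k) \<Rightarrow> 'k) \<Rightarrow> (('u \<Rightarrow> (('v \<Rightarrow> 'w \<Rightarrow> 'k) \<Rightarrow> 'k) \<Rightarrow> 'k) \<Rightarrow> 'k)" where
  "tensor_assoc U V W =
     tensor_lift (tensor_space U V) W
       (\<lambda>t w. tensor_lift U V (\<lambda>u v. tensor U (tensor_space V W) u (tensor V W v w)) t)"

section \<open>Algebras, Hopf algebras, module algebras\<close>

record ('k, 'v) kalg = "('k, 'v) vspace" +
  amult :: "'v \<Rightarrow> 'v \<Rightarrow> 'v"
  aone :: 'v

locale k_algebra = vspace A for A :: "('k::field, 'v::ab_group_add) kalg" +
  assumes mult_bilinear: "bilinear_map A A A (amult A)"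
    and mult_assoc: "\<lbrakk>x \<in> vcarrier A; y \<in> vcarrier A; z \<in> vcarrier A\<rbrakk>
          \<Longrightarrow> amult A (amult A x y) z = amult A x (amult A y z)"
    and one_carrier: "aone A \<in> vcarrier A"
    and one_left: "x \<in> vcarrier A \<Longrightarrow> amult A (aone A) x = x"
    and one_right: "x \<in> vcarrier A \<Longrightarrow> amult A x (aone A) = x"
    and one_nonzero: "aone A \<noteq> 0"

definition tensor_mult ::
  "('k::field, 'v::ab_group_add) kalg \<Rightarrow> (('v \<Rightarrow> 'v \<Rightarrow> 'k) \<Rightarrow> 'k) \<Rightarrow> (('v \<Rightarrow> 'v \<Rightarrow> 'k) \<Rightarrow> 'k) \<Rightarrow>
   (('v \<Rightarrow> 'v \<Rightarrow> 'k) \<Rightarrow> 'k)" where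
  "tensor_mult A s t =
     tensor_lift A A (\<lambda>a b. tensor_lift A A (\<lambda>c d. tensor A A (amult A a c) (amult A b d)) t) s"

locale hopf_algebra = k_algebra H for H :: "('k::field, 'h::ab_group_add) kalg" +
  fixes comult :: "'h \<Rightarrow> (('h \<Rightarrow> 'h \<Rightarrow> 'k) \<Rightarrow> 'k)"
    and counit :: "'h \<Rightarrow> 'k"
    and antipode :: "'h \<Rightarrow> 'h"
  assumes comult_linear: "linear_map H (tensor_space H H) comult"
    and counit_linear: "linear_map H ground counit"
    and antipode_linear: "linear_map H H antipode"
    and coassoc: "h \<in> vcarrier H \<Longrightarrow>
          tensor_assoc H H H (tensor_map H H (tensor_space H H) H comult (\<lambda>x. x) (comult h)) =
          tensor_map H H H (tensor_space H H) (\<lambda>x. x) comult (comult h)"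
    and counit_left: "h \<in> vcarrier H \<Longrightarrow>
          tensor_lift H H (\<lambda>x y. vscale H (counit x) y) (comult h) = h"
    and counit_right: "h \<in> vcarrier H \<Longrightarrow>
          tensor_lift H H (\<lambda>x y. vscale H (counit y) x) (comult h) = h"
    and comult_mult: "\<lbrakk>g \<in> vcarrier H; h \<in> vcarrier H\<rbrakk> \<Longrightarrow>
          comult (amult H g h) = tensor_mult H (comult g) (comult h)"
    and comult_one: "comult (aone H) = tensor H H (aone H) (aone H)"
    and counit_mult: "\<lbrakk>g \<in> vcarrier H; h \<in> vcarrier H\<rbrakk> \<Longrightarrow>
          counit (amult H g h) = counit g * counit h"
    and counit_one: "counit (aone H) = 1"
    and antipode_left: "h \<in> vcarrier H \<Longrightarrow>
          tensor_lift H H (\<lambda>x y. amult H (antipode x) y) (comult h) = vscale H (counit h) (aone H)"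
    and antipode_right: "h \<in> vcarrier H \<Longrightarrow>
          tensor_lift H H (\<lambda>x y. amult H x (antipode y)) (comult h) = vscale H (counit h) (aone H)"

text \<open>The algebra on a whole type of class \<open>ring_1\<close>, with scalar multiplication \<open>s\<close>.\<close>

definition type_algebra :: "('k::field \<Rightarrow> 'a \<Rightarrow> 'a) \<Rightarrow> ('k, 'a::ring_1) kalg" where
  "type_algebra s = \<lparr>vcarrier = UNIV, vscale = s, amult = (*), aone = 1\<rparr>"

text \<open>Here \<open>act h a\<close> is \<open>h a\<close>.\<close>

locale module_algebra = hopf_algebra H comult counit antipode + A: k_algebra "type_algebra s"
  for H :: "('k::field, 'h::ab_group_add) kalg" and comult counit antipode
    and s :: "'k \<Rightarrow> 'a \<Rightarrow> 'a::ring_1" +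
  fixes act :: "'h \<Rightarrow> 'a \<Rightarrow> 'a"
  assumes act_bilinear: "bilinear_map H (type_algebra s) (type_algebra s) act"
    and act_mult: "\<lbrakk>g \<in> vcarrier H; h \<in> vcarrier H\<rbrakk> \<Longrightarrow> act (amult H g h) a = act g (act h a)"
    and act_one: "act (aone H) a = a"
    and act_prod: "h \<in> vcarrier H \<Longrightarrow>
          act h (a * b) = tensor_lift H H (\<lambda>x y. act x a * act y b) (comult h)"
    and act_unit: "h \<in> vcarrier H \<Longrightarrow> act h 1 = s (counit h) 1"

section \<open>Galois extensions\<close>

context
  fixes H :: "('k::field, 'h::ab_group_add) kalg"
    and s :: "'k \<Rightarrow> 'a \<Rightarrow> 'a::ring_1"
    and act :: "'h \<Rightarrow> 'a \<Rightarrow> 'a"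
begin

definition galois_pi :: "(('a \<Rightarrow> 'h \<Rightarrow> 'k) \<Rightarrow> 'k) \<Rightarrow> 'a \<Rightarrow> 'a" where
  "galois_pi t = (\<lambda>b. tensor_lift (type_algebra s) H (\<lambda>a h. a * act h b) t)"

definition galois_pi' :: "(('a \<Rightarrow> 'h \<Rightarrow> 'k) \<Rightarrow> 'k) \<Rightarrow> 'a \<Rightarrow> 'a" where
  "galois_pi' t = (\<lambda>b. tensor_lift (type_algebra s) H (\<lambda>a h. act h b * a) t)"

definition galois_gamma :: "(('a \<Rightarrow> 'a \<Rightarrow> 'k) \<Rightarrow> 'k) \<Rightarrow> 'h \<Rightarrow> 'a" where
  "galois_gamma t =
     (\<lambda>h\<in>vcarrier H. tensor_lift (type_algebra s) (type_algebra s) (\<lambda>a b. a * act h b) t)"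

definition galois_gamma' :: "(('a \<Rightarrow> 'a \<Rightarrow> 'k) \<Rightarrow> 'k) \<Rightarrow> 'h \<Rightarrow> 'a" where
  "galois_gamma' t =
     (\<lambda>h\<in>vcarrier H. tensor_lift (type_algebra s) (type_algebra s) (\<lambda>a b. act h a * b) t)"

end

locale galois = module_algebra H comult counit antipode s act
  for H :: "('k::field, 'h::ab_group_add) kalg" and comult counit antipode
    and s :: "'k \<Rightarrow> 'a \<Rightarrow> 'a::ring_1" and act +
  assumes fin_dim: "fin_dim H"
    and pi_bij: "bij_betw (galois_pi H s act)
          (vcarrier (tensor_space (type_algebra s) H)) (linear_maps (type_algebra s) (type_algebra s))"
    and pi'_bij: "bij_betw (galois_pi' H s act)
          (vcarrier (tensor_space (type_algebra s) H)) (linear_maps (type_algebra s) (type_algebra s))"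
    and gamma_bij: "bij_betw (galois_gamma H s act)
          (vcarrier (tensor_space (type_algebra s) (type_algebra s))) (linear_maps H (type_algebra s))"
    and gamma'_bij: "bij_betw (galois_gamma' H s act)
          (vcarrier (tensor_space (type_algebra s) (type_algebra s))) (linear_maps H (type_algebra s))"

definition module_endo ::
  "('k::field, 'h::ab_group_add) kalg \<Rightarrow> ('k \<Rightarrow> 'a \<Rightarrow> 'a::ring_1) \<Rightarrow> ('h \<Rightarrow> 'a \<Rightarrow> 'a) \<Rightarrow>
   ('k, 'a \<Rightarrow> 'a) kalg" where
  "module_endo H s act =
     \<lparr>vcarrier = {f \<in> linear_maps (type_algebra s) (type_algebra s).
                   \<forall>h\<in>vcarrier H. \<forall>a. f (act h a) = act h (f a)},
      vscale = (\<lambda>c f a. s c (f a)), amult = (\<circ>), aone = id\<rparr>"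

section \<open>The universal property of the tensor product\<close>

lemma vector_space_fun:
  assumes "vector_space s"
  shows "vector_space (\<lambda>c f x. s c (f x))"
proof -
  interpret vector_space s by fact
  show ?thesis
    by unfold_locales (auto simp: fun_eq_iff scale_right_distrib scale_left_distrib)
qed

lemma vector_space_field: "vector_space ((*) :: 'k::field \<Rightarrow> 'k \<Rightarrow> 'k)"
  by unfold_locales (auto simp: algebra_simps)

lemma vector_space_tensor: "vector_space (\<lambda>(c::'k::field) (t::'b \<Rightarrow> 'k) \<beta>. c * t \<beta>)"
  by (rule vector_space_fun[OF vector_space_field])

lemma vspace_tensor_space:
  fixes V :: "('k::field, 'v::ab_group_add, 'y) vspace_scheme"
    and W :: "('k, 'w::ab_group_add, 'z) vspace_scheme"
  shows "vspace (tensor_space V W)"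
proof -
  interpret T: vector_space "\<lambda>(c::'k) (t::('v \<Rightarrow> 'w \<Rightarrow> 'k) \<Rightarrow> 'k) \<beta>. c * t \<beta>"
    by (rule vector_space_tensor)
  show ?thesis
    unfolding vspace_def tensor_space_def vspace.simps
    by (intro conjI T.vector_space_axioms T.subspace_span)
qed

lemma separating_functional:
  fixes s :: "'k::field \<Rightarrow> 'v::ab_group_add \<Rightarrow> 'v"
  assumes "vector_space s" "x \<noteq> 0"
  obtains \<phi> where "Vector_Spaces.linear s (*) \<phi>" "\<phi> x \<noteq> 0"
proof -
  interpret vector_space_pair s "(*) :: 'k \<Rightarrow> 'k \<Rightarrow> 'k"
    using assms vector_space_field by (simp add: vector_space_pair_def)
  have i: "vs1.independent {x}"
    using assms by simp
  show ?thesis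
    using linear_construct[OF i, of "\<lambda>_. 1"] construct_basis[OF i, of x "\<lambda>_. 1"]
    by (intro that) auto
qed

lemma linear_map_sum_list:
  assumes "vspace V" "vspace U" "linear_map V U \<phi>" "set ps \<subseteq> P" "\<And>p. p \<in> P \<Longrightarrow> g p \<in> vcarrier V"
  shows "\<phi> (\<Sum>p\<leftarrow>ps. g p) = (\<Sum>p\<leftarrow>ps. \<phi> (g p))" and "(\<Sum>p\<leftarrow>ps. g p) \<in> vcarrier V"
proof -
  interpret V: vector_space "vscale V" using assms(1) by (simp add: vspace_def)
  interpret U: vector_space "vscale U" using assms(2) by (simp add: vspace_def)
  have sub: "V.subspace (vcarrier V)" using assms(1) by (simp add: vspace_def)
  have zero: "\<phi> 0 = 0"
    using assms(3) V.subspace_0[OF sub] unfolding linear_map_def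
    by (metis V.scale_zero_left U.scale_zero_left)
  have "\<phi> (\<Sum>p\<leftarrow>ps. g p) = (\<Sum>p\<leftarrow>ps. \<phi> (g p)) \<and> (\<Sum>p\<leftarrow>ps. g p) \<in> vcarrier V"
    using assms(4)
  proof (induction ps)
    case Nil
    then show ?case using zero V.subspace_0[OF sub] by simp
  next
    case (Cons p ps)
    then show ?case
      using assms(3,5) V.subspace_add[OF sub] by (auto simp: linear_map_def)
  qed
  then show "\<phi> (\<Sum>p\<leftarrow>ps. g p) = (\<Sum>p\<leftarrow>ps. \<phi> (g p))" "(\<Sum>p\<leftarrow>ps. g p) \<in> vcarrier V"
    by auto
qed

lemma tensor_sum_determines:
  assumes U: "vspace U" and f: "bilinear_map V W U f"
    and ps: "set ps \<subseteq> vcarrier V \<times> vcarrier W" and qs: "set qs \<subseteq> vcarrier V \<times> vcarrier W"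
    and eq: "(\<Sum>(v, w)\<leftarrow>ps. tensor V W v w) = (\<Sum>(v, w)\<leftarrow>qs. tensor V W v w)"
  shows "(\<Sum>(v, w)\<leftarrow>ps. f v w) = (\<Sum>(v, w)\<leftarrow>qs. f v w)"
proof (rule ccontr)
  let ?d = "(\<Sum>(v, w)\<leftarrow>ps. f v w) - (\<Sum>(v, w)\<leftarrow>qs. f v w)"
  assume "\<not> ?thesis"
  then have "?d \<noteq> 0" by simp
  then obtain \<phi> where \<phi>: "Vector_Spaces.linear (vscale U) (*) \<phi>" "\<phi> ?d \<noteq> 0"
    using separating_functional U unfolding vspace_def by metis
  interpret \<phi>: Vector_Spaces.linear "vscale U" "(*)" \<phi> by fact
  define \<beta> where "\<beta> = (\<lambda>v w. \<phi> (f v w))"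
  have \<beta>: "bilinear_map V W ground \<beta>"
    using f unfolding bilinear_map_def linear_map_def ground_def \<beta>_def
    by (simp add: \<phi>.add \<phi>.scale)
  have val: "\<phi> (\<Sum>(v, w)\<leftarrow>rs. f v w) = (\<Sum>(v, w)\<leftarrow>rs. tensor V W v w) \<beta>" for rs
    by (induction rs) (auto simp: tensor_def \<beta> \<phi>.add \<phi>.zero, simp add: \<beta>_def)
  show False
    using \<phi>(2) eq val by (simp add: \<phi>.diff)
qed

lemma tensor_lift_sum:
  assumes "vspace U" "bilinear_map V W U f" "set ps \<subseteq> vcarrier V \<times> vcarrier W"
  shows "tensor_lift V W f (\<Sum>(v, w)\<leftarrow>ps. tensor V W v w) = (\<Sum>(v, w)\<leftarrow>ps. f v w)"
  unfolding tensor_lift_def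
proof (rule the_equality)
  show "\<exists>qs. set qs \<subseteq> vcarrier V \<times> vcarrier W \<and>
      (\<Sum>(v, w)\<leftarrow>ps. tensor V W v w) = (\<Sum>(v, w)\<leftarrow>qs. tensor V W v w) \<and>
      (\<Sum>(v, w)\<leftarrow>ps. f v w) = (\<Sum>(v, w)\<leftarrow>qs. f v w)"
    using assms(3) by (intro exI[of _ ps]) simp
next
  fix x
  assume "\<exists>qs. set qs \<subseteq> vcarrier V \<times> vcarrier W \<and>
      (\<Sum>(v, w)\<leftarrow>ps. tensor V W v w) = (\<Sum>(v, w)\<leftarrow>qs. tensor V W v w) \<and>
      x = (\<Sum>(v, w)\<leftarrow>qs. f v w)"
  then obtain qs where qs: "set qs \<subseteq> vcarrier V \<times> vcarrier W"
      "(\<Sum>(v, w)\<leftarrow>ps. tensor V W v w) = (\<Sum>(v, w)\<leftarrow>qs. tensor V W v w)"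
      "x = (\<Sum>(v, w)\<leftarrow>qs. f v w)"
    by (elim exE conjE)
  then show "x = (\<Sum>(v, w)\<leftarrow>ps. f v w)"
    using tensor_sum_determines[OF assms qs(1,2)] by simp
qed

lemma tensor_scale_left:
  assumes "v \<in> vcarrier V" "w \<in> vcarrier W"
  shows "tensor V W (vscale V c v) w = (\<lambda>\<beta>. c * tensor V W v w \<beta>)"
  using assms by (auto simp: fun_eq_iff tensor_def bilinear_map_def linear_map_def ground_def)

lemma tensor_bilinear:
  fixes V :: "('k::field, 'v::ab_group_add, 'y) vspace_scheme"
    and W :: "('k, 'w::ab_group_add, 'z) vspace_scheme"
  shows "bilinear_map V W (tensor_space V W) (tensor V W)"
proof -
  interpret T: vector_space "\<lambda>(c::'k) (t::('v \<Rightarrow> 'w \<Rightarrow> 'k) \<Rightarrow> 'k) \<beta>. c * t \<beta>"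
    by (rule vector_space_tensor)
  have "tensor V W v w \<in> vcarrier (tensor_space V W)"
    if "v \<in> vcarrier V" "w \<in> vcarrier W" for v w
    using that unfolding tensor_space_def by (auto intro: T.span_base)
  moreover have "tensor V W (v + v') w = tensor V W v w + tensor V W v' w"
    if "v \<in> vcarrier V" "v' \<in> vcarrier V" "w \<in> vcarrier W" for v v' w
    using that by (simp add: fun_eq_iff tensor_def bilinear_map_def linear_map_def)
  moreover have "tensor V W v (w + w') = tensor V W v w + tensor V W v w'"
    if "v \<in> vcarrier V" "w \<in> vcarrier W" "w' \<in> vcarrier W" for v w w'
    using that by (simp add: fun_eq_iff tensor_def bilinear_map_def linear_map_def)
  moreover have "tensor V W v (vscale W c w) = (\<lambda>\<beta>. c * tensor V W v w \<beta>)"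
    if "v \<in> vcarrier V" "w \<in> vcarrier W" for c v w
    using that by (simp add: fun_eq_iff tensor_def bilinear_map_def linear_map_def ground_def)
  moreover have "vscale (tensor_space V W) = (\<lambda>c t \<beta>. c * t \<beta>)"
    by (simp add: tensor_space_def)
  ultimately show ?thesis
    unfolding bilinear_map_def linear_map_def by (simp add: Pi_iff tensor_scale_left)
qed

lemma tensor_space_sum:
  fixes V :: "('k::field, 'v::ab_group_add, 'y) vspace_scheme"
    and W :: "('k, 'w::ab_group_add, 'z) vspace_scheme"
  assumes V: "vspace V" and t: "t \<in> vcarrier (tensor_space V W)"
  obtains ps where "set ps \<subseteq> vcarrier V \<times> vcarrier W" "t = (\<Sum>(v, w)\<leftarrow>ps. tensor V W v w)"
proof -
  interpret T: vector_space "\<lambda>(c::'k) (t::('v \<Rightarrow> 'w \<Rightarrow> 'k) \<Rightarrow> 'k) \<beta>. c * t \<beta>"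
    by (rule vector_space_tensor)
  interpret V: vector_space "vscale V" using V by (simp add: vspace_def)
  have sub: "V.subspace (vcarrier V)" using V by (simp add: vspace_def)
  have "\<exists>ps. set ps \<subseteq> vcarrier V \<times> vcarrier W \<and> t = (\<Sum>(v, w)\<leftarrow>ps. tensor V W v w)"
    using t unfolding tensor_space_def vspace.simps
  proof (induction rule: T.span_induct_alt)
    case base
    then show ?case by (intro exI[of _ "[]"]) simp
  next
    case (step c x y)
    then obtain v w ps where *: "x = tensor V W v w" "v \<in> vcarrier V" "w \<in> vcarrier W"
      "set ps \<subseteq> vcarrier V \<times> vcarrier W" "y = (\<Sum>(v, w)\<leftarrow>ps. tensor V W v w)"
      by auto
    then show ?case
      using V.subspace_scale[OF sub]
      by (intro exI[of _ "(vscale V c v, w) # ps"]) (simp add: tensor_scale_left)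
  qed
  then show ?thesis using that by blast
qed

lemma tensor_lift_linear:
  assumes V: "vspace V" and U: "vspace U" and f: "bilinear_map V W U f"
  shows "linear_map (tensor_space V W) U (tensor_lift V W f)"
proof -
  interpret V: vector_space "vscale V" using V by (simp add: vspace_def)
  interpret U: vector_space "vscale U" using U by (simp add: vspace_def)
  have subV: "V.subspace (vcarrier V)" using V by (simp add: vspace_def)
  have subU: "U.subspace (vcarrier U)" using U by (simp add: vspace_def)
  note lift = tensor_lift_sum[OF U f]
  have mem: "tensor_lift V W f t \<in> vcarrier U" if t: "t \<in> vcarrier (tensor_space V W)" for t
  proof -
    obtain ps where ps: "set ps \<subseteq> vcarrier V \<times> vcarrier W" "t = (\<Sum>(v, w)\<leftarrow>ps. tensor V W v w)"
      using tensor_space_sum[OF V t] .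
    have "(\<Sum>(v, w)\<leftarrow>ps. f v w) \<in> vcarrier U"
      using ps(1) f subU
      by (induction ps)
         (auto simp: U.subspace_0 bilinear_map_def linear_map_def Pi_iff intro!: U.subspace_add)
    then show ?thesis using lift ps by simp
  qed
  have add: "tensor_lift V W f (t + u) = tensor_lift V W f t + tensor_lift V W f u"
    if t: "t \<in> vcarrier (tensor_space V W)" and u: "u \<in> vcarrier (tensor_space V W)" for t u
  proof -
    obtain ps where ps: "set ps \<subseteq> vcarrier V \<times> vcarrier W" "t = (\<Sum>(v, w)\<leftarrow>ps. tensor V W v w)"
      using tensor_space_sum[OF V t] .
    obtain qs where qs: "set qs \<subseteq> vcarrier V \<times> vcarrier W" "u = (\<Sum>(v, w)\<leftarrow>qs. tensor V W v w)"
      using tensor_space_sum[OF V u] .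
    show ?thesis
      using lift[of "ps @ qs"] lift[of ps] lift[of qs] ps qs by simp
  qed
  have scale: "tensor_lift V W f (vscale (tensor_space V W) c t) = vscale U c (tensor_lift V W f t)"
    if t: "t \<in> vcarrier (tensor_space V W)" for c t
  proof -
    obtain ps where ps: "set ps \<subseteq> vcarrier V \<times> vcarrier W" "t = (\<Sum>(v, w)\<leftarrow>ps. tensor V W v w)"
      using tensor_space_sum[OF V t] .
    define qs where "qs = map (\<lambda>(v, w). (vscale V c v, w)) ps"
    have qs: "set qs \<subseteq> vcarrier V \<times> vcarrier W"
      using ps(1) V.subspace_scale[OF subV] by (auto simp: qs_def)
    have "vscale (tensor_space V W) c (\<Sum>(v, w)\<leftarrow>ps. tensor V W v w) =
        (\<Sum>(v, w)\<leftarrow>qs. tensor V W v w)"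
      unfolding qs_def using ps(1)
      by (induction ps) (auto simp: tensor_space_def tensor_scale_left fun_eq_iff distrib_left)
    moreover have "vscale U c (\<Sum>(v, w)\<leftarrow>ps. f v w) = (\<Sum>(v, w)\<leftarrow>qs. f v w)"
      unfolding qs_def using ps(1) f
      by (induction ps) (auto simp: bilinear_map_def linear_map_def U.scale_right_distrib)
    ultimately show ?thesis
      using lift[OF ps(1)] lift[OF qs] ps(2) by simp
  qed
  show ?thesis
    unfolding linear_map_def using mem add scale by auto
qed

lemma tensor_lift_tensor:
  assumes "vspace U" "bilinear_map V W U f" "v \<in> vcarrier V" "w \<in> vcarrier W"
  shows "tensor_lift V W f (tensor V W v w) = f v w"
  using tensor_lift_sum[OF assms(1,2), of "[(v, w)]"] assms by simp

theorem tensor_universal: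
  assumes V: "vspace V" and U: "vspace U" and f: "bilinear_map V W U f"
  shows "\<exists>!g. g \<in> linear_maps (tensor_space V W) U \<and>
           (\<forall>v\<in>vcarrier V. \<forall>w\<in>vcarrier W. g (tensor V W v w) = f v w)"
proof (rule ex1I)
  have T: "tensor V W v w \<in> vcarrier (tensor_space V W)"
    if "v \<in> vcarrier V" "w \<in> vcarrier W" for v w
    using tensor_bilinear[of V W] that by (auto simp: bilinear_map_def linear_map_def)
  let ?g = "restrict (tensor_lift V W f) (vcarrier (tensor_space V W))"
  interpret vspace "tensor_space V W" by (rule vspace_tensor_space)
  interpret T: vector_space "vscale (tensor_space V W)" by (rule ambient)
  have "linear_map (tensor_space V W) U ?g"
    using tensor_lift_linear[OF V U f]
      T.subspace_add[OF subspace_carrier] T.subspace_scale[OF subspace_carrier]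
    by (auto simp: linear_map_def)
  then show "?g \<in> linear_maps (tensor_space V W) U \<and>
      (\<forall>v\<in>vcarrier V. \<forall>w\<in>vcarrier W. ?g (tensor V W v w) = f v w)"
    using T tensor_lift_tensor[OF U f] by (auto simp: linear_maps_def)
  fix g
  assume g: "g \<in> linear_maps (tensor_space V W) U \<and>
      (\<forall>v\<in>vcarrier V. \<forall>w\<in>vcarrier W. g (tensor V W v w) = f v w)"
  show "g = ?g"
  proof (rule extensionalityI)
    fix t assume t: "t \<in> vcarrier (tensor_space V W)"
    then obtain ps where ps: "set ps \<subseteq> vcarrier V \<times> vcarrier W"
        "t = (\<Sum>(v, w)\<leftarrow>ps. tensor V W v w)"
      using tensor_space_sum[OF V] by blast
    have "g t = (\<Sum>p\<leftarrow>ps. g (case p of (v, w) \<Rightarrow> tensor V W v w))"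
      unfolding ps(2)
      by (rule linear_map_sum_list(1)[OF vspace_tensor_space U _ ps(1)]) (use g T in \<open>auto simp: linear_maps_def\<close>)
    also have "\<dots> = (\<Sum>(v, w)\<leftarrow>ps. f v w)"
      using ps(1) g by (intro arg_cong[where f = sum_list] map_cong) auto
    also have "\<dots> = ?g t"
      using tensor_lift_sum[OF U f ps(1)] ps(2) t by simp
    finally show "g t = ?g t" .
  qed (use g in \<open>auto simp: linear_maps_def\<close>)
qed

end

theory Submission
  imports Defs
begin

text \<open>
  That \<open>E\<close> is Galois and that \<open>H\<close> is its commutant is linear algebra: it holds for every algebra \<open>H\<close> acting
  on \<open>A\<close> for which the maps \<open>\<pi>\<close>, \<open>\<pi>'\<close>, \<open>\<gamma>\<close>, \<open>\<gamma>'\<close> are bijective.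
  Injectivity of \<open>\<gamma>\<close> makes \<open>A \<otimes> E \<rightarrow> End A\<close> injective: if \<open>\<Sum> a f(b) = 0\<close> for all \<open>b\<close>, then
  \<open>\<Sum> a (h f(b)) = \<Sum> a f(h b) = 0\<close> for all \<open>h\<close>, hence \<open>\<Sum> a \<otimes> f(b) = 0\<close> (\<open>pi_faithful_commutant\<close>). It is surjective
  because right translation by \<open>k \<in> H\<close> on \<open>Hom(H, A)\<close>, transported to \<open>A \<otimes> A\<close> by \<open>\<gamma>\<close>, commutes with the action of
  \<open>H\<close> on the second factor; its matrix entries with respect to the first factor lie in \<open>E\<close> and express the
  operators \<open>y \<mapsto> x (k y)\<close>, which span \<open>End A\<close> by \<open>\<pi>\<close> (\<open>pi_full_commutant\<close>). The same lemmas for the opposite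
  product of \<open>A\<close> treat \<open>\<pi>'\<close>, and by dual bases bijectivity of \<open>\<pi>\<close> for one product gives that of \<open>\<gamma>\<close> for the
  opposite one (\<open>gamma_bijective_flip\<close>). If \<open>g = \<Sum> a h\<close> commutes with \<open>E\<close>, uniqueness of coefficients over
  the commutant of \<open>E\<close> forces \<open>1 \<otimes> g = \<Sum> a \<otimes> h\<close> and so \<open>g \<in> H\<close> (\<open>double_commutant\<close>).

  For the Hopf structure of \<open>E\<close> let \<open>e\<close> run through a basis of \<open>E\<close>. The preimages of the coordinate functionals
  under \<open>\<gamma>'\<close> and \<open>\<gamma>\<close> for \<open>E\<close> give, for each \<open>f \<in> E\<close>, unique operators \<open>a\<^sub>e\<close> and \<open>b\<^sub>e\<close> with \<open>f(x y) = \<Sum> a\<^sub>e(x) e(y)\<close> and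
  \<open>f(x) y = \<Sum> b\<^sub>e(x e(y))\<close> (\<open>gamma_expansion\<close>). They commute with \<open>H\<close>: for \<open>a\<^sub>e\<close> this follows from the
  identity \<open>h(x) y = \<Sum> h'(x (S(h'') y))\<close>, for \<open>b\<^sub>e\<close> from \<open>h(x y) = \<Sum> h'(x) h''(y)\<close> (\<open>coefficient_in_E\<close>,
  \<open>twisted_coefficient_in_E\<close>). Moreover \<open>f(1)\<close> is a scalar \<open>\<epsilon>(f)\<close>, because the invariants of \<open>A\<close> are the scalars.
  So \<open>\<Delta> f = \<Sum> a\<^sub>e \<otimes> e\<close> and \<open>S f = \<Sum> \<epsilon>(b\<^sub>e) e\<close> are defined in \<open>E\<close>. A tensor of two or three elements of \<open>E\<close> is determined
  by the multilinear map that it induces on \<open>A\<close> (\<open>evaluation_faithful\<close>). This reduces the axioms to identities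
  between operators, such as \<open>f((x y) z) = f(x (y z))\<close> for coassociativity, and makes \<open>\<Delta>\<close> unique.
\<close>

section \<open>Tensors as lists of pairs\<close>

text \<open>A tensor is handled through a list \<open>ps\<close> of pairs with \<open>\<Sum> v \<otimes> w\<close> over \<open>ps\<close> as its value. The list is
  not unique, but every bilinear \<open>F\<close> has the same \<open>pair_sum ps F\<close> for all lists of one tensor, and this
  is the value at the tensor of the linear map induced by \<open>F\<close>.\<close>

definition pair_sum :: "('a \<times> 'b) list \<Rightarrow> ('a \<Rightarrow> 'b \<Rightarrow> 'c::ab_group_add) \<Rightarrow> 'c" where
  "pair_sum ps F = (\<Sum>(v, w)\<leftarrow>ps. F v w)"

lemma pair_sum_simps [simp]:
  "pair_sum [] F = 0"
  "pair_sum ((v, w) # ps) F = F v w + pair_sum ps F"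
  "pair_sum (ps @ qs) F = pair_sum ps F + pair_sum qs F"
  by (auto simp: pair_sum_def)

lemma pair_sum_map:
  "pair_sum (map (\<lambda>(v, w). (f v w, g v w)) ps) F = pair_sum ps (\<lambda>v w. F (f v w) (g v w))"
  by (induction ps) auto

lemma pair_sum_swap: "pair_sum (map prod.swap ps) F = pair_sum ps (\<lambda>v w. F w v)"
  by (induction ps) auto

lemma pair_sum_concat:
  "pair_sum (concat (map f xs)) F = (\<Sum>x\<leftarrow>xs. pair_sum (f x) F)"
  by (induction xs) auto

lemma pair_sum_cong:
  assumes "\<And>v w. (v, w) \<in> set ps \<Longrightarrow> F v w = G v w"
  shows "pair_sum ps F = pair_sum ps G"
  using assms by (induction ps) auto

lemma pair_sum_add: "pair_sum ps (\<lambda>v w. F v w + G v w) = pair_sum ps F + pair_sum ps G"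
  by (induction ps) (auto simp: algebra_simps)

lemma pair_sum_uminus: "pair_sum ps (\<lambda>v w. - F v w) = - pair_sum ps F"
  by (induction ps) auto

lemma pair_sum_zero [simp]: "pair_sum ps (\<lambda>v w. 0) = 0"
  by (induction ps) auto

lemma pair_sum_hom:
  assumes "\<phi> 0 = 0" "\<And>x y. \<phi> (x + y) = \<phi> x + \<phi> y"
  shows "\<phi> (pair_sum ps F) = pair_sum ps (\<lambda>v w. \<phi> (F v w))"
  using assms by (induction ps) auto

lemma pair_sum_sum:
  "pair_sum ps (\<lambda>v w. \<Sum>i\<in>I. F i v w) = (\<Sum>i\<in>I. pair_sum ps (F i))"
  by (induction ps) (auto simp: sum.distrib)

lemma pair_sum_commute:
  "pair_sum ps (\<lambda>v w. pair_sum qs (F v w)) = pair_sum qs (\<lambda>x y. pair_sum ps (\<lambda>v w. F v w x y))"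
  by (induction ps) (auto simp: pair_sum_add)

lemma pair_sum_apply: "pair_sum ps F x = pair_sum ps (\<lambda>v w. F v w x)"
  by (induction ps) auto

lemma pair_sum_concat_distinct:
  assumes "distinct xs"
  shows "pair_sum (concat (map f xs)) F = (\<Sum>x\<in>set xs. pair_sum (f x) F)"
  using assms by (simp add: pair_sum_concat sum_list_distinct_conv_sum_set)

section \<open>Vector spaces\<close>

lemma (in vspace) carrier_closed:
  shows carrier_zero: "0 \<in> vcarrier V"
    and carrier_add: "\<lbrakk>x \<in> vcarrier V; y \<in> vcarrier V\<rbrakk> \<Longrightarrow> x + y \<in> vcarrier V"
    and carrier_scale: "x \<in> vcarrier V \<Longrightarrow> vscale V c x \<in> vcarrier V"
    and carrier_uminus: "x \<in> vcarrier V \<Longrightarrow> - x \<in> vcarrier V"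
proof -
  interpret vector_space "vscale V" by (rule ambient)
  show "0 \<in> vcarrier V" using subspace_0[OF subspace_carrier] .
  show "\<lbrakk>x \<in> vcarrier V; y \<in> vcarrier V\<rbrakk> \<Longrightarrow> x + y \<in> vcarrier V"
    using subspace_add[OF subspace_carrier] .
  show "x \<in> vcarrier V \<Longrightarrow> vscale V c x \<in> vcarrier V"
    using subspace_scale[OF subspace_carrier] .
  show "x \<in> vcarrier V \<Longrightarrow> - x \<in> vcarrier V"
    using subspace_neg[OF subspace_carrier] .
qed

lemma (in vspace) carrier_pair_sum:
  assumes "\<And>v w. (v, w) \<in> set ps \<Longrightarrow> F v w \<in> vcarrier V"
  shows "pair_sum ps F \<in> vcarrier V"
  using assms by (induction ps) (auto simp: carrier_zero carrier_add)

lemma (in vspace) carrier_sum: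
  assumes "\<And>i. i \<in> I \<Longrightarrow> f i \<in> vcarrier V"
  shows "sum f I \<in> vcarrier V"
  using assms by (induction I rule: infinite_finite_induct) (auto simp: carrier_zero carrier_add)

lemma vspace_ground: "vspace ground"
proof -
  interpret vector_space "(*) :: 'a \<Rightarrow> 'a \<Rightarrow> 'a" by (rule vector_space_field)
  show ?thesis
    unfolding vspace_def ground_def using vector_space_field by simp
qed

lemma linear_mapD:
  assumes "linear_map V W f" "x \<in> vcarrier V"
  shows linear_map_carrier: "f x \<in> vcarrier W"
    and linear_map_add: "y \<in> vcarrier V \<Longrightarrow> f (x + y) = f x + f y"
    and linear_map_scale: "f (vscale V c x) = vscale W c (f x)"
  using assms by (auto simp: linear_map_def)

lemma linear_map_zero:
  assumes "vspace V" "linear_map V W f"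
  shows "f 0 = 0"
proof -
  have "f (0 + 0) = f 0 + f 0"
    using linear_map_add[OF assms(2)] vspace.carrier_zero[OF assms(1)] by blast
  then show ?thesis by simp
qed

lemma linear_map_pair_sum:
  assumes "vspace V" "linear_map V W f" "\<And>v w. (v, w) \<in> set ps \<Longrightarrow> F v w \<in> vcarrier V"
  shows "f (pair_sum ps F) = pair_sum ps (\<lambda>v w. f (F v w))"
  using assms(3)
  by (induction ps)
     (auto simp: linear_map_zero[OF assms(1,2)] linear_map_add[OF assms(2)]
       vspace.carrier_pair_sum[OF assms(1)])

lemma linear_map_sum:
  assumes "vspace V" "linear_map V W f" "\<And>i. i \<in> I \<Longrightarrow> g i \<in> vcarrier V"
  shows "f (sum g I) = (\<Sum>i\<in>I. f (g i))"
  using assms(3)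
  by (induction I rule: infinite_finite_induct)
     (auto simp: linear_map_zero[OF assms(1,2)] linear_map_add[OF assms(2)]
       vspace.carrier_sum[OF assms(1)])

text \<open>The coordinate functionals are taken on the whole ambient space: a functional on the span of
  \<open>B\<close> extends, and functionals on the ambient space restrict to every subspace.\<close>

lemma basis_coordinates:
  fixes s :: "'k::field \<Rightarrow> 'v::ab_group_add \<Rightarrow> 'v"
  assumes "vector_space s" "finite B" "\<not> module.dependent s B"
  obtains d where "\<And>b. b \<in> B \<Longrightarrow> Vector_Spaces.linear s (*) (d b)"
    "\<And>b c. \<lbrakk>b \<in> B; c \<in> B\<rbrakk> \<Longrightarrow> d b c = (if b = c then 1 else 0)"
    "\<And>v. v \<in> module.span s B \<Longrightarrow> v = (\<Sum>b\<in>B. s (d b v) b)"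
proof -
  interpret vector_space_pair s "(*) :: 'k \<Rightarrow> 'k \<Rightarrow> 'k"
    using assms vector_space_field by (simp add: vector_space_pair_def)
  define d where "d b = construct B (\<lambda>c. if b = c then 1 else 0)" for b
  have lin: "Vector_Spaces.linear s (*) (d b)" for b
    unfolding d_def by (rule linear_construct[OF assms(3)])
  have delta: "d b c = (if b = c then 1 else 0)" if "c \<in> B" for b c
    unfolding d_def by (rule construct_basis[OF assms(3) that])
  have "v = (\<Sum>b\<in>B. s (d b v) b)" if "v \<in> vs1.span B" for v
    using that
  proof (induction rule: vs1.span_induct_alt)
    case base
    then show ?case using lin by (simp add: linear_0)
  next
    case (step c x y)
    have "(\<Sum>b\<in>B. s (d b (s c x)) b) = (\<Sum>b\<in>B. if b = x then s c x else 0)"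
    proof (rule sum.cong[OF refl])
      fix b assume "b \<in> B"
      show "s (d b (s c x)) b = (if b = x then s c x else 0)"
        using step delta[of x b] by (simp add: linear_scale[OF lin])
    qed
    also have "\<dots> = s c x" using step assms(2) by simp
    finally show ?case
      using step by (simp add: linear_add[OF lin] vs1.scale_left_distrib sum.distrib)
  qed
  then show ?thesis using that lin delta by blast
qed

definition dual_bases where
  "dual_bases V B d \<longleftrightarrow> finite B \<and> B \<subseteq> vcarrier V \<and>
     (\<forall>b\<in>B. Vector_Spaces.linear (vscale V) (*) (d b)) \<and>
     (\<forall>b\<in>B. \<forall>c\<in>B. d b c = (if b = c then 1 else 0)) \<and>
     (\<forall>v\<in>vcarrier V. v = (\<Sum>b\<in>B. vscale V (d b v) b))"

lemma dual_basesD: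
  assumes "dual_bases V B d"
  shows dual_bases_finite: "finite B"
    and dual_bases_subset: "B \<subseteq> vcarrier V"
    and dual_bases_linear: "b \<in> B \<Longrightarrow> Vector_Spaces.linear (vscale V) (*) (d b)"
    and dual_bases_delta: "\<lbrakk>b \<in> B; c \<in> B\<rbrakk> \<Longrightarrow> d b c = (if b = c then 1 else 0)"
    and dual_bases_expand: "v \<in> vcarrier V \<Longrightarrow> v = (\<Sum>b\<in>B. vscale V (d b v) b)"
  using assms by (auto simp: dual_bases_def)

lemma fin_dim_dual_bases:
  fixes V :: "('k::field, 'v::ab_group_add, 'z) vspace_scheme"
  assumes V: "vspace V" and "fin_dim V"
  obtains B d where "dual_bases V B d"
proof -
  interpret vector_space "vscale V" using V by (simp add: vspace_def)
  obtain S where S: "finite S" "span S = vcarrier V"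
    using assms(2) by (auto simp: fin_dim_def)
  obtain B where B: "B \<subseteq> S" "independent B" "S \<subseteq> span B"
    using maximal_independent_subset by blast
  then have span: "span B = vcarrier V"
    using S by (metis span_mono span_span subset_antisym)
  have fin: "finite B" using B S finite_subset by blast
  obtain d where d: "\<And>b. b \<in> B \<Longrightarrow> Vector_Spaces.linear (vscale V) (*) (d b)"
    "\<And>b c. \<lbrakk>b \<in> B; c \<in> B\<rbrakk> \<Longrightarrow> d b c = (if b = c then 1 else 0)"
    "\<And>v. v \<in> span B \<Longrightarrow> v = (\<Sum>b\<in>B. vscale V (d b v) b)"
    using basis_coordinates[OF vector_space_axioms fin B(2)] by blast
  have "B \<subseteq> vcarrier V" using span span_superset by blast
  then have "dual_bases V B d"
    unfolding dual_bases_def using fin d span by blast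
  then show ?thesis by (rule that)
qed

lemma fin_dimI:
  fixes V :: "('k::field, 'v::ab_group_add, 'z) vspace_scheme"
  assumes V: "vspace V" and "finite S" "S \<subseteq> vcarrier V"
    and "\<And>v. v \<in> vcarrier V \<Longrightarrow> v \<in> module.span (vscale V) S"
  shows "fin_dim V"
proof -
  interpret vector_space "vscale V" using V by (simp add: vspace_def)
  have "span S = vcarrier V"
    using span_minimal[OF assms(3)] V assms(4) by (auto simp: vspace_def)
  then show ?thesis
    unfolding fin_dim_def using assms(2) by blast
qed

lemma pair_sum_in_span:
  fixes s :: "'k::field \<Rightarrow> 'v::ab_group_add \<Rightarrow> 'v"
  assumes "vector_space s" "\<And>v w. (v, w) \<in> set ps \<Longrightarrow> f v w \<in> S"
  shows "pair_sum ps (\<lambda>v w. s (c v w) (f v w)) \<in> module.span s S"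
proof -
  interpret vector_space s by fact
  show ?thesis
    using assms(2)
  proof (induction ps)
    case (Cons p ps)
    obtain v w where p: "p = (v, w)" by (cases p)
    have "s (c v w) (f v w) \<in> span S"
      using Cons.prems p by (intro span_scale span_base) simp
    moreover have "pair_sum ps (\<lambda>v w. s (c v w) (f v w)) \<in> span S"
      using Cons by simp
    ultimately show ?case by (simp add: p span_add)
  qed (simp add: span_zero)
qed

section \<open>Equality of tensors\<close>

lemma tensor_pair_sum_eqD:
  assumes "vspace U" "bilinear_map V W U f"
    and "set ps \<subseteq> vcarrier V \<times> vcarrier W" "set qs \<subseteq> vcarrier V \<times> vcarrier W"
    and "pair_sum ps (tensor V W) = pair_sum qs (tensor V W)"
  shows "pair_sum ps f = pair_sum qs f"
  using tensor_sum_determines[OF assms(1-4)] assms(5) by (simp add: pair_sum_def)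

lemma tensor_lift_pair_sum:
  assumes "vspace U" "bilinear_map V W U f" "set ps \<subseteq> vcarrier V \<times> vcarrier W"
  shows "tensor_lift V W f (pair_sum ps (tensor V W)) = pair_sum ps f"
  using tensor_lift_sum[OF assms] by (simp add: pair_sum_def)

lemma tensor_space_pair_sum:
  assumes "vspace V" "t \<in> vcarrier (tensor_space V W)"
  obtains ps where "set ps \<subseteq> vcarrier V \<times> vcarrier W" "t = pair_sum ps (tensor V W)"
  using tensor_space_sum[OF assms] by (auto simp: pair_sum_def)

lemma bilinear_mapD:
  assumes "bilinear_map V W U f" "v \<in> vcarrier V" "w \<in> vcarrier W"
  shows bilinear_map_carrier: "f v w \<in> vcarrier U"
    and bilinear_map_add_left: "v' \<in> vcarrier V \<Longrightarrow> f (v + v') w = f v w + f v' w"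
    and bilinear_map_add_right: "w' \<in> vcarrier W \<Longrightarrow> f v (w + w') = f v w + f v w'"
    and bilinear_map_scale_left: "f (vscale V c v) w = vscale U c (f v w)"
    and bilinear_map_scale_right: "f v (vscale W c w) = vscale U c (f v w)"
  using assms by (auto simp: bilinear_map_def linear_map_def)

lemma tensor_pair_sum_carrier:
  assumes "set ps \<subseteq> vcarrier V \<times> vcarrier W"
  shows "pair_sum ps (tensor V W) \<in> vcarrier (tensor_space V W)"
proof (rule vspace.carrier_pair_sum[OF vspace_tensor_space])
  fix v w assume "(v, w) \<in> set ps"
  then show "tensor V W v w \<in> vcarrier (tensor_space V W)"
    using assms bilinear_map_carrier[OF tensor_bilinear] by blast
qed

lemma bilinear_mapI:
  assumes "\<And>v w. \<lbrakk>v \<in> vcarrier V; w \<in> vcarrier W\<rbrakk> \<Longrightarrow> f v w \<in> vcarrier U"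
    and "\<And>v v' w. \<lbrakk>v \<in> vcarrier V; v' \<in> vcarrier V; w \<in> vcarrier W\<rbrakk>
          \<Longrightarrow> f (v + v') w = f v w + f v' w"
    and "\<And>v w w'. \<lbrakk>v \<in> vcarrier V; w \<in> vcarrier W; w' \<in> vcarrier W\<rbrakk>
          \<Longrightarrow> f v (w + w') = f v w + f v w'"
    and "\<And>c v w. \<lbrakk>v \<in> vcarrier V; w \<in> vcarrier W\<rbrakk> \<Longrightarrow> f (vscale V c v) w = vscale U c (f v w)"
    and "\<And>c v w. \<lbrakk>v \<in> vcarrier V; w \<in> vcarrier W\<rbrakk> \<Longrightarrow> f v (vscale W c w) = vscale U c (f v w)"
  shows "bilinear_map V W U f"
  using assms by (auto simp: bilinear_map_def linear_map_def)

lemma bilinear_map_swap: "bilinear_map V W U f \<Longrightarrow> bilinear_map W V U (\<lambda>w v. f v w)"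
  by (auto simp: bilinear_map_def)

lemma tensor_pair_sum_eqI:
  assumes "\<And>\<beta>. bilinear_map V W ground \<beta> \<Longrightarrow> pair_sum ps \<beta> = pair_sum qs \<beta>"
  shows "pair_sum ps (tensor V W) = pair_sum qs (tensor V W)"
proof
  fix \<beta>
  show "pair_sum ps (tensor V W) \<beta> = pair_sum qs (tensor V W) \<beta>"
    using assms[of \<beta>] by (cases "bilinear_map V W ground \<beta>") (simp_all add: pair_sum_apply tensor_def)
qed

lemma tensor_swap_zero:
  assumes "pair_sum (map prod.swap ps) (tensor W V) = 0" "set ps \<subseteq> vcarrier V \<times> vcarrier W"
  shows "pair_sum ps (tensor V W) = 0"
proof -
  have "pair_sum ps (tensor V W) = pair_sum [] (tensor V W)"
  proof (rule tensor_pair_sum_eqI)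
    fix \<beta> assume "bilinear_map V W ground \<beta>"
    then have "pair_sum (map prod.swap ps) (\<lambda>w v. \<beta> v w) = pair_sum [] (\<lambda>w v. \<beta> v w)"
      using assms
      by (intro tensor_pair_sum_eqD[OF vspace_ground bilinear_map_swap]) auto
    then show "pair_sum ps \<beta> = pair_sum [] \<beta>" by (simp add: pair_sum_swap)
  qed
  then show ?thesis by simp
qed

text \<open>Functionals on one factor separate the tensors: once the first components are expanded in a
  basis of their span, the coordinate functionals extract the coefficients in the second factor.\<close>

lemma tensor_zero_if_slices_left:
  fixes V :: "('k::field, 'v::ab_group_add, 'y) vspace_scheme"
    and W :: "('k, 'w::ab_group_add, 'z) vspace_scheme"
  assumes V: "vspace V" and W: "vspace W" and ps: "set ps \<subseteq> vcarrier V \<times> vcarrier W"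
    and slices: "\<And>\<alpha>. Vector_Spaces.linear (vscale V) (*) \<alpha>
        \<Longrightarrow> pair_sum ps (\<lambda>v w. vscale W (\<alpha> v) w) = 0"
  shows "pair_sum ps (tensor V W) = 0"
proof -
  interpret V: vspace V by fact
  interpret W: vspace W by fact
  interpret VV: vector_space "vscale V" by (rule V.ambient)
  obtain B where B: "B \<subseteq> fst ` set ps" "VV.independent B" "fst ` set ps \<subseteq> VV.span B"
    using VV.maximal_independent_subset by blast
  have fin: "finite B" using B(1) finite_subset by blast
  have BV: "b \<in> vcarrier V" if "b \<in> B" for b
    using subsetD[OF B(1) that] ps by auto
  obtain d where d: "\<And>b. b \<in> B \<Longrightarrow> Vector_Spaces.linear (vscale V) (*) (d b)"
    and "\<And>b c. \<lbrakk>b \<in> B; c \<in> B\<rbrakk> \<Longrightarrow> d b c = (if b = c then 1 else 0)"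
    and expand: "\<And>v. v \<in> VV.span B \<Longrightarrow> v = (\<Sum>b\<in>B. vscale V (d b v) b)"
    using basis_coordinates[OF V.ambient fin B(2)] by blast
  have "pair_sum ps (tensor V W) = pair_sum [] (tensor V W)"
  proof (rule tensor_pair_sum_eqI)
    fix \<beta> assume \<beta>: "bilinear_map V W ground \<beta>"
    have "pair_sum ps \<beta> = pair_sum ps (\<lambda>v w. \<Sum>b\<in>B. \<beta> b (vscale W (d b v) w))"
    proof (rule pair_sum_cong)
      fix v w assume vw: "(v, w) \<in> set ps"
      then have w: "w \<in> vcarrier W" using ps by auto
      have lin: "linear_map V ground (\<lambda>v. \<beta> v w)" using \<beta> w by (auto simp: bilinear_map_def)
      have "v = (\<Sum>b\<in>B. vscale V (d b v) b)" using vw B(3) by (intro expand) force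
      then have "\<beta> v w = \<beta> (\<Sum>b\<in>B. vscale V (d b v) b) w" by (rule arg_cong)
      also have "\<dots> = (\<Sum>b\<in>B. \<beta> (vscale V (d b v) b) w)"
        using BV V.carrier_scale by (intro linear_map_sum[OF V lin]) simp
      also have "\<dots> = (\<Sum>b\<in>B. \<beta> b (vscale W (d b v) w))"
        using bilinear_map_scale_left[OF \<beta> BV w] bilinear_map_scale_right[OF \<beta> BV w] by simp
      finally show "\<beta> v w = (\<Sum>b\<in>B. \<beta> b (vscale W (d b v) w))" .
    qed
    also have "\<dots> = (\<Sum>b\<in>B. pair_sum ps (\<lambda>v w. \<beta> b (vscale W (d b v) w)))"
      by (rule pair_sum_sum)
    also have "\<dots> = (\<Sum>b\<in>B. 0)"
    proof (rule sum.cong[OF refl])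
      fix b assume b: "b \<in> B"
      have lin: "linear_map W ground (\<beta> b)" using \<beta> BV[OF b] by (auto simp: bilinear_map_def)
      have "pair_sum ps (\<lambda>v w. \<beta> b (vscale W (d b v) w)) = \<beta> b (pair_sum ps (\<lambda>v w. vscale W (d b v) w))"
        using ps by (intro linear_map_pair_sum[OF W lin, symmetric] W.carrier_scale) auto
      also have "\<dots> = 0"
        using slices[OF d[OF b]] linear_map_zero[OF W lin] by simp
      finally show "pair_sum ps (\<lambda>v w. \<beta> b (vscale W (d b v) w)) = 0" .
    qed
    finally show "pair_sum ps \<beta> = pair_sum [] \<beta>" by simp
  qed
  then show ?thesis by simp
qed

lemma tensor_zero_if_slices_right:
  fixes V :: "('k::field, 'v::ab_group_add, 'y) vspace_scheme"
    and W :: "('k, 'w::ab_group_add, 'z) vspace_scheme"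
  assumes V: "vspace V" and W: "vspace W" and ps: "set ps \<subseteq> vcarrier V \<times> vcarrier W"
    and slices: "\<And>\<alpha>. Vector_Spaces.linear (vscale W) (*) \<alpha>
        \<Longrightarrow> pair_sum ps (\<lambda>v w. vscale V (\<alpha> w) v) = 0"
  shows "pair_sum ps (tensor V W) = 0"
proof (rule tensor_swap_zero[OF _ ps], rule tensor_zero_if_slices_left[OF W V])
  show "set (map prod.swap ps) \<subseteq> vcarrier W \<times> vcarrier V" using ps by auto
qed (simp add: pair_sum_swap slices)

section \<open>Families of bilinear maps\<close>

text \<open>A family \<open>F\<close> of bilinear maps indexed by \<open>I\<close> is a linear map from \<open>V \<otimes> W\<close> to the functions on \<open>I\<close>.
  Faithful means that this map is injective; full means that its image contains \<open>X\<close>. Both are stated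
  for lists; \<open>bij_betw_tensor_lift_iff\<close> translates them to maps on the tensor product.\<close>

definition faithful_family where
  "faithful_family V W I F \<longleftrightarrow> (\<forall>ps qs. set ps \<subseteq> vcarrier V \<times> vcarrier W \<longrightarrow>
     set qs \<subseteq> vcarrier V \<times> vcarrier W \<longrightarrow> (\<forall>i\<in>I. pair_sum ps (F i) = pair_sum qs (F i)) \<longrightarrow>
     pair_sum ps (tensor V W) = pair_sum qs (tensor V W))"

definition full_family where
  "full_family V W I F X \<longleftrightarrow> (\<forall>\<phi>\<in>X. \<exists>ps. set ps \<subseteq> vcarrier V \<times> vcarrier W \<and>
     (\<forall>i\<in>I. pair_sum ps (F i) = \<phi> i))"

lemma faithful_familyD:
  assumes "faithful_family V W I F" "vspace U" "bilinear_map V W U f"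
    and "set ps \<subseteq> vcarrier V \<times> vcarrier W" "set qs \<subseteq> vcarrier V \<times> vcarrier W"
    and "\<And>i. i \<in> I \<Longrightarrow> pair_sum ps (F i) = pair_sum qs (F i)"
  shows "pair_sum ps f = pair_sum qs f"
  using assms tensor_pair_sum_eqD[OF assms(2-5)] unfolding faithful_family_def by blast

lemma faithful_familyI:
  assumes V: "vspace V" and U: "vspace U" and F: "\<And>i. i \<in> I \<Longrightarrow> bilinear_map V W U (F i)"
    and zero: "\<And>ps. \<lbrakk>set ps \<subseteq> vcarrier V \<times> vcarrier W; \<And>i. i \<in> I \<Longrightarrow> pair_sum ps (F i) = 0\<rbrakk>
       \<Longrightarrow> pair_sum ps (tensor V W) = 0"
  shows "faithful_family V W I F"
  unfolding faithful_family_def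
proof (intro allI impI)
  fix ps qs
  assume ps: "set ps \<subseteq> vcarrier V \<times> vcarrier W" and qs: "set qs \<subseteq> vcarrier V \<times> vcarrier W"
    and eq: "\<forall>i\<in>I. pair_sum ps (F i) = pair_sum qs (F i)"
  \<comment> \<open>A list has no negative; negating the first components represents the negative tensor.\<close>
  define rs where "rs = map (\<lambda>(v, w). (- v, w)) qs"
  have neg: "pair_sum rs f = - pair_sum qs f" if "bilinear_map V W U' f" for f U'
  proof -
    have "pair_sum rs f = pair_sum qs (\<lambda>v w. f (- v) w)"
      unfolding rs_def by (rule pair_sum_map)
    also have "\<dots> = pair_sum qs (\<lambda>v w. - f v w)"
    proof (rule pair_sum_cong)
      fix v w assume "(v, w) \<in> set qs"
      then have vw: "v \<in> vcarrier V" "w \<in> vcarrier W" using qs by auto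
      have lin: "linear_map V U' (\<lambda>v. f v w)" using that vw by (auto simp: bilinear_map_def)
      have "f (v + - v) w = f v w + f (- v) w"
        using bilinear_map_add_left[OF that vw vspace.carrier_uminus[OF V vw(1)]] .
      then show "f (- v) w = - f v w"
        using linear_map_zero[OF V lin] by (simp add: eq_neg_iff_add_eq_0 add.commute)
    qed
    finally show ?thesis by (simp add: pair_sum_uminus)
  qed
  have "pair_sum (ps @ rs) (tensor V W) = 0"
  proof (rule zero)
    show "set (ps @ rs) \<subseteq> vcarrier V \<times> vcarrier W"
      using ps qs vspace.carrier_uminus[OF V] by (auto simp: rs_def)
    show "pair_sum (ps @ rs) (F i) = 0" if "i \<in> I" for i
      using eq that neg[OF F] by simp
  qed
  then show "pair_sum ps (tensor V W) = pair_sum qs (tensor V W)"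
    using neg[OF tensor_bilinear] by simp
qed

lemma bij_betw_tensor_lift_iff:
  assumes V: "vspace V" and U: "vspace U" and F: "\<And>i. i \<in> I \<Longrightarrow> bilinear_map V W U (F i)"
    and X: "X \<subseteq> extensional I"
    and into: "\<And>ps. set ps \<subseteq> vcarrier V \<times> vcarrier W \<Longrightarrow> (\<lambda>i\<in>I. pair_sum ps (F i)) \<in> X"
  shows "bij_betw (\<lambda>t. \<lambda>i\<in>I. tensor_lift V W (F i) t) (vcarrier (tensor_space V W)) X \<longleftrightarrow>
    faithful_family V W I F \<and> full_family V W I F X"
proof -
  let ?G = "\<lambda>t. \<lambda>i\<in>I. tensor_lift V W (F i) t"
  let ?T = "vcarrier (tensor_space V W)"
  have val: "?G (pair_sum ps (tensor V W)) = (\<lambda>i\<in>I. pair_sum ps (F i))"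
    if "set ps \<subseteq> vcarrier V \<times> vcarrier W" for ps
    using tensor_lift_pair_sum[OF U F that] by (auto simp: fun_eq_iff)
  have inj: "inj_on ?G ?T \<longleftrightarrow> faithful_family V W I F"
  proof
    assume i: "inj_on ?G ?T"
    show "faithful_family V W I F"
      unfolding faithful_family_def
    proof (intro allI impI)
      fix ps qs
      assume ps: "set ps \<subseteq> vcarrier V \<times> vcarrier W" and qs: "set qs \<subseteq> vcarrier V \<times> vcarrier W"
        and eq: "\<forall>i\<in>I. pair_sum ps (F i) = pair_sum qs (F i)"
      have "?G (pair_sum ps (tensor V W)) = ?G (pair_sum qs (tensor V W))"
        unfolding val[OF ps] val[OF qs] using eq by (auto simp: fun_eq_iff restrict_def)
      then show "pair_sum ps (tensor V W) = pair_sum qs (tensor V W)"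
        using i tensor_pair_sum_carrier[OF ps] tensor_pair_sum_carrier[OF qs]
        by (auto dest: inj_onD)
    qed
  next
    assume f: "faithful_family V W I F"
    show "inj_on ?G ?T"
    proof (rule inj_onI)
      fix t u assume t: "t \<in> ?T" and u: "u \<in> ?T" and eq: "?G t = ?G u"
      obtain ps where ps: "set ps \<subseteq> vcarrier V \<times> vcarrier W" "t = pair_sum ps (tensor V W)"
        using tensor_space_pair_sum[OF V t] .
      obtain qs where qs: "set qs \<subseteq> vcarrier V \<times> vcarrier W" "u = pair_sum qs (tensor V W)"
        using tensor_space_pair_sum[OF V u] .
      have "(\<lambda>i\<in>I. pair_sum ps (F i)) = (\<lambda>i\<in>I. pair_sum qs (F i))"
        using eq val ps qs by simp
      then have "\<forall>i\<in>I. pair_sum ps (F i) = pair_sum qs (F i)"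
        by (metis restrict_apply')
      then show "t = u"
        using f ps qs unfolding faithful_family_def by blast
    qed
  qed
  have sub: "?G ` ?T \<subseteq> X"
  proof
    fix y assume "y \<in> ?G ` ?T"
    then obtain t where t: "t \<in> ?T" "y = ?G t" by blast
    obtain ps where "set ps \<subseteq> vcarrier V \<times> vcarrier W" "t = pair_sum ps (tensor V W)"
      using tensor_space_pair_sum[OF V t(1)] .
    then show "y \<in> X" using into val t(2) by simp
  qed
  have surj: "X \<subseteq> ?G ` ?T \<longleftrightarrow> full_family V W I F X"
  proof
    assume h: "X \<subseteq> ?G ` ?T"
    show "full_family V W I F X"
      unfolding full_family_def
    proof
      fix \<phi> assume "\<phi> \<in> X"
      then obtain t where t: "t \<in> ?T" "\<phi> = ?G t" using h by blast
      obtain ps where ps: "set ps \<subseteq> vcarrier V \<times> vcarrier W" "t = pair_sum ps (tensor V W)"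
        using tensor_space_pair_sum[OF V t(1)] .
      have "\<forall>i\<in>I. pair_sum ps (F i) = \<phi> i"
        using t(2) val[OF ps(1)] ps(2) by simp
      then show "\<exists>ps. set ps \<subseteq> vcarrier V \<times> vcarrier W \<and> (\<forall>i\<in>I. pair_sum ps (F i) = \<phi> i)"
        using ps(1) by blast
    qed
  next
    assume h: "full_family V W I F X"
    show "X \<subseteq> ?G ` ?T"
    proof
      fix \<phi> assume \<phi>: "\<phi> \<in> X"
      then obtain ps where ps: "set ps \<subseteq> vcarrier V \<times> vcarrier W"
        "\<forall>i\<in>I. pair_sum ps (F i) = \<phi> i"
        using h unfolding full_family_def by blast
      have "\<phi> \<in> extensional I" using \<phi> X by blast
      then have "\<phi> = (\<lambda>i\<in>I. pair_sum ps (F i))"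
        using ps(2) by (auto simp: fun_eq_iff extensional_def restrict_def)
      then have "\<phi> = ?G (pair_sum ps (tensor V W))" using val[OF ps(1)] by simp
      then show "\<phi> \<in> ?G ` ?T" using tensor_pair_sum_carrier[OF ps(1)] by blast
    qed
  qed
  show ?thesis
    unfolding bij_betw_def using inj sub surj by blast
qed

section \<open>Algebras acting on an algebra\<close>

lemma type_algebra_simps [simp]:
  "vcarrier (type_algebra s) = UNIV" "vscale (type_algebra s) = s"
  "amult (type_algebra s) = (*)" "aone (type_algebra s) = 1"
  by (simp_all add: type_algebra_def)

lemma vspace_type_algebra: "vector_space s \<Longrightarrow> vspace (type_algebra s)"
proof -
  assume "vector_space s"
  then interpret vector_space s .
  show ?thesis by (simp add: vspace_def vector_space_axioms)
qed

lemma unit_functional: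
  fixes s :: "'k::field \<Rightarrow> 'a::ring_1 \<Rightarrow> 'a"
  assumes "vector_space s"
  obtains \<tau> where "Vector_Spaces.linear s (*) \<tau>" "\<tau> 1 = 1"
proof -
  interpret vector_space s by fact
  have "independent {1}" by simp
  then show ?thesis
    using basis_coordinates[OF assms, of "{1}"] that by (metis finite.emptyI finite.insertI singletonI)
qed

text \<open>The product \<open>m\<close> is a parameter so that the opposite product is covered by the same lemmas. For
  \<open>m = (*)\<close> the two predicates say that \<open>\<pi>\<close> and \<open>\<gamma>\<close> are bijective. For the opposite product they say this
  of \<open>\<pi>'\<close> and of the composite of \<open>\<gamma>'\<close> with the flip of \<open>A \<otimes> A\<close>.\<close>

definition pi_bijective ::
  "('a \<Rightarrow> 'a \<Rightarrow> 'a) \<Rightarrow> ('k::field, 'h::ab_group_add) kalg \<Rightarrow> ('k \<Rightarrow> 'a \<Rightarrow> 'a::ring_1) \<Rightarrow> ('h \<Rightarrow> 'a \<Rightarrow> 'a) \<Rightarrow> bool"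
  where "pi_bijective m H s act \<longleftrightarrow>
    faithful_family (type_algebra s) H UNIV (\<lambda>b a h. m a (act h b)) \<and>
    full_family (type_algebra s) H UNIV (\<lambda>b a h. m a (act h b))
      (linear_maps (type_algebra s) (type_algebra s))"

definition gamma_bijective ::
  "('a \<Rightarrow> 'a \<Rightarrow> 'a) \<Rightarrow> ('k::field, 'h::ab_group_add) kalg \<Rightarrow> ('k \<Rightarrow> 'a \<Rightarrow> 'a::ring_1) \<Rightarrow> ('h \<Rightarrow> 'a \<Rightarrow> 'a) \<Rightarrow> bool"
  where "gamma_bijective m H s act \<longleftrightarrow>
    faithful_family (type_algebra s) (type_algebra s) (vcarrier H) (\<lambda>h a b. m a (act h b)) \<and>
    full_family (type_algebra s) (type_algebra s) (vcarrier H) (\<lambda>h a b. m a (act h b))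
      (linear_maps H (type_algebra s))"

text \<open>An algebra acting on \<open>A\<close> by linear operators. The instances are \<open>H\<close>, its commutant \<open>E\<close>, and the
  commutant of \<open>E\<close>.\<close>

locale represented_algebra = k_algebra H + vector_space s
  for H :: "('k::field, 'h::ab_group_add) kalg" and s :: "'k \<Rightarrow> 'a \<Rightarrow> 'a::ring_1" +
  fixes act :: "'h \<Rightarrow> 'a \<Rightarrow> 'a"
  assumes act_bilinear: "bilinear_map H (type_algebra s) (type_algebra s) act"
    and act_mult: "\<lbrakk>g \<in> vcarrier H; h \<in> vcarrier H\<rbrakk> \<Longrightarrow> act (amult H g h) a = act g (act h a)"
    and act_one: "act (aone H) a = a"
begin

abbreviation "A \<equiv> type_algebra s"

lemma vspace_A: "vspace A"
  by (rule vspace_type_algebra[OF vector_space_axioms])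

lemma vspace_H: "vspace H" ..

lemma act_add: "h \<in> vcarrier H \<Longrightarrow> act h (a + b) = act h a + act h b"
  and act_scale: "h \<in> vcarrier H \<Longrightarrow> act h (s c a) = s c (act h a)"
  and act_add_left: "\<lbrakk>g \<in> vcarrier H; h \<in> vcarrier H\<rbrakk> \<Longrightarrow> act (g + h) a = act g a + act h a"
  and act_scale_left: "h \<in> vcarrier H \<Longrightarrow> act (vscale H c h) a = s c (act h a)"
  using bilinear_map_add_right[OF act_bilinear] bilinear_map_scale_right[OF act_bilinear]
    bilinear_map_add_left[OF act_bilinear] bilinear_map_scale_left[OF act_bilinear]
  by simp_all

lemma act_linear: "h \<in> vcarrier H \<Longrightarrow> linear_map A A (act h)"
  using act_bilinear by (auto simp: bilinear_map_def)

lemma act_linear_left: "linear_map H A (\<lambda>h. act h a)"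
  using act_bilinear by (auto simp: bilinear_map_def)

lemma act_zero: "h \<in> vcarrier H \<Longrightarrow> act h 0 = 0"
  using linear_map_zero[OF vspace_A act_linear] .

lemma act_pair_sum: "h \<in> vcarrier H \<Longrightarrow> act h (pair_sum ps F) = pair_sum ps (\<lambda>v w. act h (F v w))"
  by (rule pair_sum_hom) (simp_all add: act_zero act_add)

lemma act_sum: "h \<in> vcarrier H \<Longrightarrow> act h (sum f I) = (\<Sum>i\<in>I. act h (f i))"
  by (induction I rule: infinite_finite_induct) (simp_all add: act_zero act_add)

abbreviation "E \<equiv> module_endo H s act"

lemma E_carrier: "f \<in> vcarrier E \<longleftrightarrow> linear_map A A f \<and> (\<forall>h\<in>vcarrier H. \<forall>a. f (act h a) = act h (f a))"
  by (auto simp: module_endo_def linear_maps_def extensional_def)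

lemma E_simps: "vscale E c f = (\<lambda>a. s c (f a))" "amult E f g = f \<circ> g" "aone E = id"
  by (simp_all add: module_endo_def)

lemma E_add: "f \<in> vcarrier E \<Longrightarrow> f (a + b) = f a + f b"
  and E_scale: "f \<in> vcarrier E \<Longrightarrow> f (s c a) = s c (f a)"
  and E_act: "\<lbrakk>f \<in> vcarrier E; h \<in> vcarrier H\<rbrakk> \<Longrightarrow> f (act h a) = act h (f a)"
  by (auto simp: E_carrier linear_map_def)

lemma EI:
  assumes "\<And>a b. f (a + b) = f a + f b" "\<And>c a. f (s c a) = s c (f a)"
    and "\<And>h a. h \<in> vcarrier H \<Longrightarrow> f (act h a) = act h (f a)"
  shows "f \<in> vcarrier E"
  using assms by (auto simp: E_carrier linear_map_def)

lemma vspace_E: "vspace E"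
proof -
  have v: "vector_space (vscale E)"
    using vector_space_fun[OF vector_space_axioms] by (simp add: module_endo_def)
  then interpret E: vector_space "vscale E" .
  have "E.subspace (vcarrier E)"
    unfolding E.subspace_def
  proof (intro conjI ballI allI)
    show "0 \<in> vcarrier E" by (rule EI) (auto simp: act_zero)
  next
    fix f g assume fg: "f \<in> vcarrier E" "g \<in> vcarrier E"
    show "f + g \<in> vcarrier E"
      by (rule EI) (use fg in \<open>auto simp: E_add E_scale E_act act_add scale_right_distrib\<close>)
  next
    fix c f assume f: "f \<in> vcarrier E"
    show "vscale E c f \<in> vcarrier E" unfolding E_simps
      by (rule EI) (use f in \<open>auto simp: E_add E_scale E_act act_scale scale_right_distrib mult.commute\<close>)
  qed
  then show ?thesis using v by (simp add: vspace_def)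
qed

lemma commutant_represented: "represented_algebra E s (\<lambda>f a. f a)"
proof -
  interpret E: vspace E by (rule vspace_E)
  have id: "id \<in> vcarrier E" by (rule EI) auto
  have comp: "f \<circ> g \<in> vcarrier E" if "f \<in> vcarrier E" "g \<in> vcarrier E" for f g
    by (rule EI) (use that in \<open>auto simp: E_add E_scale E_act\<close>)
  show ?thesis
  proof unfold_locales
    show "bilinear_map E E E (amult E)"
      by (rule bilinear_mapI) (auto simp: E_simps comp E_add E_scale fun_eq_iff)
    show "aone E \<noteq> 0"
    proof
      assume "aone E = 0"
      then have "id 1 = (0 :: 'a \<Rightarrow> 'a) 1" by (simp add: E_simps)
      then show False by simp
    qed
    show "bilinear_map E A A (\<lambda>f a. f a)"
      by (rule bilinear_mapI) (auto simp: E_simps E_add E_scale)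
  qed (auto simp: E_simps id)
qed

end

locale algebra_product = vector_space s for s :: "'k::field \<Rightarrow> 'a::ring_1 \<Rightarrow> 'a" +
  fixes m :: "'a \<Rightarrow> 'a \<Rightarrow> 'a"
  assumes m_add_left: "m (x + y) z = m x z + m y z"
    and m_add_right: "m x (y + z) = m x y + m x z"
    and m_scale_left: "m (s c x) y = s c (m x y)"
    and m_scale_right: "m x (s c y) = s c (m x y)"
    and m_assoc: "m (m x y) z = m x (m y z)"
    and m_one_left: "m 1 x = x"
    and m_one_right: "m x 1 = x"
begin

lemma m_zero: "m 0 x = 0" "m x 0 = 0"
  using m_add_left[of 0 0 x] m_add_right[of x 0 0] by simp_all

lemma m_pair_sum: "m x (pair_sum ps F) = pair_sum ps (\<lambda>v w. m x (F v w))"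
    "m (pair_sum ps F) x = pair_sum ps (\<lambda>v w. m (F v w) x)"
  by (rule pair_sum_hom; simp add: m_zero m_add_right m_add_left)+

end

locale acting_algebra = represented_algebra H s act + algebra_product s m
  for H :: "('k::field, 'h::ab_group_add) kalg" and s :: "'k \<Rightarrow> 'a \<Rightarrow> 'a::ring_1" and act m
begin

lemma bilinear_gamma: "h \<in> vcarrier H \<Longrightarrow> bilinear_map A A A (\<lambda>a b. m a (act h b))"
  by (rule bilinear_mapI)
     (simp_all add: m_add_left m_add_right m_scale_left m_scale_right act_add act_scale)

lemma bilinear_pi: "bilinear_map A H A (\<lambda>a h. m a (act h b))"
  by (rule bilinear_mapI)
     (simp_all add: m_add_left m_add_right m_scale_left m_scale_right act_add_left act_scale_left)

lemma gamma_unique: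
  assumes "faithful_family A A (vcarrier H) (\<lambda>h a b. m a (act h b))"
    and "vspace U" "bilinear_map A A U F"
    and "\<And>h. h \<in> vcarrier H \<Longrightarrow>
      pair_sum ps (\<lambda>a b. m a (act h b)) = pair_sum qs (\<lambda>a b. m a (act h b))"
  shows "pair_sum ps F = pair_sum qs F"
  using faithful_familyD[OF assms(1-3) _ _ assms(4)] by simp

lemma gamma_exists:
  assumes "full_family A A (vcarrier H) (\<lambda>h a b. m a (act h b)) (linear_maps H A)"
    and "linear_map H A F"
  shows "\<exists>ps. \<forall>h\<in>vcarrier H. pair_sum ps (\<lambda>a b. m a (act h b)) = F h"
proof -
  have "restrict F (vcarrier H) \<in> linear_maps H A"
    using assms(2) carrier_add carrier_scale by (auto simp: linear_maps_def linear_map_def)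
  then obtain ps where "\<forall>h\<in>vcarrier H. pair_sum ps (\<lambda>a b. m a (act h b)) = restrict F (vcarrier H) h"
    using assms(1) unfolding full_family_def by blast
  then show ?thesis by (intro exI[of _ ps]) simp
qed

lemma pi_unique:
  assumes "faithful_family A H UNIV (\<lambda>b a h. m a (act h b))"
    and "vspace U" "bilinear_map A H U F"
    and "set ps \<subseteq> UNIV \<times> vcarrier H" "set qs \<subseteq> UNIV \<times> vcarrier H"
    and "\<And>b. pair_sum ps (\<lambda>a h. m a (act h b)) = pair_sum qs (\<lambda>a h. m a (act h b))"
  shows "pair_sum ps F = pair_sum qs F"
  using faithful_familyD[OF assms(1-3) _ _ assms(6)] assms(4,5) by simp

lemma pi_exists:
  assumes "full_family A H UNIV (\<lambda>b a h. m a (act h b)) (linear_maps A A)"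
    and "linear_map A A \<phi>"
  shows "\<exists>ps. set ps \<subseteq> UNIV \<times> vcarrier H \<and> (\<forall>b. pair_sum ps (\<lambda>a h. m a (act h b)) = \<phi> b)"
proof -
  have "\<phi> \<in> linear_maps A A" using assms(2) by (simp add: linear_maps_def extensional_def)
  then show ?thesis using assms(1) unfolding full_family_def by simp
qed

text \<open>If \<open>T b\<close> is a preimage under \<open>\<gamma>\<close> of the coordinate functional \<open>d b\<close>, then
  \<open>\<Sum> b(y) T\<^sub>b\<close> and \<open>1 \<otimes> y\<close> have the same image \<open>h \<mapsto> h y = \<Sum> d\<^sub>b(h) b(y)\<close> under \<open>\<gamma>\<close>, so they are equal tensors;
  here \<open>b(y)\<close> multiplies the first factor from the left. The lemma is this equality after a bilinear
  map \<open>F\<close>. It yields the finiteness of \<open>A\<close> and the formulas for the coproduct and the antipode.\<close>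

lemma gamma_expansion:
  assumes inj: "faithful_family A A (vcarrier H) (\<lambda>h a b. m a (act h b))"
    and Bd: "dual_bases H B d"
    and T: "\<And>b h. \<lbrakk>b \<in> B; h \<in> vcarrier H\<rbrakk> \<Longrightarrow> pair_sum (T b) (\<lambda>u v. m u (act h v)) = s (d b h) 1"
    and U: "vspace U" and F: "bilinear_map A A U F"
  shows "(\<Sum>b\<in>B. pair_sum (T b) (\<lambda>u v. F (m (act b y) u) v)) = F 1 y"
proof -
  have B: "finite B" "B \<subseteq> vcarrier H" using dual_basesD[OF Bd] by blast+
  obtain xs where xs: "set xs = B" "distinct xs" using finite_distinct_list[OF B(1)] by blast
  define ps where "ps = concat (map (\<lambda>b. map (\<lambda>(u, v). (m (act b y) u, v)) (T b)) xs)"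
  have ps: "pair_sum ps G = (\<Sum>b\<in>B. pair_sum (T b) (\<lambda>u v. G (m (act b y) u) v))"
    for G :: "'a \<Rightarrow> 'a \<Rightarrow> 'x::ab_group_add"
    unfolding ps_def by (simp add: pair_sum_concat_distinct[OF xs(2)] xs(1) pair_sum_map)
  have "pair_sum ps F = pair_sum [(1, y)] F"
  proof (rule gamma_unique[OF inj U F])
    fix h assume h: "h \<in> vcarrier H"
    have "pair_sum ps (\<lambda>a b. m a (act h b)) = (\<Sum>b\<in>B. m (act b y) (s (d b h) 1))"
      unfolding ps by (simp add: m_assoc m_pair_sum(1)[symmetric] T h)
    also have "\<dots> = (\<Sum>b\<in>B. act (vscale H (d b h) b) y)"
      using B(2) by (intro sum.cong refl) (auto simp: m_scale_right m_one_right act_scale_left)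
    also have "\<dots> = act (\<Sum>b\<in>B. vscale H (d b h) b) y"
      using B(2) carrier_scale by (intro linear_map_sum[OF vspace_H act_linear_left, symmetric]) auto
    also have "\<dots> = act h y" by (rule arg_cong[OF dual_bases_expand[OF Bd h, symmetric]])
    finally show "pair_sum ps (\<lambda>a b. m a (act h b)) = pair_sum [(1, y)] (\<lambda>a b. m a (act h b))"
      by (simp add: m_one_left)
  qed
  then show ?thesis unfolding ps by simp
qed

lemma gamma_dual_lists:
  assumes "full_family A A (vcarrier H) (\<lambda>h a b. m a (act h b)) (linear_maps H A)"
    and "dual_bases H B d"
  shows "\<exists>T. \<forall>b\<in>B. \<forall>h\<in>vcarrier H. pair_sum (T b) (\<lambda>u v. m u (act h v)) = s (d b h) 1"
proof -
  have "\<exists>ps. \<forall>h\<in>vcarrier H. pair_sum ps (\<lambda>u v. m u (act h v)) = s (d b h) 1" if b: "b \<in> B" for b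
  proof -
    interpret d: Vector_Spaces.linear "vscale H" "(*)" "d b"
      by (rule dual_bases_linear[OF assms(2) b])
    have "linear_map H A (\<lambda>h. s (d b h) 1)"
      by (auto simp: linear_map_def d.add d.scale scale_left_distrib)
    then show ?thesis by (rule gamma_exists[OF assms(1)])
  qed
  then have "\<forall>b\<in>B. \<exists>ps. \<forall>h\<in>vcarrier H. pair_sum ps (\<lambda>u v. m u (act h v)) = s (d b h) 1"
    by blast
  then show ?thesis by (rule bchoice)
qed

text \<open>A functional with value 1 at 1, applied to the first factor in \<open>gamma_expansion\<close>, writes every \<open>y\<close>
  as a combination of the second components of the finitely many lists \<open>T b\<close>.\<close>

lemma fin_dim_A:
  assumes \<gamma>: "gamma_bijective m H s act" and fin: "fin_dim H"
  shows "fin_dim A"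
proof -
  have inj: "faithful_family A A (vcarrier H) (\<lambda>h a b. m a (act h b))"
    and full: "full_family A A (vcarrier H) (\<lambda>h a b. m a (act h b)) (linear_maps H A)"
    using \<gamma> by (simp_all add: gamma_bijective_def)
  obtain B d where Bd: "dual_bases H B d"
    using fin_dim_dual_bases[OF vspace_H fin] .
  have B: "finite B" "B \<subseteq> vcarrier H" using dual_basesD[OF Bd] by blast+
  obtain T where T: "\<forall>b\<in>B. \<forall>h\<in>vcarrier H. pair_sum (T b) (\<lambda>u v. m u (act h v)) = s (d b h) 1"
    using gamma_dual_lists[OF full Bd] ..
  obtain \<tau> where \<tau>: "Vector_Spaces.linear s (*) \<tau>" "\<tau> 1 = 1"
    using unit_functional[OF vector_space_axioms] .
  interpret \<tau>: Vector_Spaces.linear s "(*)" \<tau> by fact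
  define S where "S = (\<Union>b\<in>B. snd ` set (T b))"
  show ?thesis
  proof (rule fin_dimI[OF vspace_A, of S])
    show "finite S" using B by (auto simp: S_def)
    fix y
    have "bilinear_map A A A (\<lambda>u v. s (\<tau> u) v)"
      by (rule bilinear_mapI) (simp_all add: \<tau>.add \<tau>.scale scale_left_distrib scale_right_distrib mult.commute)
    from gamma_expansion[OF inj Bd bspec[OF bspec[OF T]] vspace_A this]
    have "s (\<tau> 1) y = (\<Sum>b\<in>B. pair_sum (T b) (\<lambda>u v. s (\<tau> (m (act b y) u)) v))" by simp
    also have "\<dots> \<in> span S"
      by (intro span_sum pair_sum_in_span[OF vector_space_axioms]) (force simp: S_def)
    finally show "y \<in> module.span (vscale A) S" using \<tau>(2) by simp
  qed simp
qed

end

section \<open>The Galois property of the commutant\<close>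

context acting_algebra
begin

lemma commutant_acting: "acting_algebra E s (\<lambda>f a. f a) m"
  by (intro acting_algebra.intro commutant_represented algebra_product_axioms)

text \<open>If \<open>\<Sum> a f(b) = 0\<close> for all \<open>b\<close>, then replacing \<open>b\<close> by \<open>h b\<close> gives \<open>\<Sum> a (h (f b)) = 0\<close> for all \<open>h\<close>, because the
  operators \<open>f\<close> commute with \<open>H\<close>. By injectivity of \<open>\<gamma>\<close> the tensor \<open>\<Sum> a \<otimes> f(b)\<close> vanishes for every \<open>b\<close>.\<close>

lemma pi_faithful_commutant:
  assumes \<gamma>: "faithful_family A A (vcarrier H) (\<lambda>h a b. m a (act h b))"
  shows "faithful_family A E UNIV (\<lambda>b a f. m a (f b))"
proof -
  interpret E: acting_algebra E s "\<lambda>f a. f a" m by (rule commutant_acting)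
  show ?thesis
  proof (rule faithful_familyI[OF vspace_A vspace_A E.bilinear_pi])
    fix ps
    assume ps: "set ps \<subseteq> vcarrier A \<times> vcarrier E"
      and zero: "\<And>b. b \<in> UNIV \<Longrightarrow> pair_sum ps (\<lambda>a f. m a (f b)) = 0"
    show "pair_sum ps (tensor A E) = 0"
    proof (rule tensor_zero_if_slices_left[OF vspace_A vspace_E ps])
      fix \<alpha> :: "'a \<Rightarrow> 'k" assume "Vector_Spaces.linear (vscale A) (*) \<alpha>"
      then interpret \<alpha>: Vector_Spaces.linear s "(*)" \<alpha> by simp
      have bil: "bilinear_map A A A (\<lambda>a b. s (\<alpha> a) b)"
        by (rule bilinear_mapI)
           (simp_all add: \<alpha>.add \<alpha>.scale scale_left_distrib scale_right_distrib mult.commute)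
      show "pair_sum ps (\<lambda>a f. vscale E (\<alpha> a) f) = 0"
      proof
        fix y
        have "pair_sum (map (\<lambda>(a, f). (a, f y)) ps) (\<lambda>a b. s (\<alpha> a) b) = pair_sum [] (\<lambda>a b. s (\<alpha> a) b)"
        proof (rule gamma_unique[OF \<gamma> vspace_A bil])
          fix h assume h: "h \<in> vcarrier H"
          have "pair_sum ps (\<lambda>a f. m a (act h (f y))) = pair_sum ps (\<lambda>a f. m a (f (act h y)))"
            using ps h by (intro pair_sum_cong) (auto simp: E_act)
          then show "pair_sum (map (\<lambda>(a, f). (a, f y)) ps) (\<lambda>a b. m a (act h b)) =
              pair_sum [] (\<lambda>a b. m a (act h b))"
            using zero by (simp add: pair_sum_map)
        qed
        then show "pair_sum ps (\<lambda>a f. vscale E (\<alpha> a) f) y = 0 y"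
          by (simp add: pair_sum_apply pair_sum_map E_simps)
      qed
    qed
  qed
qed

text \<open>By surjectivity of \<open>\<pi>\<close> it suffices to write \<open>y \<mapsto> x (k y)\<close> in terms of \<open>E\<close>. Surjectivity of \<open>\<gamma>\<close> gives a
  tensor \<open>r y = \<Sum> u \<otimes> v\<close> with \<open>\<Sum> u (h v) = x (k (h y))\<close> for all \<open>h\<close>, and injectivity of \<open>\<gamma>\<close> makes \<open>r\<close> linear
  with \<open>r (g y) = \<Sum> u \<otimes> g v\<close>. So a functional on the first factor turns \<open>r\<close> into an element of \<open>E\<close>. The
  coordinates of \<open>A\<close> as functionals, together with the case \<open>h = 1\<close>, give the claim.\<close>

lemma pi_full_commutant:
  assumes \<gamma>: "gamma_bijective m H s act" and \<pi>: "pi_bijective m H s act" and fin: "fin_dim A"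
  shows "full_family A E UNIV (\<lambda>b a f. m a (f b)) (linear_maps A A)"
proof -
  have inj: "faithful_family A A (vcarrier H) (\<lambda>h a b. m a (act h b))"
    and full: "full_family A A (vcarrier H) (\<lambda>h a b. m a (act h b)) (linear_maps H A)"
    using \<gamma> by (simp_all add: gamma_bijective_def)
  obtain X d where Xd: "dual_bases A X d" using fin_dim_dual_bases[OF vspace_A fin] .
  have X: "finite X" using dual_basesD[OF Xd] by blast
  obtain xs where xs: "set xs = X" "distinct xs" using finite_distinct_list[OF X] by blast
  have one: "\<exists>ps. set ps \<subseteq> UNIV \<times> vcarrier E \<and> (\<forall>y. pair_sum ps (\<lambda>a f. m a (f y)) = m x (act k y))"
    if k: "k \<in> vcarrier H" for x k
  proof -
    have "\<forall>y. \<exists>ps. \<forall>h\<in>vcarrier H. pair_sum ps (\<lambda>a b. m a (act h b)) = m x (act k (act h y))"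
    proof
      fix y
      have "linear_map H A (\<lambda>h. m x (act k (act h y)))"
        using k by (auto simp: linear_map_def act_add_left act_scale_left act_add act_scale
            m_add_right m_scale_right)
      then show "\<exists>ps. \<forall>h\<in>vcarrier H. pair_sum ps (\<lambda>a b. m a (act h b)) = m x (act k (act h y))"
        by (rule gamma_exists[OF full])
    qed
    then obtain r where r: "\<And>y h. h \<in> vcarrier H \<Longrightarrow>
        pair_sum (r y) (\<lambda>a b. m a (act h b)) = m x (act k (act h y))"
      by metis
    define f where "f i y = pair_sum (r y) (\<lambda>u v. s (d i u) v)" for i y
    have f: "f i \<in> vcarrier E" if i: "i \<in> X" for i
    proof -
      interpret d: Vector_Spaces.linear s "(*)" "d i"
        using dual_bases_linear[OF Xd i] by simp
      have bil: "bilinear_map A A A (\<lambda>a b. s (d i a) b)"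
        by (rule bilinear_mapI)
           (simp_all add: d.add d.scale scale_left_distrib scale_right_distrib mult.commute)
      show ?thesis
      proof (rule EI)
        fix y z
        have "pair_sum (r (y + z)) (\<lambda>u v. s (d i u) v) = pair_sum (r y @ r z) (\<lambda>u v. s (d i u) v)"
          using k by (intro gamma_unique[OF inj vspace_A bil]) (simp add: r act_add m_add_right)
        then show "f i (y + z) = f i y + f i z" by (simp add: f_def)
      next
        fix c y
        have "pair_sum (r (s c y)) (\<lambda>u v. s (d i u) v) =
            pair_sum (map (\<lambda>(u, v). (u, s c v)) (r y)) (\<lambda>u v. s (d i u) v)"
        proof (rule gamma_unique[OF inj vspace_A bil])
          fix h assume h: "h \<in> vcarrier H"
          have "s c (pair_sum (r y) (\<lambda>a b. m a (act h b))) = pair_sum (r y) (\<lambda>a b. s c (m a (act h b)))"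
            by (rule pair_sum_hom) (simp_all add: scale_right_distrib)
          then show "pair_sum (r (s c y)) (\<lambda>a b. m a (act h b)) =
              pair_sum (map (\<lambda>(u, v). (u, s c v)) (r y)) (\<lambda>a b. m a (act h b))"
            using h k by (simp add: r pair_sum_map act_scale m_scale_right)
        qed
        moreover have "s c (f i y) = pair_sum (r y) (\<lambda>u v. s c (s (d i u) v))"
          unfolding f_def by (rule pair_sum_hom) (simp_all add: scale_right_distrib)
        ultimately show "f i (s c y) = s c (f i y)"
          by (simp add: f_def pair_sum_map mult.commute)
      next
        fix g y assume g: "g \<in> vcarrier H"
        have "pair_sum (r (act g y)) (\<lambda>u v. s (d i u) v) =
            pair_sum (map (\<lambda>(u, v). (u, act g v)) (r y)) (\<lambda>u v. s (d i u) v)"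
        proof (rule gamma_unique[OF inj vspace_A bil])
          fix h assume h: "h \<in> vcarrier H"
          have hg: "amult H h g \<in> vcarrier H"
            using bilinear_map_carrier[OF mult_bilinear h g] .
          show "pair_sum (r (act g y)) (\<lambda>a b. m a (act h b)) =
              pair_sum (map (\<lambda>(u, v). (u, act g v)) (r y)) (\<lambda>a b. m a (act h b))"
            using r[OF hg] by (simp add: r[OF h] pair_sum_map act_mult[OF h g])
        qed
        then show "f i (act g y) = act g (f i y)"
          using g by (simp add: f_def pair_sum_map act_pair_sum act_scale)
      qed
    qed
    have val: "(\<Sum>i\<in>X. m i (f i y)) = m x (act k y)" for y
    proof -
      have "(\<Sum>i\<in>X. m i (f i y)) = pair_sum (r y) (\<lambda>u v. \<Sum>i\<in>X. m i (s (d i u) v))"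
        by (simp add: f_def m_pair_sum pair_sum_sum)
      also have "\<dots> = pair_sum (r y) (\<lambda>u v. m u (act (aone H) v))"
      proof (rule pair_sum_cong)
        fix u v
        interpret V: Modules.additive "\<lambda>u. m u v" by standard (rule m_add_left)
        have "(\<Sum>i\<in>X. m i (s (d i u) v)) = m (\<Sum>i\<in>X. s (d i u) i) v"
          by (simp add: V.sum m_scale_left m_scale_right)
        also have "(\<Sum>i\<in>X. s (d i u) i) = u"
          using dual_bases_expand[OF Xd, of u] by simp
        finally show "(\<Sum>i\<in>X. m i (s (d i u) v)) = m u (act (aone H) v)"
          by (simp add: act_one)
      qed
      also have "\<dots> = m x (act k y)" using r[OF one_carrier] by (simp add: act_one)
      finally show ?thesis .
    qed
    have "pair_sum (map (\<lambda>i. (i, f i)) xs) F = (\<Sum>i\<in>X. F i (f i))"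
      for F :: "'a \<Rightarrow> ('a \<Rightarrow> 'a) \<Rightarrow> 'a"
      using xs by (simp add: pair_sum_def o_def sum_list_distinct_conv_sum_set)
    then show ?thesis
      using f val xs(1) by (intro exI[of _ "map (\<lambda>i. (i, f i)) xs"]) auto
  qed
  show ?thesis
    unfolding full_family_def
  proof
    fix \<phi> assume "\<phi> \<in> linear_maps A A"
    then obtain ps where ps: "set ps \<subseteq> UNIV \<times> vcarrier H"
      "\<forall>b. pair_sum ps (\<lambda>a h. m a (act h b)) = \<phi> b"
      using pi_exists[of \<phi>] \<pi> by (auto simp: pi_bijective_def linear_maps_def)
    have "\<exists>qs. set qs \<subseteq> UNIV \<times> vcarrier E \<and>
        (\<forall>b. pair_sum qs (\<lambda>a f. m a (f b)) = pair_sum ps (\<lambda>a h. m a (act h b)))"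
      using ps(1)
    proof (induction ps)
      case Nil
      show ?case by (intro exI[of _ "[]"]) simp
    next
      case (Cons p ps)
      obtain x k where p: "p = (x, k)" by (cases p)
      obtain qs where qs: "set qs \<subseteq> UNIV \<times> vcarrier E"
        "\<forall>b. pair_sum qs (\<lambda>a f. m a (f b)) = pair_sum ps (\<lambda>a h. m a (act h b))"
        using Cons by auto
      obtain rs where rs: "set rs \<subseteq> UNIV \<times> vcarrier E"
        "\<forall>y. pair_sum rs (\<lambda>a f. m a (f y)) = m x (act k y)"
        using one[of k x] Cons.prems p by auto
      show ?case
        using qs rs p by (intro exI[of _ "rs @ qs"]) simp
    qed
    then show "\<exists>qs. set qs \<subseteq> vcarrier A \<times> vcarrier E \<and>
        (\<forall>b\<in>UNIV. pair_sum qs (\<lambda>a f. m a (f b)) = \<phi> b)"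
      using ps(2) by simp
  qed
qed

lemma pi_bijective_commutant:
  assumes "gamma_bijective m H s act" "pi_bijective m H s act" "fin_dim A"
  shows "pi_bijective m E s (\<lambda>f a. f a)"
  unfolding pi_bijective_def
  using pi_full_commutant[OF assms] pi_faithful_commutant assms(1) by (simp add: gamma_bijective_def)

lemma pi_dual_lists:
  assumes "full_family A H UNIV (\<lambda>b a h. m a (act h b)) (linear_maps A A)"
    and "dual_bases A X d"
  shows "\<exists>C. \<forall>x\<in>X. set (C x) \<subseteq> UNIV \<times> vcarrier H \<and>
     (\<forall>b. pair_sum (C x) (\<lambda>c g. m c (act g b)) = s (d x b) 1)"
proof -
  have "\<exists>ps. set ps \<subseteq> UNIV \<times> vcarrier H \<and> (\<forall>b. pair_sum ps (\<lambda>c g. m c (act g b)) = s (d x b) 1)"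
    if x: "x \<in> X" for x
  proof -
    interpret d: Vector_Spaces.linear s "(*)" "d x"
      using dual_bases_linear[OF assms(2) x] by simp
    have "linear_map A A (\<lambda>b. s (d x b) 1)"
      by (auto simp: linear_map_def d.add d.scale scale_left_distrib)
    then show ?thesis by (rule pi_exists[OF assms(1)])
  qed
  then have "\<forall>x\<in>X. \<exists>ps. set ps \<subseteq> UNIV \<times> vcarrier H \<and>
      (\<forall>b. pair_sum ps (\<lambda>c g. m c (act g b)) = s (d x b) 1)"
    by blast
  then show ?thesis by (rule bchoice)
qed

text \<open>The dual counterpart of \<open>gamma_expansion\<close>. If \<open>C x\<close> is a preimage under \<open>\<pi>\<close> of the operator
  \<open>b \<mapsto> d\<^sub>x(b) 1\<close>, then \<open>1 \<otimes> f\<close> and \<open>\<Sum> f(x) C\<^sub>x\<close>, where \<open>f(x)\<close> multiplies the first factor from the left, have the same image, since \<open>f(b) = \<Sum> f(x) d\<^sub>x(b)\<close>.\<close>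

lemma pi_expansion:
  assumes inj: "faithful_family A H UNIV (\<lambda>b a h. m a (act h b))"
    and Xd: "dual_bases A X d"
    and C: "\<forall>x\<in>X. set (C x) \<subseteq> UNIV \<times> vcarrier H \<and>
     (\<forall>b. pair_sum (C x) (\<lambda>c g. m c (act g b)) = s (d x b) 1)"
    and U: "vspace U" and G: "bilinear_map A H U G" and f: "f \<in> vcarrier H"
  shows "(\<Sum>x\<in>X. pair_sum (C x) (\<lambda>c g. G (m (act f x) c) g)) = G 1 f"
proof -
  have X: "finite X" using dual_basesD[OF Xd] by blast
  obtain xs where xs: "set xs = X" "distinct xs" using finite_distinct_list[OF X] by blast
  define ps where "ps = concat (map (\<lambda>x. map (\<lambda>(c, g). (m (act f x) c, g)) (C x)) xs)"
  have ps: "pair_sum ps F = (\<Sum>x\<in>X. pair_sum (C x) (\<lambda>c g. F (m (act f x) c) g))"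
    for F :: "'a \<Rightarrow> 'h \<Rightarrow> 'x::ab_group_add"
    unfolding ps_def by (simp add: pair_sum_concat_distinct[OF xs(2)] xs(1) pair_sum_map)
  have "pair_sum ps G = pair_sum [(1, f)] G"
  proof (rule pi_unique[OF inj U G])
    show "set ps \<subseteq> UNIV \<times> vcarrier H" using C xs(1) by (fastforce simp: ps_def)
    show "set [(1, f)] \<subseteq> UNIV \<times> vcarrier H" using f by simp
    fix b
    have "pair_sum ps (\<lambda>a h. m a (act h b)) = (\<Sum>x\<in>X. m (act f x) (s (d x b) 1))"
      unfolding ps using C by (simp add: m_assoc m_pair_sum(1)[symmetric])
    also have "\<dots> = act f (\<Sum>x\<in>X. s (d x b) x)"
      by (simp add: act_sum f act_scale m_scale_right m_one_right)
    also have "(\<Sum>x\<in>X. s (d x b) x) = b"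
      using dual_bases_expand[OF Xd, of b] by simp
    finally show "pair_sum ps (\<lambda>a h. m a (act h b)) = pair_sum [(1, f)] (\<lambda>a h. m a (act h b))"
      by (simp add: m_one_left)
  qed
  then show ?thesis by (simp add: ps)
qed

lemma fin_dim_H:
  assumes \<pi>: "pi_bijective m H s act" and fin: "fin_dim A"
  shows "fin_dim H"
proof -
  have inj: "faithful_family A H UNIV (\<lambda>b a h. m a (act h b))"
    and full: "full_family A H UNIV (\<lambda>b a h. m a (act h b)) (linear_maps A A)"
    using \<pi> by (simp_all add: pi_bijective_def)
  obtain X d where Xd: "dual_bases A X d" using fin_dim_dual_bases[OF vspace_A fin] .
  have X: "finite X" using dual_basesD[OF Xd] by blast
  obtain C where C: "\<forall>x\<in>X. set (C x) \<subseteq> UNIV \<times> vcarrier H \<and>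
     (\<forall>b. pair_sum (C x) (\<lambda>c g. m c (act g b)) = s (d x b) 1)"
    using pi_dual_lists[OF full Xd] ..
  obtain \<tau> where \<tau>: "Vector_Spaces.linear s (*) \<tau>" "\<tau> 1 = 1"
    using unit_functional[OF vector_space_axioms] .
  interpret \<tau>: Vector_Spaces.linear s "(*)" \<tau> by fact
  interpret HH: vector_space "vscale H" by (rule ambient)
  define S where "S = (\<Union>x\<in>X. snd ` set (C x))"
  show ?thesis
  proof (rule fin_dimI[OF vspace_H, of S])
    show "finite S" using X by (auto simp: S_def)
    show "S \<subseteq> vcarrier H" using C by (fastforce simp: S_def)
    fix f assume f: "f \<in> vcarrier H"
    have "bilinear_map A H H (\<lambda>a h. vscale H (\<tau> a) h)"
      by (rule bilinear_mapI)
         (simp_all add: carrier_scale \<tau>.add \<tau>.scale HH.scale_left_distrib HH.scale_right_distrib mult.commute)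
    from pi_expansion[OF inj Xd C vspace_H this f]
    have "vscale H (\<tau> 1) f = (\<Sum>x\<in>X. pair_sum (C x) (\<lambda>c g. vscale H (\<tau> (m (act f x) c)) g))" by simp
    also have "\<dots> \<in> HH.span S"
      by (intro HH.span_sum pair_sum_in_span[OF ambient]) (force simp: S_def)
    finally show "f \<in> HH.span S" using \<tau>(2) by simp
  qed
qed

lemma flip_product: "algebra_product s (\<lambda>a b. m b a)"
  by unfold_locales
     (simp_all add: m_add_left m_add_right m_scale_left m_scale_right m_assoc m_one_left m_one_right)

text \<open>Injectivity: if \<open>\<Sum> (h b) a = 0\<close> for all \<open>h\<close>, then \<open>\<Sum> \<phi>(b) a = 0\<close> for every linear \<open>\<phi>\<close>, as \<open>\<phi>\<close> is a
  combination \<open>\<Sum> c h\<close> and \<open>c\<close> stands on the left of the product; so all slices of \<open>\<Sum> a \<otimes> b\<close> vanish.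
  Surjectivity: \<open>pi_expansion\<close> with \<open>G a h = a F(h)\<close> expresses \<open>F\<close> through the values \<open>h x\<close> at the basis of \<open>A\<close>.\<close>

lemma gamma_bijective_flip:
  assumes \<pi>: "pi_bijective m H s act" and fin: "fin_dim A"
  shows "gamma_bijective (\<lambda>a b. m b a) H s act"
proof -
  have inj: "faithful_family A H UNIV (\<lambda>b a h. m a (act h b))"
    and full: "full_family A H UNIV (\<lambda>b a h. m a (act h b)) (linear_maps A A)"
    using \<pi> by (simp_all add: pi_bijective_def)
  interpret op: acting_algebra H s act "\<lambda>a b. m b a"
    by (intro acting_algebra.intro represented_algebra_axioms flip_product)
  obtain X d where Xd: "dual_bases A X d" using fin_dim_dual_bases[OF vspace_A fin] .
  have X: "finite X" using dual_basesD[OF Xd] by blast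
  obtain xs where xs: "set xs = X" "distinct xs" using finite_distinct_list[OF X] by blast
  obtain C where C: "\<forall>x\<in>X. set (C x) \<subseteq> UNIV \<times> vcarrier H \<and>
     (\<forall>b. pair_sum (C x) (\<lambda>c g. m c (act g b)) = s (d x b) 1)"
    using pi_dual_lists[OF full Xd] ..
  have "faithful_family A A (vcarrier H) (\<lambda>h a b. m (act h b) a)"
  proof (rule faithful_familyI[OF vspace_A vspace_A op.bilinear_gamma])
    fix ps assume ps: "set ps \<subseteq> vcarrier A \<times> vcarrier A"
      and zero: "\<And>h. h \<in> vcarrier H \<Longrightarrow> pair_sum ps (\<lambda>a b. m (act h b) a) = 0"
    show "pair_sum ps (tensor A A) = 0"
    proof (rule tensor_zero_if_slices_right[OF vspace_A vspace_A ps])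
      fix \<alpha> :: "'a \<Rightarrow> 'k" assume "Vector_Spaces.linear (vscale A) (*) \<alpha>"
      then interpret \<alpha>: Vector_Spaces.linear s "(*)" \<alpha> by simp
      have "linear_map A A (\<lambda>b. s (\<alpha> b) 1)"
        by (auto simp: linear_map_def \<alpha>.add \<alpha>.scale scale_left_distrib)
      then obtain qs where qs: "set qs \<subseteq> UNIV \<times> vcarrier H"
        "\<forall>b. pair_sum qs (\<lambda>a h. m a (act h b)) = s (\<alpha> b) 1"
        using pi_exists[OF full] by blast
      have "pair_sum ps (\<lambda>v w. vscale A (\<alpha> w) v) =
          pair_sum ps (\<lambda>v w. m (pair_sum qs (\<lambda>a h. m a (act h w))) v)"
        by (simp add: qs(2) m_scale_left m_one_left)
      also have "\<dots> = pair_sum qs (\<lambda>a h. m a (pair_sum ps (\<lambda>v w. m (act h w) v)))"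
        by (simp add: m_pair_sum m_assoc pair_sum_commute[of ps])
      also have "\<dots> = pair_sum qs (\<lambda>a h. 0)"
        using qs(1) zero by (intro pair_sum_cong) (auto simp: m_zero)
      finally show "pair_sum ps (\<lambda>v w. vscale A (\<alpha> w) v) = 0" by simp
    qed
  qed
  moreover have "full_family A A (vcarrier H) (\<lambda>h a b. m (act h b) a) (linear_maps H A)"
    unfolding full_family_def
  proof
    fix F assume "F \<in> linear_maps H A"
    then have F: "linear_map H A F" by (simp add: linear_maps_def)
    define ps where "ps = concat (map (\<lambda>x. map (\<lambda>(c, g). (m c (F g), x)) (C x)) xs)"
    have "pair_sum ps (\<lambda>a b. m (act h b) a) = F h" if h: "h \<in> vcarrier H" for h
    proof -
      have G: "bilinear_map A H A (\<lambda>a g. m a (F g))"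
        using F by (intro bilinear_mapI)
          (simp_all add: linear_map_add linear_map_scale m_add_left m_add_right m_scale_left m_scale_right)
      have "pair_sum ps (\<lambda>a b. m (act h b) a) = (\<Sum>x\<in>X. pair_sum (C x) (\<lambda>c g. m (m (act h x) c) (F g)))"
        unfolding ps_def
        by (simp add: pair_sum_concat_distinct[OF xs(2)] xs(1) pair_sum_map m_assoc)
      also have "\<dots> = F h"
        using pi_expansion[OF inj Xd C vspace_A G h] by (simp add: m_one_left)
      finally show ?thesis .
    qed
    then show "\<exists>ps. set ps \<subseteq> vcarrier A \<times> vcarrier A \<and>
        (\<forall>h\<in>vcarrier H. pair_sum ps (\<lambda>a b. m (act h b) a) = F h)"
      by auto
  qed
  ultimately show ?thesis by (simp add: gamma_bijective_def)
qed

lemma act_in_double_commutant: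
  assumes "h \<in> vcarrier H"
  shows "act h \<in> vcarrier (module_endo E s (\<lambda>f a. f a))"
proof -
  interpret E: represented_algebra E s "\<lambda>f a. f a" by (rule commutant_represented)
  show ?thesis
    by (rule E.EI) (use assms in \<open>auto simp: act_add act_scale E_act\<close>)
qed

text \<open>An operator \<open>g\<close> commuting with \<open>E\<close> is \<open>\<Sum> a h\<close> with \<open>a \<in> A\<close>, by surjectivity of \<open>\<pi>\<close>. The map \<open>\<pi>\<close> of the
  commutant of \<open>E\<close> is injective (\<open>pi_faithful_commutant\<close> for \<open>E\<close>), so that \<open>1 \<otimes> g = \<Sum> a \<otimes> h\<close>. A functional \<open>\<tau>\<close>
  with \<open>\<tau>(1) = 1\<close> then gives \<open>g = \<Sum> \<tau>(a) h\<close>.\<close>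

lemma double_commutant:
  assumes \<pi>: "pi_bijective m H s act"
    and \<gamma>E: "gamma_bijective m E s (\<lambda>f a. f a)"
  shows "bij_betw act (vcarrier H) (vcarrier (module_endo E s (\<lambda>f a. f a)))"
proof -
  have inj: "faithful_family A H UNIV (\<lambda>b a h. m a (act h b))"
    and full: "full_family A H UNIV (\<lambda>b a h. m a (act h b)) (linear_maps A A)"
    using \<pi> by (simp_all add: pi_bijective_def)
  interpret E: acting_algebra E s "\<lambda>f a. f a" m by (rule commutant_acting)
  interpret EE: acting_algebra E.E s "\<lambda>f a. f a" m by (rule E.commutant_acting)
  interpret HH: vector_space "vscale H" by (rule ambient)
  obtain \<tau> where \<tau>: "Vector_Spaces.linear s (*) \<tau>" "\<tau> 1 = 1"
    using unit_functional[OF vector_space_axioms] .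
  interpret \<tau>: Vector_Spaces.linear s "(*)" \<tau> by fact
  have injEE: "faithful_family A E.E UNIV (\<lambda>b a f. m a (f b))"
    using E.pi_faithful_commutant \<gamma>E by (simp add: gamma_bijective_def)
  have "inj_on act (vcarrier H)"
  proof (rule inj_onI)
    fix g h assume g: "g \<in> vcarrier H" and h: "h \<in> vcarrier H" and eq: "act g = act h"
    have bil: "bilinear_map A H H (\<lambda>a h. vscale H (\<tau> a) h)"
      by (rule bilinear_mapI)
         (simp_all add: carrier_scale \<tau>.add \<tau>.scale HH.scale_left_distrib HH.scale_right_distrib mult.commute)
    have "pair_sum [(1, g)] (\<lambda>a h. vscale H (\<tau> a) h) = pair_sum [(1, h)] (\<lambda>a h. vscale H (\<tau> a) h)"
      by (rule pi_unique[OF inj vspace_H bil]) (use g h eq in auto)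
    then show "g = h" using \<tau>(2) by simp
  qed
  moreover have "g \<in> act ` vcarrier H" if g: "g \<in> vcarrier E.E" for g
  proof -
    have "linear_map A A g" using g E.E_carrier by blast
    then obtain ps where ps: "set ps \<subseteq> UNIV \<times> vcarrier H"
      "\<forall>b. pair_sum ps (\<lambda>a h. m a (act h b)) = g b"
      using pi_exists[OF full] by blast
    have bil: "bilinear_map A E.E E.E (\<lambda>a f. vscale E.E (\<tau> a) f)"
      using vspace.carrier_scale[OF E.vspace_E]
      by (intro bilinear_mapI)
         (simp_all add: E.E_simps \<tau>.add \<tau>.scale scale_left_distrib scale_right_distrib fun_eq_iff mult.commute)
    have "pair_sum [(1, g)] (\<lambda>a f. vscale E.E (\<tau> a) f) =
        pair_sum (map (\<lambda>(a, h). (a, act h)) ps) (\<lambda>a f. vscale E.E (\<tau> a) f)"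
    proof (rule EE.pi_unique[OF injEE E.vspace_E bil])
      show "set [(1, g)] \<subseteq> UNIV \<times> vcarrier E.E" using g by simp
      show "set (map (\<lambda>(a, h). (a, act h)) ps) \<subseteq> UNIV \<times> vcarrier E.E"
        using ps(1) act_in_double_commutant by auto
      show "pair_sum [(1, g)] (\<lambda>a f. m a (f b)) =
          pair_sum (map (\<lambda>(a, h). (a, act h)) ps) (\<lambda>a f. m a (f b))" for b
        using ps(2) by (simp add: pair_sum_map m_one_left)
    qed
    then have eq: "g b = pair_sum ps (\<lambda>a h. s (\<tau> a) (act h b))" for b
      by (simp add: pair_sum_map E.E_simps \<tau>(2) pair_sum_apply fun_eq_iff)
    have h: "pair_sum ps (\<lambda>a h. vscale H (\<tau> a) h) \<in> vcarrier H"
      using ps(1) by (intro carrier_pair_sum carrier_scale) auto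
    have "g b = act (pair_sum ps (\<lambda>a h. vscale H (\<tau> a) h)) b" for b
    proof -
      have "act (pair_sum ps (\<lambda>a h. vscale H (\<tau> a) h)) b = pair_sum ps (\<lambda>a h. act (vscale H (\<tau> a) h) b)"
        using ps(1) carrier_scale by (intro linear_map_pair_sum[OF vspace_H act_linear_left]) auto
      also have "\<dots> = pair_sum ps (\<lambda>a h. s (\<tau> a) (act h b))"
        using ps(1) by (intro pair_sum_cong) (auto simp: act_scale_left)
      finally show ?thesis using eq by simp
    qed
    then show ?thesis using h by blast
  qed
  moreover have "act ` vcarrier H \<subseteq> vcarrier E.E" using act_in_double_commutant by blast
  ultimately show ?thesis unfolding bij_betw_def by blast
qed

end

section \<open>The four Galois maps\<close>

text \<open>\<open>\<gamma>'\<close> is \<open>gamma_bijective\<close> for the opposite product only after the two tensor factors are exchanged.\<close>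

lemma faithful_family_swap:
  assumes "faithful_family V W I F"
  shows "faithful_family W V I (\<lambda>i w v. F i v w)"
  unfolding faithful_family_def
proof (intro allI impI)
  fix ps qs
  assume ps: "set ps \<subseteq> vcarrier W \<times> vcarrier V" and qs: "set qs \<subseteq> vcarrier W \<times> vcarrier V"
    and eq: "\<forall>i\<in>I. pair_sum ps (\<lambda>w v. F i v w) = pair_sum qs (\<lambda>w v. F i v w)"
  show "pair_sum ps (tensor W V) = pair_sum qs (tensor W V)"
  proof (rule tensor_pair_sum_eqI)
    fix \<beta> assume "bilinear_map W V ground \<beta>"
    then have \<beta>: "bilinear_map V W ground (\<lambda>v w. \<beta> w v)" by (rule bilinear_map_swap)
    have "pair_sum (map prod.swap ps) (\<lambda>v w. \<beta> w v) = pair_sum (map prod.swap qs) (\<lambda>v w. \<beta> w v)"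
      by (rule faithful_familyD[OF assms vspace_ground \<beta>]) (use ps qs eq in \<open>auto simp: pair_sum_swap\<close>)
    then show "pair_sum ps \<beta> = pair_sum qs \<beta>" by (simp add: pair_sum_swap)
  qed
qed

lemma faithful_family_swap_iff:
  "faithful_family W V I (\<lambda>i w v. F i v w) \<longleftrightarrow> faithful_family V W I F"
  using faithful_family_swap[of V W I F] faithful_family_swap[of W V I "\<lambda>i w v. F i v w"] by blast

lemma full_family_swap:
  assumes "full_family V W I F X"
  shows "full_family W V I (\<lambda>i w v. F i v w) X"
  unfolding full_family_def
proof
  fix \<phi> assume "\<phi> \<in> X"
  then obtain ps where "set ps \<subseteq> vcarrier V \<times> vcarrier W" "\<forall>i\<in>I. pair_sum ps (F i) = \<phi> i"
    using assms unfolding full_family_def by blast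
  then show "\<exists>ps. set ps \<subseteq> vcarrier W \<times> vcarrier V \<and> (\<forall>i\<in>I. pair_sum ps (\<lambda>w v. F i v w) = \<phi> i)"
    by (intro exI[of _ "map prod.swap ps"]) (auto simp: pair_sum_swap)
qed

lemma full_family_swap_iff:
  "full_family W V I (\<lambda>i w v. F i v w) X \<longleftrightarrow> full_family V W I F X"
  using full_family_swap[of V W I F] full_family_swap[of W V I "\<lambda>i w v. F i v w"] by blast

context acting_algebra
begin

lemma pi_bijective_iff:
  "bij_betw (\<lambda>t b. tensor_lift A H (\<lambda>a h. m a (act h b)) t)
     (vcarrier (tensor_space A H)) (linear_maps A A) \<longleftrightarrow> pi_bijective m H s act"
proof -
  have "bij_betw (\<lambda>t. \<lambda>b\<in>UNIV. tensor_lift A H (\<lambda>a h. m a (act h b)) t)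
     (vcarrier (tensor_space A H)) (linear_maps A A) \<longleftrightarrow> pi_bijective m H s act"
    unfolding pi_bijective_def
  proof (rule bij_betw_tensor_lift_iff[OF vspace_A vspace_A bilinear_pi])
    fix ps assume ps: "set ps \<subseteq> vcarrier A \<times> vcarrier H"
    have "pair_sum ps (\<lambda>a h. m a (act h (x + y))) =
        pair_sum ps (\<lambda>a h. m a (act h x)) + pair_sum ps (\<lambda>a h. m a (act h y))" for x y
      unfolding pair_sum_add[symmetric]
      using ps by (intro pair_sum_cong) (auto simp: act_add m_add_right)
    moreover have "pair_sum ps (\<lambda>a h. m a (act h (s c x))) = s c (pair_sum ps (\<lambda>a h. m a (act h x)))"
      for c x
    proof -
      have "s c (pair_sum ps (\<lambda>a h. m a (act h x))) = pair_sum ps (\<lambda>a h. s c (m a (act h x)))"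
        by (rule pair_sum_hom) (simp_all add: scale_right_distrib)
      also have "\<dots> = pair_sum ps (\<lambda>a h. m a (act h (s c x)))"
        using ps by (intro pair_sum_cong) (auto simp: act_scale m_scale_right)
      finally show ?thesis ..
    qed
    ultimately show "(\<lambda>b\<in>UNIV. pair_sum ps (\<lambda>a h. m a (act h b))) \<in> linear_maps A A"
      by (simp add: linear_maps_def linear_map_def)
  qed (auto simp: linear_maps_def)
  then show ?thesis by (simp add: restrict_def)
qed

lemma gamma_bijective_iff:
  "bij_betw (\<lambda>t. \<lambda>h\<in>vcarrier H. tensor_lift A A (\<lambda>a b. m a (act h b)) t)
     (vcarrier (tensor_space A A)) (linear_maps H A) \<longleftrightarrow> gamma_bijective m H s act"
  and gamma_bijective_swap_iff:
  "bij_betw (\<lambda>t. \<lambda>h\<in>vcarrier H. tensor_lift A A (\<lambda>b a. m a (act h b)) t)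
     (vcarrier (tensor_space A A)) (linear_maps H A) \<longleftrightarrow> gamma_bijective m H s act"
proof -
  have into: "(\<lambda>h\<in>vcarrier H. pair_sum ps (\<lambda>a b. m a (act h b))) \<in> linear_maps H A" for ps
  proof -
    have "pair_sum ps (\<lambda>a b. m a (act (g + h) b)) =
        pair_sum ps (\<lambda>a b. m a (act g b)) + pair_sum ps (\<lambda>a b. m a (act h b))"
      if "g \<in> vcarrier H" "h \<in> vcarrier H" for g h
      unfolding pair_sum_add[symmetric]
      using that by (intro pair_sum_cong) (auto simp: act_add_left m_add_right)
    moreover have "pair_sum ps (\<lambda>a b. m a (act (vscale H c h) b)) = s c (pair_sum ps (\<lambda>a b. m a (act h b)))"
      if "h \<in> vcarrier H" for c h
    proof -
      have "s c (pair_sum ps (\<lambda>a b. m a (act h b))) = pair_sum ps (\<lambda>a b. s c (m a (act h b)))"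
        by (rule pair_sum_hom) (simp_all add: scale_right_distrib)
      also have "\<dots> = pair_sum ps (\<lambda>a b. m a (act (vscale H c h) b))"
        using that by (intro pair_sum_cong) (auto simp: act_scale_left m_scale_right)
      finally show ?thesis ..
    qed
    ultimately show ?thesis
      using carrier_add carrier_scale by (auto simp: linear_maps_def linear_map_def)
  qed
  have into': "(\<lambda>h\<in>vcarrier H. pair_sum ps (\<lambda>b a. m a (act h b))) \<in> linear_maps H A" for ps
    using into[of "map prod.swap ps"] by (simp add: pair_sum_swap)
  show "bij_betw (\<lambda>t. \<lambda>h\<in>vcarrier H. tensor_lift A A (\<lambda>a b. m a (act h b)) t)
     (vcarrier (tensor_space A A)) (linear_maps H A) \<longleftrightarrow> gamma_bijective m H s act"
    unfolding gamma_bijective_def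
  proof (rule bij_betw_tensor_lift_iff[OF vspace_A vspace_A bilinear_gamma])
    show "linear_maps H A \<subseteq> extensional (vcarrier H)" by (auto simp: linear_maps_def)
  qed (assumption, rule into)
  have "bij_betw (\<lambda>t. \<lambda>h\<in>vcarrier H. tensor_lift A A (\<lambda>b a. m a (act h b)) t)
     (vcarrier (tensor_space A A)) (linear_maps H A) \<longleftrightarrow>
     faithful_family A A (vcarrier H) (\<lambda>h b a. m a (act h b)) \<and>
     full_family A A (vcarrier H) (\<lambda>h b a. m a (act h b)) (linear_maps H A)"
  proof (rule bij_betw_tensor_lift_iff[OF vspace_A vspace_A bilinear_map_swap[OF bilinear_gamma]])
    show "linear_maps H A \<subseteq> extensional (vcarrier H)" by (auto simp: linear_maps_def)
  qed (assumption, rule into')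
  then show "bij_betw (\<lambda>t. \<lambda>h\<in>vcarrier H. tensor_lift A A (\<lambda>b a. m a (act h b)) t)
     (vcarrier (tensor_space A A)) (linear_maps H A) \<longleftrightarrow> gamma_bijective m H s act"
    by (simp only: gamma_bijective_def
        faithful_family_swap_iff[of A A "vcarrier H" "\<lambda>h a b. m a (act h b)"]
        full_family_swap_iff[of A A "vcarrier H" "\<lambda>h a b. m a (act h b)"])
qed

end

lemma (in represented_algebra) galois_maps_iff:
  assumes "algebra_product s (*)"
  shows "bij_betw (galois_pi H s act) (vcarrier (tensor_space A H)) (linear_maps A A)
           \<longleftrightarrow> pi_bijective (*) H s act"
    and "bij_betw (galois_pi' H s act) (vcarrier (tensor_space A H)) (linear_maps A A)
           \<longleftrightarrow> pi_bijective (\<lambda>a b. b * a) H s act"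
    and "bij_betw (galois_gamma H s act) (vcarrier (tensor_space A A)) (linear_maps H A)
           \<longleftrightarrow> gamma_bijective (*) H s act"
    and "bij_betw (galois_gamma' H s act) (vcarrier (tensor_space A A)) (linear_maps H A)
           \<longleftrightarrow> gamma_bijective (\<lambda>a b. b * a) H s act"
proof -
  interpret acting_algebra H s act "(*)"
    by (intro acting_algebra.intro represented_algebra_axioms assms)
  interpret op: acting_algebra H s act "\<lambda>a b. b * a"
    by (intro acting_algebra.intro represented_algebra_axioms flip_product)
  show "bij_betw (galois_pi H s act) (vcarrier (tensor_space A H)) (linear_maps A A)
           \<longleftrightarrow> pi_bijective (*) H s act"
    "bij_betw (galois_pi' H s act) (vcarrier (tensor_space A H)) (linear_maps A A)
           \<longleftrightarrow> pi_bijective (\<lambda>a b. b * a) H s act"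
    "bij_betw (galois_gamma H s act) (vcarrier (tensor_space A A)) (linear_maps H A)
           \<longleftrightarrow> gamma_bijective (*) H s act"
    "bij_betw (galois_gamma' H s act) (vcarrier (tensor_space A A)) (linear_maps H A)
           \<longleftrightarrow> gamma_bijective (\<lambda>a b. b * a) H s act"
    using pi_bijective_iff op.pi_bijective_iff gamma_bijective_iff op.gamma_bijective_swap_iff
    by (simp_all add: galois_pi_def[abs_def] galois_pi'_def[abs_def] galois_gamma_def[abs_def]
        galois_gamma'_def[abs_def])
qed

section \<open>Multilinear maps and coassociativity\<close>

lemma tensor_carrier:
  "\<lbrakk>v \<in> vcarrier V; w \<in> vcarrier W\<rbrakk> \<Longrightarrow> tensor V W v w \<in> vcarrier (tensor_space V W)"
  by (rule bilinear_map_carrier[OF tensor_bilinear])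

lemma linear_map_ident: "linear_map V V (\<lambda>x. x)"
  by (simp add: linear_map_def)

lemma linear_map_compose: "\<lbrakk>linear_map V W f; linear_map W U g\<rbrakk> \<Longrightarrow> linear_map V U (\<lambda>x. g (f x))"
  by (auto simp: linear_map_def Pi_iff)

lemma bilinear_map_compose:
  "\<lbrakk>bilinear_map V' W' U f; linear_map V V' g; linear_map W W' h\<rbrakk>
    \<Longrightarrow> bilinear_map V W U (\<lambda>v w. f (g v) (h w))"
  by (auto simp: bilinear_map_def linear_map_def Pi_iff)

lemma bilinear_map_linear:
  "\<lbrakk>bilinear_map V W U f; linear_map U X g\<rbrakk> \<Longrightarrow> bilinear_map V W X (\<lambda>v w. g (f v w))"
  by (auto simp: bilinear_map_def linear_map_def Pi_iff)

definition trilinear_map where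
  "trilinear_map V W X U F \<longleftrightarrow> (\<forall>v\<in>vcarrier V. bilinear_map W X U (F v)) \<and>
     (\<forall>w\<in>vcarrier W. \<forall>x\<in>vcarrier X. linear_map V U (\<lambda>v. F v w x))"

lemma trilinear_map_rotate:
  "trilinear_map V W X U F \<Longrightarrow> trilinear_map X V W U (\<lambda>x v w. F v w x)"
  by (auto simp: trilinear_map_def bilinear_map_def)

lemma bilinear_tensor_lift:
  fixes V :: "('k::field, 'v::ab_group_add, 'y) vspace_scheme"
    and W :: "('k, 'w::ab_group_add, 'z) vspace_scheme"
  assumes V: "vspace V" and W: "vspace W" and U: "vspace U" and F: "trilinear_map V W X U F"
  shows "bilinear_map V (tensor_space W X) U (\<lambda>v t. tensor_lift W X (F v) t)"
  unfolding bilinear_map_def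
proof (intro conjI ballI)
  fix v assume "v \<in> vcarrier V"
  then show "linear_map (tensor_space W X) U (tensor_lift W X (F v))"
    using F by (intro tensor_lift_linear[OF W U]) (auto simp: trilinear_map_def)
next
  fix t assume "t \<in> vcarrier (tensor_space W X)"
  then obtain ps where ps: "set ps \<subseteq> vcarrier W \<times> vcarrier X" "t = pair_sum ps (tensor W X)"
    using tensor_space_pair_sum[OF W] by blast
  have val: "tensor_lift W X (F v) t = pair_sum ps (F v)" if "v \<in> vcarrier V" for v
    using tensor_lift_pair_sum[OF U _ ps(1), of "F v"] F that ps(2) by (auto simp: trilinear_map_def)
  interpret U: vector_space "vscale U" using U by (simp add: vspace_def)
  have lin: "linear_map V U (\<lambda>v. F v w x)" if "(w, x) \<in> set ps" for w x
    using F that ps(1) by (auto simp: trilinear_map_def)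
  show "linear_map V U (\<lambda>v. tensor_lift W X (F v) t)"
    unfolding linear_map_def
  proof (intro conjI ballI allI Pi_I)
    fix v assume v: "v \<in> vcarrier V"
    show "tensor_lift W X (F v) t \<in> vcarrier U"
      unfolding val[OF v]
      using linear_map_carrier[OF lin v] by (intro vspace.carrier_pair_sum[OF U])
    show "tensor_lift W X (F (v + v')) t = tensor_lift W X (F v) t + tensor_lift W X (F v') t"
      if v': "v' \<in> vcarrier V" for v'
      unfolding val[OF v] val[OF v'] val[OF vspace.carrier_add[OF V v v']] pair_sum_add[symmetric]
      using linear_map_add[OF lin v v'] by (intro pair_sum_cong)
    fix c
    have "vscale U c (pair_sum ps (F v)) = pair_sum ps (\<lambda>w x. vscale U c (F v w x))"
      by (rule pair_sum_hom) (simp_all add: U.scale_right_distrib)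
    also have "\<dots> = pair_sum ps (F (vscale V c v))"
      using linear_map_scale[OF lin v] by (intro pair_sum_cong) simp
    finally show "tensor_lift W X (F (vscale V c v)) t = vscale U c (tensor_lift W X (F v) t)"
      unfolding val[OF v] val[OF vspace.carrier_scale[OF V v]] ..
  qed
qed

lemma tensor_lift_eqI:
  fixes V :: "('k::field, 'v::ab_group_add, 'y) vspace_scheme"
    and W :: "('k, 'w::ab_group_add, 'z) vspace_scheme"
  assumes V: "vspace V" and U: "vspace U" and g: "linear_map (tensor_space V W) U g"
    and h: "linear_map (tensor_space V W) U h"
    and "\<And>v w. \<lbrakk>v \<in> vcarrier V; w \<in> vcarrier W\<rbrakk> \<Longrightarrow> g (tensor V W v w) = h (tensor V W v w)"
    and t: "t \<in> vcarrier (tensor_space V W)"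
  shows "g t = h t"
proof -
  obtain ps where ps: "set ps \<subseteq> vcarrier V \<times> vcarrier W" "t = pair_sum ps (tensor V W)"
    using tensor_space_pair_sum[OF V t] .
  have "f (pair_sum ps (tensor V W)) = pair_sum ps (\<lambda>v w. f (tensor V W v w))"
    if "linear_map (tensor_space V W) U f" for f
    using ps(1) by (intro linear_map_pair_sum[OF vspace_tensor_space that] tensor_carrier) auto
  note val = this
  show ?thesis
    unfolding ps(2) val[OF g] val[OF h]
    using ps(1) by (intro pair_sum_cong assms(5)) auto
qed

lemma tensor_map_linear:
  fixes V :: "('k::field, 'v::ab_group_add, 'y) vspace_scheme"
    and W :: "('k, 'w::ab_group_add, 'z) vspace_scheme"
  assumes "vspace V" "linear_map V V1 f" "linear_map W W1 g"
  shows "linear_map (tensor_space V W) (tensor_space V1 W1) (tensor_map V W V1 W1 f g)"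
  unfolding tensor_map_def
  by (intro tensor_lift_linear assms vspace_tensor_space bilinear_map_compose[OF tensor_bilinear])

lemma tensor_map_tensor:
  assumes "linear_map V V1 f" "linear_map W W1 g" "v \<in> vcarrier V" "w \<in> vcarrier W"
  shows "tensor_map V W V1 W1 f g (tensor V W v w) = tensor V1 W1 (f v) (g w)"
  unfolding tensor_map_def
  by (rule tensor_lift_tensor[OF vspace_tensor_space bilinear_map_compose[OF tensor_bilinear assms(1,2)] assms(3,4)])

lemma tensor_trilinear: "trilinear_map U V W (tensor_space U (tensor_space V W))
    (\<lambda>u v w. tensor U (tensor_space V W) u (tensor V W v w))"
  unfolding trilinear_map_def
proof (intro conjI ballI)
  fix u assume u: "u \<in> vcarrier U"
  then show "bilinear_map V W (tensor_space U (tensor_space V W)) (\<lambda>v w. tensor U (tensor_space V W) u (tensor V W v w))"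
    using tensor_bilinear[of U "tensor_space V W"]
    by (intro bilinear_map_linear[OF tensor_bilinear]) (auto simp: bilinear_map_def)
next
  fix v w assume "v \<in> vcarrier V" "w \<in> vcarrier W"
  then show "linear_map U (tensor_space U (tensor_space V W)) (\<lambda>u. tensor U (tensor_space V W) u (tensor V W v w))"
    using tensor_bilinear[of U "tensor_space V W"] tensor_carrier[of v V w W]
    by (auto simp: bilinear_map_def)
qed

lemma
  fixes U :: "('k::field, 'u::ab_group_add, 'x) vspace_scheme"
    and V :: "('k, 'v::ab_group_add, 'y) vspace_scheme"
    and W :: "('k, 'w::ab_group_add, 'z) vspace_scheme"
  assumes U: "vspace U" and V: "vspace V" and W: "vspace W"
  shows tensor_assoc_linear: "linear_map (tensor_space (tensor_space U V) W)
      (tensor_space U (tensor_space V W)) (tensor_assoc U V W)"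
    and tensor_assoc_tensor: "\<lbrakk>t \<in> vcarrier (tensor_space U V); w \<in> vcarrier W\<rbrakk> \<Longrightarrow>
      tensor_assoc U V W (tensor (tensor_space U V) W t w) =
      tensor_lift U V (\<lambda>u v. tensor U (tensor_space V W) u (tensor V W v w)) t"
proof -
  have bil: "bilinear_map (tensor_space U V) W (tensor_space U (tensor_space V W))
      (\<lambda>t w. tensor_lift U V (\<lambda>u v. tensor U (tensor_space V W) u (tensor V W v w)) t)"
    by (rule bilinear_map_swap, rule bilinear_tensor_lift[OF W U vspace_tensor_space],
        rule trilinear_map_rotate, rule tensor_trilinear)
  show "linear_map (tensor_space (tensor_space U V) W)
      (tensor_space U (tensor_space V W)) (tensor_assoc U V W)"
    unfolding tensor_assoc_def by (rule tensor_lift_linear[OF vspace_tensor_space vspace_tensor_space bil])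
  show "\<lbrakk>t \<in> vcarrier (tensor_space U V); w \<in> vcarrier W\<rbrakk> \<Longrightarrow>
      tensor_assoc U V W (tensor (tensor_space U V) W t w) =
      tensor_lift U V (\<lambda>u v. tensor U (tensor_space V W) u (tensor V W v w)) t"
    unfolding tensor_assoc_def by (rule tensor_lift_tensor[OF vspace_tensor_space bil])
qed

text \<open>The two sides of the coassociativity law, seen through a trilinear map \<open>F\<close>: these are the Sweedler
  sums \<open>\<Sum> F p' p'' q\<close> and \<open>\<Sum> F p q' q''\<close>, with no tensor product of three factors in them. They serve both
  to use coassociativity in \<open>H\<close> and to prove it in \<open>E\<close>.\<close>

lemma
  fixes V :: "('k::field, 'v::ab_group_add, 'y) vspace_scheme"
    and U :: "('k, 'u::ab_group_add, 'z) vspace_scheme"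
  assumes V: "vspace V" and U: "vspace U" and \<Delta>: "linear_map V (tensor_space V V) \<Delta>"
    and F: "trilinear_map V V V U F" and t: "t \<in> vcarrier (tensor_space V V)"
  shows tensor_lift_comult_left:
      "tensor_lift V (tensor_space V V) (\<lambda>p u. tensor_lift V V (F p) u)
        (tensor_assoc V V V (tensor_map V V (tensor_space V V) V \<Delta> (\<lambda>x. x) t)) =
       tensor_lift V V (\<lambda>p q. tensor_lift V V (\<lambda>u v. F u v q) (\<Delta> p)) t"
    and tensor_lift_comult_right:
      "tensor_lift V (tensor_space V V) (\<lambda>p u. tensor_lift V V (F p) u)
        (tensor_map V V V (tensor_space V V) (\<lambda>x. x) \<Delta> t) =
       tensor_lift V V (\<lambda>p q. tensor_lift V V (F p) (\<Delta> q)) t"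
proof -
  let ?T = "tensor_space V V"
  let ?G = "tensor_lift V ?T (\<lambda>p u. tensor_lift V V (F p) u)"
  have T: "vspace ?T" by (rule vspace_tensor_space)
  have bilG: "bilinear_map V ?T U (\<lambda>p u. tensor_lift V V (F p) u)"
    by (rule bilinear_tensor_lift[OF V V U F])
  have G: "linear_map (tensor_space V ?T) U ?G"
    by (rule tensor_lift_linear[OF V U bilG])
  have bilL: "bilinear_map ?T V U (\<lambda>u q. tensor_lift V V (\<lambda>x y. F x y q) u)"
    by (rule bilinear_map_swap, rule bilinear_tensor_lift[OF V V U trilinear_map_rotate[OF F]])
  have bilF: "bilinear_map V V U (\<lambda>x y. F x y q)" if "q \<in> vcarrier V" for q
    using trilinear_map_rotate[OF F] that by (simp add: trilinear_map_def)
  note tri = trilinear_map_rotate[OF tensor_trilinear[of V V V], unfolded trilinear_map_def]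
  show "?G (tensor_map V V V ?T (\<lambda>x. x) \<Delta> t) = tensor_lift V V (\<lambda>p q. tensor_lift V V (F p) (\<Delta> q)) t"
  proof (rule tensor_lift_eqI[OF V U _ _ _ t])
    show "linear_map ?T U (\<lambda>t. ?G (tensor_map V V V ?T (\<lambda>x. x) \<Delta> t))"
      by (rule linear_map_compose[OF tensor_map_linear[OF V linear_map_ident \<Delta>] G])
    have bil: "bilinear_map V V U (\<lambda>p q. tensor_lift V V (F p) (\<Delta> q))"
      by (rule bilinear_map_compose[OF bilG linear_map_ident \<Delta>])
    then show "linear_map ?T U (\<lambda>t. tensor_lift V V (\<lambda>p q. tensor_lift V V (F p) (\<Delta> q)) t)"
      by (rule tensor_lift_linear[OF V U])
    fix p q assume pq: "p \<in> vcarrier V" "q \<in> vcarrier V"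
    show "?G (tensor_map V V V ?T (\<lambda>x. x) \<Delta> (tensor V V p q)) =
        tensor_lift V V (\<lambda>p q. tensor_lift V V (F p) (\<Delta> q)) (tensor V V p q)"
      unfolding tensor_map_tensor[OF linear_map_ident \<Delta> pq] tensor_lift_tensor[OF U bil pq]
      by (rule tensor_lift_tensor[OF U bilG pq(1) linear_map_carrier[OF \<Delta> pq(2)]])
  qed
  show "?G (tensor_assoc V V V (tensor_map V V ?T V \<Delta> (\<lambda>x. x) t)) =
      tensor_lift V V (\<lambda>p q. tensor_lift V V (\<lambda>u v. F u v q) (\<Delta> p)) t"
  proof (rule tensor_lift_eqI[OF V U _ _ _ t])
    show "linear_map ?T U (\<lambda>t. ?G (tensor_assoc V V V (tensor_map V V ?T V \<Delta> (\<lambda>x. x) t)))"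
      by (rule linear_map_compose[OF linear_map_compose[OF
            tensor_map_linear[OF V \<Delta> linear_map_ident] tensor_assoc_linear[OF V V V]] G])
    have bil: "bilinear_map V V U (\<lambda>p q. tensor_lift V V (\<lambda>u v. F u v q) (\<Delta> p))"
      by (rule bilinear_map_compose[OF bilL \<Delta> linear_map_ident])
    then show "linear_map ?T U (\<lambda>t. tensor_lift V V (\<lambda>p q. tensor_lift V V (\<lambda>u v. F u v q) (\<Delta> p)) t)"
      by (rule tensor_lift_linear[OF V U])
    fix p q assume pq: "p \<in> vcarrier V" "q \<in> vcarrier V"
    have \<Delta>p: "\<Delta> p \<in> vcarrier ?T" by (rule linear_map_carrier[OF \<Delta> pq(1)])
    have "?G (tensor_lift V V (\<lambda>u v. tensor V ?T u (tensor V V v q)) (\<Delta> p)) =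
        tensor_lift V V (\<lambda>u v. F u v q) (\<Delta> p)"
    proof (rule tensor_lift_eqI[OF V U _ _ _ \<Delta>p])
      have b: "bilinear_map V V (tensor_space V ?T) (\<lambda>u v. tensor V ?T u (tensor V V v q))"
        using tri pq(2) by blast
      show "linear_map ?T U (\<lambda>u. ?G (tensor_lift V V (\<lambda>u v. tensor V ?T u (tensor V V v q)) u))"
        by (rule linear_map_compose[OF tensor_lift_linear[OF V vspace_tensor_space b] G])
      show "linear_map ?T U (\<lambda>u. tensor_lift V V (\<lambda>u v. F u v q) u)"
        by (rule tensor_lift_linear[OF V U bilF[OF pq(2)]])
      fix u v assume uv: "u \<in> vcarrier V" "v \<in> vcarrier V"
      have Fu: "bilinear_map V V U (F u)" using F uv(1) by (simp add: trilinear_map_def)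
      show "?G (tensor_lift V V (\<lambda>u v. tensor V ?T u (tensor V V v q)) (tensor V V u v)) =
          tensor_lift V V (\<lambda>u v. F u v q) (tensor V V u v)"
        unfolding tensor_lift_tensor[OF vspace_tensor_space b uv] tensor_lift_tensor[OF U bilF[OF pq(2)] uv]
          tensor_lift_tensor[OF U bilG uv(1) tensor_carrier[OF uv(2) pq(2)]]
        by (rule tensor_lift_tensor[OF U Fu uv(2) pq(2)])
    qed
    then show "?G (tensor_assoc V V V (tensor_map V V ?T V \<Delta> (\<lambda>x. x) (tensor V V p q))) =
        tensor_lift V V (\<lambda>p q. tensor_lift V V (\<lambda>u v. F u v q) (\<Delta> p)) (tensor V V p q)"
      unfolding tensor_map_tensor[OF \<Delta> linear_map_ident pq] tensor_lift_tensor[OF U bil pq]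
        tensor_assoc_tensor[OF V V V \<Delta>p pq(2)] .
  qed
qed

section \<open>The Hopf algebra of a Galois algebra of operators\<close>

lemma sum_fun_apply: "(\<Sum>i\<in>I. f i) x = (\<Sum>i\<in>I. f i x)"
  by (induction I rule: infinite_finite_induct) simp_all

lemma faithful_tensor_eqI:
  assumes F: "faithful_family V W I F" and V: "vspace V" and U: "vspace U"
    and bil: "\<And>i. i \<in> I \<Longrightarrow> bilinear_map V W U (F i)"
    and t: "t \<in> vcarrier (tensor_space V W)" and u: "u \<in> vcarrier (tensor_space V W)"
    and eq: "\<And>i. i \<in> I \<Longrightarrow> tensor_lift V W (F i) t = tensor_lift V W (F i) u"
  shows "t = u"
proof -
  obtain ps where ps: "set ps \<subseteq> vcarrier V \<times> vcarrier W" "t = pair_sum ps (tensor V W)"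
    using tensor_space_pair_sum[OF V t] .
  obtain qs where qs: "set qs \<subseteq> vcarrier V \<times> vcarrier W" "u = pair_sum qs (tensor V W)"
    using tensor_space_pair_sum[OF V u] .
  have "pair_sum ps (F i) = pair_sum qs (F i)" if "i \<in> I" for i
    using eq[OF that] ps(2) qs(2)
      tensor_lift_pair_sum[OF U bil[OF that] ps(1)] tensor_lift_pair_sum[OF U bil[OF that] qs(1)]
    by simp
  then show ?thesis
    using F ps qs unfolding faithful_family_def by blast
qed

text \<open>What the commutant of a Galois action provides for the construction of its Hopf structure. The
  lists \<open>T e\<close> and \<open>T' e\<close> represent preimages of the coordinate functional \<open>d e\<close> under the two maps \<open>\<gamma>\<close>, the
  second one with exchanged factors. They determine the two families of coefficients of \<open>f\<close> for which
  \<open>f(x y) = \<Sum> a\<^sub>e(x) e(y)\<close> and \<open>f(x) y = \<Sum> b\<^sub>e(x e(y))\<close>. The coefficients \<open>a\<^sub>e\<close> and \<open>b\<^sub>e\<close> lie in \<open>D\<close> by assumption;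
  this is where the Hopf structure of the original acting algebra is used.\<close>

locale galois_operators = represented_algebra D s "\<lambda>f a. f a"
  for D :: "('k::field, 'a::ring_1 \<Rightarrow> 'a) kalg" and s +
  fixes B :: "('a \<Rightarrow> 'a) set" and d :: "('a \<Rightarrow> 'a) \<Rightarrow> ('a \<Rightarrow> 'a) \<Rightarrow> 'k"
    and T T' :: "('a \<Rightarrow> 'a) \<Rightarrow> ('a \<times> 'a) list"
  assumes product: "algebra_product s (*)"
    and D_scale: "vscale D c f = (\<lambda>a. s c (f a))"
    and D_mult: "amult D f g = f \<circ> g"
    and D_one: "aone D = id"
    and Bd: "dual_bases D B d"
    and gamma_faithful: "faithful_family A A (vcarrier D) (\<lambda>f a b. a * f b)"
    and gamma'_faithful: "faithful_family A A (vcarrier D) (\<lambda>f a b. f b * a)"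
    and pi'_faithful: "faithful_family A D UNIV (\<lambda>b a f. f b * a)"
    and T: "\<lbrakk>e \<in> B; f \<in> vcarrier D\<rbrakk> \<Longrightarrow> pair_sum (T e) (\<lambda>u v. u * f v) = s (d e f) 1"
    and T': "\<lbrakk>e \<in> B; f \<in> vcarrier D\<rbrakk> \<Longrightarrow> pair_sum (T' e) (\<lambda>u v. f v * u) = s (d e f) 1"
    and coefficient_closed:
      "\<lbrakk>e \<in> B; f \<in> vcarrier D\<rbrakk> \<Longrightarrow> (\<lambda>x. pair_sum (T' e) (\<lambda>u v. f (x * v) * u)) \<in> vcarrier D"
    and twisted_coefficient_closed:
      "\<lbrakk>e \<in> B; f \<in> vcarrier D\<rbrakk> \<Longrightarrow> (\<lambda>x. pair_sum (T e) (\<lambda>u v. f (x * u) * v)) \<in> vcarrier D"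
    and value_at_one: "f \<in> vcarrier D \<Longrightarrow> \<exists>c. f 1 = s c 1"
begin

sublocale P: algebra_product s "(*)" by (rule product)
sublocale L: acting_algebra D s "\<lambda>f a. f a" "(*)"
  by (intro acting_algebra.intro represented_algebra_axioms product)
sublocale R: acting_algebra D s "\<lambda>f a. f a" "\<lambda>a b. b * a"
  by (intro acting_algebra.intro represented_algebra_axioms L.flip_product)

definition coefficient :: "('a \<Rightarrow> 'a) \<Rightarrow> ('a \<Rightarrow> 'a) \<Rightarrow> 'a \<Rightarrow> 'a" where
  "coefficient e f = (\<lambda>x. pair_sum (T' e) (\<lambda>u v. f (x * v) * u))"

definition twisted_coefficient :: "('a \<Rightarrow> 'a) \<Rightarrow> ('a \<Rightarrow> 'a) \<Rightarrow> 'a \<Rightarrow> 'a" where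
  "twisted_coefficient e f = (\<lambda>x. pair_sum (T e) (\<lambda>u v. f (x * u) * v))"

lemma B_in: "e \<in> B \<Longrightarrow> e \<in> vcarrier D"
  using dual_basesD[OF Bd] by blast

lemma coefficient_in: "\<lbrakk>e \<in> B; f \<in> vcarrier D\<rbrakk> \<Longrightarrow> coefficient e f \<in> vcarrier D"
  unfolding coefficient_def by (rule coefficient_closed)

lemma twisted_coefficient_in: "\<lbrakk>e \<in> B; f \<in> vcarrier D\<rbrakk> \<Longrightarrow> twisted_coefficient e f \<in> vcarrier D"
  unfolding twisted_coefficient_def by (rule twisted_coefficient_closed)

lemma s_pair_sum: "s c (pair_sum ps F) = pair_sum ps (\<lambda>u v. s c (F u v))"
  by (rule pair_sum_hom) (simp_all add: scale_right_distrib)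

lemma coefficient_linear:
  "coefficient e (f + g) = coefficient e f + coefficient e g"
  "coefficient e (vscale D c f) = vscale D c (coefficient e f)"
  "twisted_coefficient e (f + g) = twisted_coefficient e f + twisted_coefficient e g"
  "twisted_coefficient e (vscale D c f) = vscale D c (twisted_coefficient e f)"
  by (simp_all add: coefficient_def twisted_coefficient_def fun_eq_iff D_scale pair_sum_add[symmetric]
      distrib_right s_pair_sum P.m_scale_left)

lemma coefficient_expansion:
  assumes f: "f \<in> vcarrier D"
  shows "(\<Sum>e\<in>B. coefficient e f x * e y) = f (x * y)"
proof -
  have "bilinear_map A A A (\<lambda>a b. f (x * b) * a)"
    by (rule bilinear_mapI) (simp_all add: f act_add act_scale distrib_left distrib_right
        P.m_scale_left P.m_scale_right)
  from R.gamma_expansion[OF gamma'_faithful Bd T' vspace_A this]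
  show ?thesis
    by (simp add: coefficient_def P.m_pair_sum P.m_assoc)
qed

lemma twisted_coefficient_expansion:
  assumes f: "f \<in> vcarrier D"
  shows "(\<Sum>e\<in>B. twisted_coefficient e f (x * e y)) = f x * y"
proof -
  have "bilinear_map A A A (\<lambda>a b. f (x * a) * b)"
    by (rule bilinear_mapI) (simp_all add: f act_add act_scale distrib_left distrib_right
        P.m_scale_left P.m_scale_right)
  from L.gamma_expansion[OF gamma_faithful Bd T vspace_A this]
  show ?thesis
    by (simp add: twisted_coefficient_def mult.assoc)
qed

definition counit :: "('a \<Rightarrow> 'a) \<Rightarrow> 'k" where
  "counit f = (SOME c. f 1 = s c 1)"

lemma counit: "f \<in> vcarrier D \<Longrightarrow> s (counit f) 1 = f 1"
  unfolding counit_def using someI_ex[OF value_at_one] by simp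

lemma counit_eqI: "f 1 = s c 1 \<Longrightarrow> counit f = c"
  unfolding counit_def by (rule some_equality) (auto dest: scale_right_imp_eq[rotated])

lemma counit_scale: "f \<in> vcarrier D \<Longrightarrow> s (counit f) a = f 1 * a" "f \<in> vcarrier D \<Longrightarrow> s (counit f) a = a * f 1"
  by (simp_all add: counit[symmetric] P.m_scale_left P.m_scale_right)

definition comult :: "('a \<Rightarrow> 'a) \<Rightarrow> ((('a \<Rightarrow> 'a) \<Rightarrow> ('a \<Rightarrow> 'a) \<Rightarrow> 'k) \<Rightarrow> 'k)" where
  "comult = (\<lambda>f\<in>vcarrier D. \<Sum>e\<in>B. tensor D D (coefficient e f) e)"

text \<open>For a Hopf algebra with module algebra \<open>A\<close> one has \<open>f(x) y = \<Sum> f'(x (S(f'') y))\<close>. Comparison with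
  \<open>f(x) y = \<Sum> b\<^sub>e(x e(y))\<close> suggests \<open>\<Sum> f' \<otimes> S(f'') = \<Sum> b\<^sub>e \<otimes> e\<close>, and the counit on the first factor gives the
  formula.\<close>

definition antipode :: "('a \<Rightarrow> 'a) \<Rightarrow> 'a \<Rightarrow> 'a" where
  "antipode f = (\<Sum>e\<in>B. vscale D (counit (twisted_coefficient e f)) e)"

lemma comult_linear: "linear_map D (tensor_space D D) comult"
  unfolding linear_map_def
proof (intro conjI ballI allI Pi_I)
  fix f assume f: "f \<in> vcarrier D"
  show "comult f \<in> vcarrier (tensor_space D D)"
    unfolding comult_def using f coefficient_in B_in
    by (auto intro!: vspace.carrier_sum[OF vspace_tensor_space] tensor_carrier)
  show "comult (f + g) = comult f + comult g" if g: "g \<in> vcarrier D" for g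
    using f g coefficient_in B_in
    by (simp add: comult_def carrier_add coefficient_linear sum.distrib[symmetric]
        bilinear_map_add_left[OF tensor_bilinear])
  interpret TT: vector_space "vscale (tensor_space D D)"
    using vspace_tensor_space[of D D] by (simp add: vspace_def)
  show "comult (vscale D c f) = vscale (tensor_space D D) c (comult f)" for c
    using f coefficient_in B_in
    by (simp add: comult_def carrier_scale coefficient_linear TT.scale_sum_right
        bilinear_map_scale_left[OF tensor_bilinear])
qed

lemma tensor_lift_comult:
  assumes U: "vspace U" and F: "bilinear_map D D U F" and f: "f \<in> vcarrier D"
  shows "tensor_lift D D F (comult f) = (\<Sum>e\<in>B. F (coefficient e f) e)"
proof -
  have "tensor_lift D D F (comult f) = (\<Sum>e\<in>B. tensor_lift D D F (tensor D D (coefficient e f) e))"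
    unfolding comult_def using f coefficient_in B_in
    by (auto intro!: linear_map_sum[OF vspace_tensor_space tensor_lift_linear[OF vspace_H U F]] tensor_carrier)
  also have "\<dots> = (\<Sum>e\<in>B. F (coefficient e f) e)"
    using f coefficient_in B_in by (intro sum.cong refl tensor_lift_tensor[OF U F]) auto
  finally show ?thesis .
qed

lemma evaluation_bilinear:
  assumes G: "linear_map W A g"
  shows "bilinear_map D W A (\<lambda>p w. p x * g w)"
  using linear_map_add[OF G] linear_map_scale[OF G]
  by (intro bilinear_mapI) (simp_all add: D_scale distrib_right distrib_left P.m_scale_left P.m_scale_right)

text \<open>Fix \<open>j\<close> and let \<open>x\<close> vary: \<open>\<Sum> p(x) G\<^sub>j(w) = 0\<close> says that \<open>\<Sum> G\<^sub>j(w) \<otimes> p\<close> is in the kernel of the injective map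
  \<open>\<pi>'\<close>. So every functional \<open>\<alpha>\<close> on \<open>D\<close> gives \<open>\<Sum> \<alpha>(p) G\<^sub>j(w) = 0\<close>; that is, all \<open>G\<^sub>j\<close> vanish on the slice \<open>\<Sum> \<alpha>(p) w\<close>,
  which is therefore zero. With \<open>W = D\<close> and then \<open>W = D \<otimes> D\<close> it follows that tensors of two or three operators are determined by the
  multilinear maps that they induce on \<open>A\<close>.\<close>

lemma evaluation_faithful:
  assumes W: "vspace W" and G: "\<And>j. linear_map W A (G j)"
    and inj: "\<And>w. \<lbrakk>w \<in> vcarrier W; \<And>j. G j w = 0\<rbrakk> \<Longrightarrow> w = 0"
  shows "faithful_family D W UNIV (\<lambda>(x, j) p w. p x * G j w)"
proof -
  interpret W: vspace W by fact
  show "faithful_family D W UNIV (\<lambda>(x, j) p w. p x * G j w)"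
  proof (rule faithful_familyI[OF vspace_H vspace_A])
    fix i show "bilinear_map D W A (case i of (x, j) \<Rightarrow> \<lambda>p w. p x * G j w)"
      using evaluation_bilinear[OF G] by (cases i) simp
  next
    fix ps assume ps: "set ps \<subseteq> vcarrier D \<times> vcarrier W"
      and zero: "\<And>i. i \<in> UNIV \<Longrightarrow> pair_sum ps (case i of (x, j) \<Rightarrow> \<lambda>p w. p x * G j w) = 0"
    show "pair_sum ps (tensor D W) = 0"
    proof (rule tensor_zero_if_slices_left[OF vspace_H W ps])
      fix \<alpha> assume "Vector_Spaces.linear (vscale D) (*) \<alpha>"
      then interpret \<alpha>: Vector_Spaces.linear "vscale D" "(*)" \<alpha> .
      have bil\<alpha>: "bilinear_map A D A (\<lambda>a p. s (\<alpha> p) a)"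
        by (rule bilinear_mapI)
           (simp_all add: \<alpha>.add \<alpha>.scale scale_left_distrib scale_right_distrib mult.commute)
      show "pair_sum ps (\<lambda>v w. vscale W (\<alpha> v) w) = 0"
      proof (rule inj)
        show "pair_sum ps (\<lambda>v w. vscale W (\<alpha> v) w) \<in> vcarrier W"
          using ps by (intro W.carrier_pair_sum W.carrier_scale) auto
        fix j
        have "G j (pair_sum ps (\<lambda>v w. vscale W (\<alpha> v) w)) = pair_sum ps (\<lambda>v w. G j (vscale W (\<alpha> v) w))"
          using ps by (intro linear_map_pair_sum[OF W G] W.carrier_scale) auto
        also have "\<dots> = pair_sum ps (\<lambda>v w. s (\<alpha> v) (G j w))"
          using ps linear_map_scale[OF G] by (intro pair_sum_cong) auto
        also have "\<dots> = pair_sum (map (\<lambda>(v, w). (G j w, v)) ps) (\<lambda>a p. s (\<alpha> p) a)"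
          by (simp add: pair_sum_map)
        also have "\<dots> = pair_sum [] (\<lambda>a p. s (\<alpha> p) a)"
        proof (rule R.pi_unique[OF pi'_faithful vspace_A bil\<alpha>])
          show "set (map (\<lambda>(v, w). (G j w, v)) ps) \<subseteq> UNIV \<times> vcarrier D" using ps by auto
          show "pair_sum (map (\<lambda>(v, w). (G j w, v)) ps) (\<lambda>a f. f b * a) = pair_sum [] (\<lambda>a f. f b * a)" for b
            using zero[of "(b, j)"] by (simp add: pair_sum_map)
        qed simp
        finally show "G j (pair_sum ps (\<lambda>v w. vscale W (\<alpha> v) w)) = 0" by simp
      qed
    qed
  qed
qed

lemma evaluation2_bilinear: "bilinear_map D D A (\<lambda>p q. p x * q y)"
  by (rule bilinear_mapI) (simp_all add: D_scale distrib_right distrib_left P.m_scale_left P.m_scale_right)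

lemma tensor2_eqI:
  assumes "t \<in> vcarrier (tensor_space D D)" "u \<in> vcarrier (tensor_space D D)"
    and "\<And>x y. tensor_lift D D (\<lambda>p q. p x * q y) t = tensor_lift D D (\<lambda>p q. p x * q y) u"
  shows "t = u"
proof (rule faithful_tensor_eqI[OF _ vspace_H vspace_A _ assms(1,2)])
  show "faithful_family D D UNIV (\<lambda>(x, y) p q. p x * q y)"
    by (rule evaluation_faithful[OF vspace_H act_linear_left]) (simp add: fun_eq_iff)
qed (auto simp: evaluation2_bilinear assms(3))

lemma evaluation2_linear: "linear_map (tensor_space D D) A (tensor_lift D D (\<lambda>p q. p x * q y))"
  by (rule tensor_lift_linear[OF vspace_H vspace_A evaluation2_bilinear])

lemma tensor3_eqI:
  assumes "t \<in> vcarrier (tensor_space D (tensor_space D D))" "u \<in> vcarrier (tensor_space D (tensor_space D D))"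
    and eq: "\<And>x y z. tensor_lift D (tensor_space D D) (\<lambda>p w. p x * tensor_lift D D (\<lambda>q r. q y * r z) w) t =
      tensor_lift D (tensor_space D D) (\<lambda>p w. p x * tensor_lift D D (\<lambda>q r. q y * r z) w) u"
  shows "t = u"
proof -
  define G where "G = (\<lambda>(y, z). tensor_lift D D (\<lambda>q r. (q y :: 'a) * r z))"
  have G: "linear_map (tensor_space D D) A (G j)" for j
    using evaluation2_linear by (cases j) (simp add: G_def)
  have inj: "w = 0" if "w \<in> vcarrier (tensor_space D D)" "\<And>j. G j w = 0" for w
  proof (rule tensor2_eqI[OF that(1)])
    show "0 \<in> vcarrier (tensor_space D D)" by (rule vspace.carrier_zero[OF vspace_tensor_space])
    show "tensor_lift D D (\<lambda>p q. p x * q y) w = tensor_lift D D (\<lambda>p q. p x * q y) 0" for x y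
      using that(2)[of "(x, y)"] linear_map_zero[OF vspace_tensor_space evaluation2_linear, of x y]
      by (simp add: G_def)
  qed
  note ev = evaluation_faithful[OF vspace_tensor_space G inj]
  show ?thesis
  proof (rule faithful_tensor_eqI[OF ev vspace_H vspace_A _ assms(1,2)])
    show "bilinear_map D (tensor_space D D) A (case i of (x, j) \<Rightarrow> \<lambda>p w. p x * G j w)" for i
      using evaluation_bilinear[OF G] by (cases i) simp
    show "tensor_lift D (tensor_space D D) (case i of (x, j) \<Rightarrow> \<lambda>p w. p x * G j w) t =
        tensor_lift D (tensor_space D D) (case i of (x, j) \<Rightarrow> \<lambda>p w. p x * G j w) u" for i
      using eq by (cases i) (simp add: G_def split: prod.splits)
  qed
qed

lemma evaluation_comult:
  "f \<in> vcarrier D \<Longrightarrow> tensor_lift D D (\<lambda>p q. p x * q y) (comult f) = f (x * y)"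
  by (simp add: tensor_lift_comult[OF vspace_A evaluation2_bilinear] coefficient_expansion)

lemma comult_in: "f \<in> vcarrier D \<Longrightarrow> comult f \<in> vcarrier (tensor_space D D)"
  by (rule linear_map_carrier[OF comult_linear])

text \<open>Both sides induce the trilinear map \<open>(x, y, z) \<mapsto> f(x y z)\<close>, so that this is associativity of \<open>A\<close>.\<close>

lemma coassociative:
  assumes f: "f \<in> vcarrier D"
  shows "tensor_assoc D D D (tensor_map D D (tensor_space D D) D comult (\<lambda>x. x) (comult f)) =
      tensor_map D D D (tensor_space D D) (\<lambda>x. x) comult (comult f)" (is "?l = ?r")
proof (rule tensor3_eqI)
  show "?l \<in> vcarrier (tensor_space D (tensor_space D D))"
    using linear_map_carrier[OF linear_map_compose[OF tensor_map_linear[OF vspace_H comult_linear linear_map_ident]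
          tensor_assoc_linear[OF vspace_H vspace_H vspace_H]] comult_in[OF f]] .
  show "?r \<in> vcarrier (tensor_space D (tensor_space D D))"
    by (rule linear_map_carrier[OF tensor_map_linear[OF vspace_H linear_map_ident comult_linear] comult_in[OF f]])
  fix x y z :: 'a
  let ?F = "\<lambda>p q r. p x * (q y * r z)"
  let ?ev = "tensor_lift D (tensor_space D D) (\<lambda>p w. p x * tensor_lift D D (\<lambda>q r. q y * r z) w)"
  let ?ev' = "tensor_lift D (tensor_space D D) (\<lambda>p w. tensor_lift D D (?F p) w)"
  have lin: "linear_map A A (\<lambda>c. a * c)" for a
    by (simp add: linear_map_def distrib_left P.m_scale_right)
  have bil: "bilinear_map D D A (?F p)" for p
    by (rule bilinear_map_linear[OF evaluation2_bilinear lin])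
  have tri: "trilinear_map D D D A ?F"
    using bil by (simp add: trilinear_map_def linear_map_def D_scale distrib_right P.m_scale_left)
  \<comment> \<open>The constant factor moves into the inner lift, which gives the form used for Sweedler sums.\<close>
  have ev: "?ev t = ?ev' t" if t: "t \<in> vcarrier (tensor_space D (tensor_space D D))" for t
  proof (rule tensor_lift_eqI[OF vspace_H vspace_A _ _ _ t])
    have b: "bilinear_map D (tensor_space D D) A (\<lambda>p w. p x * tensor_lift D D (\<lambda>q r. q y * r z) w)"
      by (rule evaluation_bilinear[OF evaluation2_linear])
    then show "linear_map (tensor_space D (tensor_space D D)) A ?ev"
      by (rule tensor_lift_linear[OF vspace_H vspace_A])
    have b': "bilinear_map D (tensor_space D D) A (\<lambda>p w. tensor_lift D D (?F p) w)"
      by (rule bilinear_tensor_lift[OF vspace_H vspace_H vspace_A tri])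
    then show "linear_map (tensor_space D (tensor_space D D)) A ?ev'"
      by (rule tensor_lift_linear[OF vspace_H vspace_A])
    fix p w assume pw: "p \<in> vcarrier D" "w \<in> vcarrier (tensor_space D D)"
    have "p x * tensor_lift D D (\<lambda>q r. q y * r z) w = tensor_lift D D (?F p) w"
    proof (rule tensor_lift_eqI[OF vspace_H vspace_A _ _ _ pw(2)])
      show "linear_map (tensor_space D D) A (\<lambda>w. p x * tensor_lift D D (\<lambda>q r. q y * r z) w)"
        by (rule linear_map_compose[OF evaluation2_linear lin])
      show "linear_map (tensor_space D D) A (tensor_lift D D (?F p))"
        by (rule tensor_lift_linear[OF vspace_H vspace_A bil])
      fix q r assume qr: "q \<in> vcarrier D" "r \<in> vcarrier D"
      show "p x * tensor_lift D D (\<lambda>q r. q y * r z) (tensor D D q r) = tensor_lift D D (?F p) (tensor D D q r)"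
        unfolding tensor_lift_tensor[OF vspace_A evaluation2_bilinear qr] tensor_lift_tensor[OF vspace_A bil qr] ..
    qed
    then show "?ev (tensor D (tensor_space D D) p w) = ?ev' (tensor D (tensor_space D D) p w)"
      unfolding tensor_lift_tensor[OF vspace_A b pw] tensor_lift_tensor[OF vspace_A b' pw] .
  qed
  have "?ev' ?l = tensor_lift D D (\<lambda>p q. tensor_lift D D (\<lambda>u v. ?F u v q) (comult p)) (comult f)"
    by (rule tensor_lift_comult_left[OF vspace_H vspace_A comult_linear tri comult_in[OF f]])
  also have "\<dots> = (\<Sum>e\<in>B. tensor_lift D D (\<lambda>u v. ?F u v e) (comult (coefficient e f)))"
    by (rule tensor_lift_comult[OF vspace_A _ f],
        rule bilinear_map_compose[OF bilinear_map_swap[OF bilinear_tensor_lift[OF vspace_H vspace_H vspace_A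
          trilinear_map_rotate[OF tri]]] comult_linear linear_map_ident])
  also have "\<dots> = (\<Sum>e\<in>B. \<Sum>e'\<in>B. ?F (coefficient e' (coefficient e f)) e' e)"
    using trilinear_map_rotate[OF tri] f coefficient_in B_in
    by (intro sum.cong refl tensor_lift_comult[OF vspace_A]) (auto simp: trilinear_map_def)
  also have "\<dots> = f (x * y * z)"
    using f coefficient_in
    by (simp add: mult.assoc[symmetric] sum_distrib_right[symmetric] coefficient_expansion)
  finally have l: "?ev' ?l = f (x * y * z)" .
  have "?ev' ?r = tensor_lift D D (\<lambda>p q. tensor_lift D D (?F p) (comult q)) (comult f)"
    by (rule tensor_lift_comult_right[OF vspace_H vspace_A comult_linear tri comult_in[OF f]])
  also have "\<dots> = (\<Sum>e\<in>B. tensor_lift D D (?F (coefficient e f)) (comult e))"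
    by (rule tensor_lift_comult[OF vspace_A _ f],
        rule bilinear_map_compose[OF bilinear_tensor_lift[OF vspace_H vspace_H vspace_A tri]
          linear_map_ident comult_linear])
  also have "\<dots> = (\<Sum>e\<in>B. \<Sum>e'\<in>B. ?F (coefficient e f) (coefficient e' e) e')"
    using bil B_in by (intro sum.cong refl tensor_lift_comult[OF vspace_A]) auto
  also have "\<dots> = f (x * (y * z))"
    using f B_in by (simp add: sum_distrib_left[symmetric] coefficient_expansion)
  finally have r: "?ev' ?r = f (x * (y * z))" .
  show "?ev ?l = ?ev ?r"
    using l r \<open>?l \<in> vcarrier (tensor_space D (tensor_space D D))\<close>
      \<open>?r \<in> vcarrier (tensor_space D (tensor_space D D))\<close>
    by (simp add: ev mult.assoc)
qed

end

context galois_operators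
begin

lemma comp_in: "\<lbrakk>f \<in> vcarrier D; g \<in> vcarrier D\<rbrakk> \<Longrightarrow> f \<circ> g \<in> vcarrier D"
  using bilinear_map_carrier[OF mult_bilinear] by (simp add: D_mult)

lemma comp_bilinear: "bilinear_map D D D (\<circ>)"
proof -
  have "amult D = (\<circ>)" by (intro ext) (simp add: D_mult)
  then show ?thesis using mult_bilinear by simp
qed

lemma id_in: "id \<in> vcarrier D"
  using one_carrier by (simp add: D_one)

text \<open>Both sides induce the bilinear map \<open>(x, y) \<mapsto> g(f(x y))\<close>.\<close>

lemma comult_multiplicative:
  assumes g: "g \<in> vcarrier D" and f: "f \<in> vcarrier D"
  shows "comult (g \<circ> f) = tensor_mult D (comult g) (comult f)"
proof -
  let ?M = "\<lambda>a b. tensor_lift D D (\<lambda>p q. tensor D D (a \<circ> p) (b \<circ> q))"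
  have lin_left: "linear_map D D (\<lambda>p. a \<circ> p)" if "a \<in> vcarrier D" for a
    using comp_bilinear that by (simp add: bilinear_map_def)
  have lin_right: "linear_map D D (\<lambda>a. a \<circ> p)" if "p \<in> vcarrier D" for p
    using comp_bilinear that by (simp add: bilinear_map_def)
  have bil: "bilinear_map D D (tensor_space D D) (\<lambda>p q. tensor D D (a \<circ> p) (b \<circ> q))"
    if "a \<in> vcarrier D" "b \<in> vcarrier D" for a b
    by (rule bilinear_map_compose[OF tensor_bilinear lin_left[OF that(1)] lin_left[OF that(2)]])
  have bil': "bilinear_map D D (tensor_space D D) (\<lambda>a b. tensor D D (a \<circ> p) (b \<circ> q))"
    if "p \<in> vcarrier D" "q \<in> vcarrier D" for p q
    by (rule bilinear_map_compose[OF tensor_bilinear lin_right[OF that(1)] lin_right[OF that(2)]])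
  have val: "?M a b (comult f) = (\<Sum>e\<in>B. tensor D D (a \<circ> coefficient e f) (b \<circ> e))"
    if "a \<in> vcarrier D" "b \<in> vcarrier D" for a b
    by (rule tensor_lift_comult[OF vspace_tensor_space bil[OF that] f])
  have "bilinear_map D D (tensor_space D D)
      (\<lambda>a b. \<Sum>e\<in>B. tensor D D (a \<circ> coefficient e f) (b \<circ> e))"
  proof (rule bilinear_mapI)
    fix a b assume ab: "a \<in> vcarrier D" "b \<in> vcarrier D"
    have mem: "a \<circ> coefficient e f \<in> vcarrier D" "b \<circ> e \<in> vcarrier D" if "e \<in> B" for e
      using ab f B_in coefficient_in that by (auto intro: comp_in)
    note bil'' = bil'[OF coefficient_in[OF _ f] B_in]
    show "(\<Sum>e\<in>B. tensor D D (a \<circ> coefficient e f) (b \<circ> e)) \<in> vcarrier (tensor_space D D)"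
      using mem by (intro vspace.carrier_sum[OF vspace_tensor_space] tensor_carrier)
    show "(\<Sum>e\<in>B. tensor D D ((a + a') \<circ> coefficient e f) (b \<circ> e)) =
        (\<Sum>e\<in>B. tensor D D (a \<circ> coefficient e f) (b \<circ> e)) + (\<Sum>e\<in>B. tensor D D (a' \<circ> coefficient e f) (b \<circ> e))"
      if "a' \<in> vcarrier D" for a'
      unfolding sum.distrib[symmetric]
      by (rule sum.cong[OF refl]) (rule bilinear_map_add_left[OF bil'' ab that])
    show "(\<Sum>e\<in>B. tensor D D (a \<circ> coefficient e f) ((b + b') \<circ> e)) =
        (\<Sum>e\<in>B. tensor D D (a \<circ> coefficient e f) (b \<circ> e)) + (\<Sum>e\<in>B. tensor D D (a \<circ> coefficient e f) (b' \<circ> e))"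
      if "b' \<in> vcarrier D" for b'
      unfolding sum.distrib[symmetric]
      by (rule sum.cong[OF refl]) (rule bilinear_map_add_right[OF bil'' ab that])
    interpret TT: vector_space "vscale (tensor_space D D)"
      using vspace_tensor_space[of D D] by (simp add: vspace_def)
    fix c
    show "(\<Sum>e\<in>B. tensor D D (vscale D c a \<circ> coefficient e f) (b \<circ> e)) =
        vscale (tensor_space D D) c (\<Sum>e\<in>B. tensor D D (a \<circ> coefficient e f) (b \<circ> e))"
      unfolding TT.scale_sum_right
      by (rule sum.cong[OF refl]) (rule bilinear_map_scale_left[OF bil'' ab])
    show "(\<Sum>e\<in>B. tensor D D (a \<circ> coefficient e f) (vscale D c b \<circ> e)) =
        vscale (tensor_space D D) c (\<Sum>e\<in>B. tensor D D (a \<circ> coefficient e f) (b \<circ> e))"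
      unfolding TT.scale_sum_right
      by (rule sum.cong[OF refl]) (rule bilinear_map_scale_right[OF bil'' ab])
  qed
  then have M: "bilinear_map D D (tensor_space D D) (\<lambda>a b. ?M a b (comult f))"
    by (simp add: bilinear_map_def linear_map_def val carrier_add carrier_scale Pi_iff)
  have "tensor_mult D (comult g) (comult f) = (\<Sum>e\<in>B. ?M (coefficient e g) e (comult f))"
    unfolding tensor_mult_def D_mult by (rule tensor_lift_comult[OF vspace_tensor_space M g])
  also have "\<dots> = (\<Sum>e\<in>B. \<Sum>e'\<in>B. tensor D D (coefficient e g \<circ> coefficient e' f) (e \<circ> e'))"
    using g coefficient_in B_in val by (intro sum.cong refl) auto
  finally have mult: "tensor_mult D (comult g) (comult f) =
      (\<Sum>e\<in>B. \<Sum>e'\<in>B. tensor D D (coefficient e g \<circ> coefficient e' f) (e \<circ> e'))" .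
  have mem: "coefficient e g \<circ> coefficient e' f \<in> vcarrier D" "e \<circ> e' \<in> vcarrier D"
    if "e \<in> B" "e' \<in> B" for e e'
    using that g f coefficient_in B_in by (auto intro: comp_in)
  have tc: "tensor D D (coefficient e g \<circ> coefficient e' f) (e \<circ> e') \<in> vcarrier (tensor_space D D)"
    if "e \<in> B" "e' \<in> B" for e e'
    using mem that by (intro tensor_carrier)
  have mult_in: "tensor_mult D (comult g) (comult f) \<in> vcarrier (tensor_space D D)"
    unfolding mult using tc by (intro vspace.carrier_sum[OF vspace_tensor_space])
  show ?thesis
  proof (rule tensor2_eqI[OF comult_in[OF comp_in[OF g f]] mult_in])
    fix x y
    have "tensor_lift D D (\<lambda>p q. p x * q y) (tensor_mult D (comult g) (comult f)) =
        (\<Sum>e\<in>B. \<Sum>e'\<in>B. tensor_lift D D (\<lambda>p q. p x * q y)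
           (tensor D D (coefficient e g \<circ> coefficient e' f) (e \<circ> e')))"
      unfolding mult using tc
      by (simp add: linear_map_sum[OF vspace_tensor_space evaluation2_linear]
          vspace.carrier_sum[OF vspace_tensor_space])
    also have "\<dots> = (\<Sum>e\<in>B. \<Sum>e'\<in>B. coefficient e g (coefficient e' f x) * e (e' y))"
      using mem by (simp add: tensor_lift_tensor[OF vspace_A evaluation2_bilinear])
    also have "\<dots> = (\<Sum>e'\<in>B. g (coefficient e' f x * e' y))"
      by (subst sum.swap) (simp add: coefficient_expansion[OF g])
    also have "\<dots> = g (f (x * y))"
      by (simp add: act_sum[OF g, symmetric] coefficient_expansion[OF f])
    finally show "tensor_lift D D (\<lambda>p q. p x * q y) (comult (g \<circ> f)) =
        tensor_lift D D (\<lambda>p q. p x * q y) (tensor_mult D (comult g) (comult f))"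
      using evaluation_comult[OF comp_in[OF g f]] by simp
  qed
qed

lemma comult_id: "comult id = tensor D D id id"
  by (rule tensor2_eqI[OF comult_in[OF id_in] tensor_carrier[OF id_in id_in]])
     (simp add: evaluation_comult[OF id_in] tensor_lift_tensor[OF vspace_A evaluation2_bilinear id_in id_in])

lemma counit_linear: "linear_map D ground counit"
  unfolding linear_map_def
proof (intro conjI ballI allI Pi_I)
  fix f assume f: "f \<in> vcarrier D"
  show "counit f \<in> vcarrier ground" by (simp add: ground_def)
  show "counit (f + g) = counit f + counit g" if g: "g \<in> vcarrier D" for g
    by (rule counit_eqI) (simp add: scale_left_distrib counit f g)
  show "counit (vscale D c f) = vscale ground c (counit f)" for c
    by (rule counit_eqI) (simp add: D_scale ground_def scale_scale[symmetric] counit f del: scale_scale)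
qed

lemma antipode_apply: "f \<in> vcarrier D \<Longrightarrow> antipode f x = (\<Sum>e\<in>B. twisted_coefficient e f 1 * e x)"
  unfolding antipode_def sum_fun_apply D_scale
  by (intro sum.cong refl) (simp add: counit_scale twisted_coefficient_in)

lemma antipode_linear: "linear_map D D antipode"
  unfolding linear_map_def
proof (intro conjI ballI allI Pi_I)
  fix f assume f: "f \<in> vcarrier D"
  show "antipode f \<in> vcarrier D"
    unfolding antipode_def using B_in by (intro carrier_sum carrier_scale)
  show "antipode (f + g) = antipode f + antipode g" if g: "g \<in> vcarrier D" for g
    using f g by (simp add: fun_eq_iff antipode_apply carrier_add coefficient_linear distrib_right sum.distrib)
  show "antipode (vscale D c f) = vscale D c (antipode f)" for c
    using f by (simp add: fun_eq_iff antipode_apply carrier_scale coefficient_linear)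
       (simp add: D_scale antipode_apply scale_sum_right P.m_scale_left)
qed

lemma comult_twisted_coefficient:
  assumes f: "f \<in> vcarrier D"
  shows "(\<Sum>e\<in>B. coefficient e f x * twisted_coefficient j e z) = twisted_coefficient j f (x * z)"
proof -
  have "(\<Sum>e\<in>B. coefficient e f x * twisted_coefficient j e z) =
      pair_sum (T j) (\<lambda>u v. (\<Sum>e\<in>B. coefficient e f x * e (z * u)) * v)"
    by (simp add: twisted_coefficient_def P.m_pair_sum pair_sum_sum sum_distrib_right mult.assoc)
  then show ?thesis
    by (simp only: coefficient_expansion[OF f] twisted_coefficient_def mult.assoc)
qed

text \<open>Since \<open>b\<^sub>j(1)\<close> is a scalar, \<open>f'(S(f'') y)\<close> is the sum over \<open>j\<close> of \<open>f'(j(y)) b\<^sub>j(1)\<close>, where \<open>b\<^sub>j\<close> belongs to \<open>f''\<close>. By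
  \<open>comult_twisted_coefficient\<close> this is \<open>\<Sum> b\<^sub>j(j(y))\<close> with \<open>b\<^sub>j\<close> belonging to \<open>f\<close>, which is \<open>f(1) y\<close>.\<close>

lemma antipode_right_apply:
  assumes f: "f \<in> vcarrier D"
  shows "(\<Sum>e\<in>B. coefficient e f (antipode e y)) = f 1 * y"
proof -
  have "coefficient e f (antipode e y) = (\<Sum>j\<in>B. coefficient e f (j y) * twisted_coefficient j e 1)"
    if e: "e \<in> B" for e
  proof -
    have "coefficient e f (twisted_coefficient j e 1 * j y) = coefficient e f (j y) * twisted_coefficient j e 1"
      if j: "j \<in> B" for j
      using counit_scale[OF twisted_coefficient_in[OF j B_in[OF e]]]
        act_scale[OF coefficient_in[OF e f]] by metis
    then show ?thesis
      by (simp add: antipode_apply B_in e act_sum[OF coefficient_in[OF e f]])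
  qed
  then have "(\<Sum>e\<in>B. coefficient e f (antipode e y)) =
      (\<Sum>j\<in>B. \<Sum>e\<in>B. coefficient e f (j y) * twisted_coefficient j e 1)"
    by (subst sum.swap) simp
  also have "\<dots> = (\<Sum>j\<in>B. twisted_coefficient j f (1 * j y))"
    by (simp add: comult_twisted_coefficient[OF f])
  also have "\<dots> = f 1 * y"
    by (rule twisted_coefficient_expansion[OF f])
  finally show ?thesis .
qed

text \<open>Here \<open>S(f') f''\<close> is \<open>\<Sum> b\<^sub>j(1) j f''\<close> with \<open>b\<^sub>j\<close> belonging to \<open>f'\<close>. In the basis of \<open>D\<close> its coefficient at \<open>l\<close> is
  \<open>\<Sum> d\<^sub>l(j f'') b\<^sub>j(1)\<close>. Rewriting \<open>d\<^sub>l(j f'')\<close> by means of \<open>T l\<close> brings \<open>j\<close> into the argument of \<open>b\<^sub>j\<close>, and the two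
  expansions reduce the sum to \<open>\<Sum> f(u v)\<close> over \<open>T l\<close>, which is \<open>f(d\<^sub>l(id) 1)\<close>.\<close>

lemma antipode_left_apply:
  assumes f: "f \<in> vcarrier D"
  shows "(\<Sum>e\<in>B. antipode (coefficient e f) (e y)) = f 1 * y"
proof -
  have expand: "g y = (\<Sum>l\<in>B. s (d l g) (l y))" if "g \<in> vcarrier D" for g
  proof -
    have "g y = (\<Sum>l\<in>B. vscale D (d l g) l) y"
      using dual_bases_expand[OF Bd that] by (rule arg_cong)
    then show ?thesis by (simp add: sum_fun_apply D_scale)
  qed
  have coeff: "(\<Sum>e\<in>B. \<Sum>j\<in>B. s (d l (j \<circ> e)) (twisted_coefficient j (coefficient e f) 1)) = s (d l id) (f 1)"
    if l: "l \<in> B" for l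
  proof -
    have "s (d l (j \<circ> e)) (twisted_coefficient j (coefficient e f) 1) =
        pair_sum (T l) (\<lambda>u v. twisted_coefficient j (coefficient e f) (u * j (e v)))"
      if e: "e \<in> B" and j: "j \<in> B" for e j
    proof -
      have t: "twisted_coefficient j (coefficient e f) \<in> vcarrier D"
        using e j f by (intro twisted_coefficient_in coefficient_in)
      have "s (d l (j \<circ> e)) (twisted_coefficient j (coefficient e f) 1) =
          twisted_coefficient j (coefficient e f) (pair_sum (T l) (\<lambda>u v. u * j (e v)))"
        using T[OF l comp_in[OF B_in[OF j] B_in[OF e]]] by (simp add: act_scale[OF t])
      then show ?thesis by (simp add: act_pair_sum[OF t])
    qed
    then have "(\<Sum>e\<in>B. \<Sum>j\<in>B. s (d l (j \<circ> e)) (twisted_coefficient j (coefficient e f) 1)) =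
        pair_sum (T l) (\<lambda>u v. \<Sum>e\<in>B. \<Sum>j\<in>B. twisted_coefficient j (coefficient e f) (u * j (e v)))"
      by (simp add: pair_sum_sum)
    also have "\<dots> = pair_sum (T l) (\<lambda>u v. f (u * v))"
      by (simp add: twisted_coefficient_expansion coefficient_in f coefficient_expansion)
    also have "\<dots> = f (pair_sum (T l) (\<lambda>u v. u * id v))"
      by (simp add: act_pair_sum[OF f])
    finally show ?thesis by (simp only: T[OF l id_in] act_scale[OF f])
  qed
  have "(\<Sum>e\<in>B. antipode (coefficient e f) (e y)) =
      (\<Sum>e\<in>B. \<Sum>j\<in>B. twisted_coefficient j (coefficient e f) 1 * j (e y))"
    by (simp add: antipode_apply coefficient_in f)
  also have "\<dots> = (\<Sum>e\<in>B. \<Sum>j\<in>B. \<Sum>l\<in>B. s (d l (j \<circ> e)) (twisted_coefficient j (coefficient e f) 1) * l y)"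
  proof (intro sum.cong refl)
    fix e j assume e: "e \<in> B" and j: "j \<in> B"
    have "(j \<circ> e) y = (\<Sum>l\<in>B. s (d l (j \<circ> e)) (l y))"
      by (rule expand[OF comp_in[OF B_in[OF j] B_in[OF e]]])
    then show "twisted_coefficient j (coefficient e f) 1 * j (e y) =
        (\<Sum>l\<in>B. s (d l (j \<circ> e)) (twisted_coefficient j (coefficient e f) 1) * l y)"
      by (simp add: sum_distrib_left P.m_scale_left P.m_scale_right)
  qed
  also have "\<dots> = (\<Sum>e\<in>B. \<Sum>l\<in>B. \<Sum>j\<in>B. s (d l (j \<circ> e)) (twisted_coefficient j (coefficient e f) 1) * l y)"
    by (intro sum.cong refl sum.swap)
  also have "\<dots> = (\<Sum>l\<in>B. \<Sum>e\<in>B. \<Sum>j\<in>B. s (d l (j \<circ> e)) (twisted_coefficient j (coefficient e f) 1) * l y)"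
    by (rule sum.swap)
  also have "\<dots> = (\<Sum>l\<in>B. s (d l id) (f 1) * l y)"
    by (simp only: sum_distrib_right[symmetric] coeff cong: sum.cong)
  also have "\<dots> = f 1 * id y"
    unfolding expand[OF id_in] by (simp add: sum_distrib_left P.m_scale_left P.m_scale_right)
  finally show ?thesis by simp
qed

theorem operators_hopf: "hopf_algebra D comult counit antipode"
proof unfold_locales
  show "linear_map D (tensor_space D D) comult" by (rule comult_linear)
  show "linear_map D ground counit" by (rule counit_linear)
  show "linear_map D D antipode" by (rule antipode_linear)
next
  fix f assume f: "f \<in> vcarrier D"
  show "tensor_assoc D D D (tensor_map D D (tensor_space D D) D comult (\<lambda>x. x) (comult f)) =
      tensor_map D D D (tensor_space D D) (\<lambda>x. x) comult (comult f)"
    by (rule coassociative[OF f])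
  have scale: "bilinear_map D D D (\<lambda>x y. vscale D (counit x) y)"
    using linear_map_add[OF counit_linear] linear_map_scale[OF counit_linear] carrier_scale
    by (intro bilinear_mapI) (auto simp: D_scale ground_def scale_left_distrib scale_right_distrib
        fun_eq_iff mult.commute)
  show "tensor_lift D D (\<lambda>x y. vscale D (counit x) y) (comult f) = f"
    unfolding tensor_lift_comult[OF vspace_H scale f]
    using f coefficient_in coefficient_expansion[OF f, of 1]
    by (simp add: fun_eq_iff sum_fun_apply D_scale counit_scale(1))
  show "tensor_lift D D (\<lambda>x y. vscale D (counit y) x) (comult f) = f"
    unfolding tensor_lift_comult[OF vspace_H bilinear_map_swap[OF scale] f]
    using B_in coefficient_expansion[OF f, of _ 1]
    by (simp add: fun_eq_iff sum_fun_apply D_scale counit_scale(2))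
  show "tensor_lift D D (\<lambda>x y. amult D (antipode x) y) (comult f) = vscale D (counit f) (aone D)"
    unfolding D_mult tensor_lift_comult[OF vspace_H bilinear_map_compose[OF comp_bilinear antipode_linear linear_map_ident] f]
    by (simp add: fun_eq_iff sum_fun_apply D_scale D_one antipode_left_apply[OF f] counit_scale(1)[OF f])
  show "tensor_lift D D (\<lambda>x y. amult D x (antipode y)) (comult f) = vscale D (counit f) (aone D)"
    unfolding D_mult tensor_lift_comult[OF vspace_H bilinear_map_compose[OF comp_bilinear linear_map_ident antipode_linear] f]
    by (simp add: fun_eq_iff sum_fun_apply D_scale D_one antipode_right_apply[OF f] counit_scale(1)[OF f])
  fix g assume g: "g \<in> vcarrier D"
  show "comult (amult D f g) = tensor_mult D (comult f) (comult g)"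
    unfolding D_mult by (rule comult_multiplicative[OF f g])
  show "counit (amult D f g) = counit f * counit g"
    unfolding D_mult
    by (rule counit_eqI) (simp add: counit[OF g, symmetric] act_scale[OF f] counit[OF f, symmetric] mult.commute)
next
  show "comult (aone D) = tensor D D (aone D) (aone D)" unfolding D_one by (rule comult_id)
  show "counit (aone D) = 1" unfolding D_one by (rule counit_eqI) simp
qed

theorem operators_module_algebra:
  assumes "k_algebra A"
  shows "module_algebra D comult counit antipode s (\<lambda>f a. f a)"
  by (intro module_algebra.intro operators_hopf assms module_algebra_axioms.intro act_bilinear)
     (simp_all add: D_mult D_one evaluation_comult counit)

text \<open>The module algebra law prescribes the bilinear map \<open>(x, y) \<mapsto> f(x y)\<close> induced by \<open>\<Delta> f\<close>.\<close>

theorem comult_unique: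
  assumes "module_algebra D \<Delta> \<epsilon> S s (\<lambda>f a. f a)" and f: "f \<in> vcarrier D"
  shows "\<Delta> f = comult f"
proof -
  interpret M: module_algebra D \<Delta> \<epsilon> S s "\<lambda>f a. f a" by fact
  show ?thesis
    by (rule tensor2_eqI[OF linear_map_carrier[OF M.comult_linear f] comult_in[OF f]])
       (simp add: evaluation_comult f M.act_prod[OF f, symmetric])
qed

end

section \<open>The commutant of a Galois action of a Hopf algebra\<close>

lemma algebra_product_times:
  assumes "k_algebra (type_algebra s)"
  shows "algebra_product s (*)"
proof -
  interpret A: k_algebra "type_algebra s" by fact
  interpret vector_space s using A.ambient by simp
  show ?thesis
    using bilinear_map_scale_left[OF A.mult_bilinear] bilinear_map_scale_right[OF A.mult_bilinear]
    by unfold_locales (simp_all add: distrib_left distrib_right mult.assoc)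
qed

context hopf_algebra
begin

lemma vspace_H: "vspace H" ..

lemma comult_in: "h \<in> vcarrier H \<Longrightarrow> comult h \<in> vcarrier (tensor_space H H)"
  by (rule linear_map_carrier[OF comult_linear])

lemma sweedler_coassoc:
  assumes U: "vspace U" and F: "trilinear_map H H H U F" and h: "h \<in> vcarrier H"
  shows "tensor_lift H H (\<lambda>p q. tensor_lift H H (\<lambda>u v. F u v q) (comult p)) (comult h) =
    tensor_lift H H (\<lambda>p q. tensor_lift H H (F p) (comult q)) (comult h)"
  using tensor_lift_comult_left[OF vspace_H U comult_linear F comult_in[OF h]]
    tensor_lift_comult_right[OF vspace_H U comult_linear F comult_in[OF h]] coassoc[OF h]
  by simp

end

sublocale module_algebra \<subseteq> represented: represented_algebra H s act
proof -
  have "vector_space s" using A.ambient by simp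
  then show "represented_algebra H s act"
    by (intro represented_algebra.intro k_algebra_axioms represented_algebra_axioms.intro
        act_bilinear act_mult act_one)
qed

sublocale module_algebra \<subseteq> left: acting_algebra H s act "(*)"
  by (intro acting_algebra.intro represented.represented_algebra_axioms
      algebra_product_times A.k_algebra_axioms)

sublocale module_algebra \<subseteq> right: acting_algebra H s act "\<lambda>a b. b * a"
  by (intro acting_algebra.intro represented.represented_algebra_axioms left.flip_product)

context module_algebra
begin

lemma leibniz_list:
  assumes h: "h \<in> vcarrier H"
  shows "\<exists>ps. set ps \<subseteq> vcarrier H \<times> vcarrier H \<and>
    (\<forall>x y. pair_sum ps (\<lambda>p q. act p x * act q y) = act h (x * y))"
proof -
  obtain ps where ps: "set ps \<subseteq> vcarrier H \<times> vcarrier H" "comult h = pair_sum ps (tensor H H)"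
    using tensor_space_pair_sum[OF vspace_H comult_in[OF h]] .
  have "bilinear_map H H (type_algebra s) (\<lambda>p q. act p x * act q y)" for x y
    by (rule bilinear_map_compose[OF A.mult_bilinear[simplified] represented.act_linear_left
          represented.act_linear_left])
  then show ?thesis
    using ps by (intro exI[of _ ps])
      (simp add: act_prod[OF h] tensor_lift_pair_sum[OF represented.vspace_A])
qed

text \<open>The tensor is \<open>\<Sum> h' \<otimes> S(h'')\<close>: indeed \<open>\<Sum> h'(x (S(h'') y)) = \<Sum> h'(x) h''(S(h''') y) = h(x) y\<close>.\<close>

lemma untwisting_list:
  assumes h: "h \<in> vcarrier H"
  shows "\<exists>ps. set ps \<subseteq> vcarrier H \<times> vcarrier H \<and>
    (\<forall>x y. pair_sum ps (\<lambda>p q. act p (x * act q y)) = act h x * y)"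
proof -
  note vA = represented.vspace_A
  obtain ps where ps: "set ps \<subseteq> vcarrier H \<times> vcarrier H" "comult h = pair_sum ps (tensor H H)"
    using tensor_space_pair_sum[OF vspace_H comult_in[OF h]] .
  have S: "antipode q \<in> vcarrier H" if "q \<in> vcarrier H" for q
    by (rule linear_map_carrier[OF antipode_linear that])
  have "pair_sum ps (\<lambda>p q. act p (x * act (antipode q) y)) = act h x * y" for x y
  proof -
    let ?F = "\<lambda>p u q. act p x * act u (act (antipode q) y)"
    have SA: "linear_map H (type_algebra s) (\<lambda>q. act (antipode q) y)"
      by (rule linear_map_compose[OF antipode_linear represented.act_linear_left])
    have b: "bilinear_map H H (type_algebra s) (\<lambda>u q. act u (act (antipode q) y))"
      by (rule bilinear_map_compose[OF act_bilinear linear_map_ident SA])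
    have lin: "linear_map (type_algebra s) (type_algebra s) (\<lambda>c. a * c)" for a
      by (simp add: linear_map_def distrib_left left.m_scale_right)
    have bF: "bilinear_map H H (type_algebra s) (?F p)" for p
      by (rule bilinear_map_linear[OF b lin])
    have tri: "trilinear_map H H H (type_algebra s) ?F"
      using bF by (simp add: trilinear_map_def linear_map_def represented.act_add_left
          represented.act_scale_left distrib_right left.m_scale_left)
    have bL: "bilinear_map H H (type_algebra s) (\<lambda>p q. tensor_lift H H (\<lambda>u v. ?F u v q) (comult p))"
      by (rule bilinear_map_compose[OF bilinear_map_swap[OF bilinear_tensor_lift[OF vspace_H vspace_H vA
          trilinear_map_rotate[OF tri]]] comult_linear linear_map_ident])
    have bR: "bilinear_map H H (type_algebra s) (\<lambda>p q. tensor_lift H H (?F p) (comult q))"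
      by (rule bilinear_map_compose[OF bilinear_tensor_lift[OF vspace_H vspace_H vA tri]
          linear_map_ident comult_linear])
    have inner: "tensor_lift H H (?F p) (comult q) = act (vscale H (counit q) p) x * y"
      if p: "p \<in> vcarrier H" and q: "q \<in> vcarrier H" for p q
    proof -
      obtain qs where qs: "set qs \<subseteq> vcarrier H \<times> vcarrier H" "comult q = pair_sum qs (tensor H H)"
        using tensor_space_pair_sum[OF vspace_H comult_in[OF q]] .
      have bm: "bilinear_map H H H (\<lambda>u v. amult H u (antipode v))"
        by (rule bilinear_map_compose[OF mult_bilinear linear_map_ident antipode_linear])
      have "tensor_lift H H (?F p) (comult q) = pair_sum qs (?F p)"
        using tensor_lift_pair_sum[OF vA bF qs(1)] qs(2) by simp
      also have "\<dots> = act p x * pair_sum qs (\<lambda>u v. act (amult H u (antipode v)) y)"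
        using qs(1) S unfolding left.m_pair_sum by (intro pair_sum_cong) (auto simp: act_mult)
      also have "pair_sum qs (\<lambda>u v. act (amult H u (antipode v)) y) =
          act (pair_sum qs (\<lambda>u v. amult H u (antipode v))) y"
        using qs(1) bilinear_map_carrier[OF bm]
        by (intro linear_map_pair_sum[OF vspace_H represented.act_linear_left, symmetric]) auto
      also have "pair_sum qs (\<lambda>u v. amult H u (antipode v)) = vscale H (counit q) (aone H)"
        using antipode_right[OF q] tensor_lift_pair_sum[OF vspace_H bm qs(1)] qs(2) by simp
      finally show ?thesis
        using p one_carrier by (simp add: represented.act_scale_left act_one left.m_scale_left left.m_scale_right)
    qed
    have bc: "bilinear_map H H H (\<lambda>p q. vscale H (counit q) p)"
    proof -
      interpret HH: vector_space "vscale H" by (rule ambient)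
      show ?thesis
        using linear_map_add[OF counit_linear] linear_map_scale[OF counit_linear] carrier_scale
        by (intro bilinear_mapI)
           (auto simp: ground_def HH.scale_left_distrib HH.scale_right_distrib mult.commute)
    qed
    have "pair_sum ps (\<lambda>p q. act p (x * act (antipode q) y)) =
        pair_sum ps (\<lambda>p q. tensor_lift H H (\<lambda>u v. ?F u v q) (comult p))"
      using ps(1) by (intro pair_sum_cong) (auto simp: act_prod)
    also have "\<dots> = pair_sum ps (\<lambda>p q. tensor_lift H H (?F p) (comult q))"
      using sweedler_coassoc[OF vA tri h] ps(2)
        tensor_lift_pair_sum[OF vA bL ps(1)] tensor_lift_pair_sum[OF vA bR ps(1)] by simp
    also have "\<dots> = pair_sum ps (\<lambda>p q. act (vscale H (counit q) p) x) * y"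
      using ps(1) inner unfolding left.m_pair_sum by (intro pair_sum_cong) auto
    also have "pair_sum ps (\<lambda>p q. act (vscale H (counit q) p) x) = act (pair_sum ps (\<lambda>p q. vscale H (counit q) p)) x"
      using ps(1) carrier_scale
      by (intro linear_map_pair_sum[OF vspace_H represented.act_linear_left, symmetric]) auto
    also have "pair_sum ps (\<lambda>p q. vscale H (counit q) p) = h"
      using counit_right[OF h] tensor_lift_pair_sum[OF vspace_H bc ps(1)] ps(2) by simp
    finally show ?thesis .
  qed
  then show ?thesis
    using ps(1) S by (intro exI[of _ "map (\<lambda>(p, q). (p, antipode q)) ps"]) (auto simp: pair_sum_map)
qed

end

context galois
begin

abbreviation "A \<equiv> type_algebra s"
abbreviation "E \<equiv> module_endo H s act"

lemma galois_bijective: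
  "pi_bijective (*) H s act" "pi_bijective (\<lambda>a b. b * a) H s act"
  "gamma_bijective (*) H s act" "gamma_bijective (\<lambda>a b. b * a) H s act"
  using pi_bij pi'_bij gamma_bij gamma'_bij
  by (simp_all add: represented.galois_maps_iff[OF left.algebra_product_axioms])

lemma fin_dim_A: "fin_dim A"
  by (rule left.fin_dim_A[OF galois_bijective(3) fin_dim])

lemma pi_bijective_E: "pi_bijective (*) E s (\<lambda>f a. f a)" "pi_bijective (\<lambda>a b. b * a) E s (\<lambda>f a. f a)"
  using left.pi_bijective_commutant right.pi_bijective_commutant galois_bijective fin_dim_A by blast+

lemma gamma_bijective_E:
  "gamma_bijective (*) E s (\<lambda>f a. f a)" "gamma_bijective (\<lambda>a b. b * a) E s (\<lambda>f a. f a)"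
  using acting_algebra.gamma_bijective_flip[OF right.commutant_acting pi_bijective_E(2) fin_dim_A]
    acting_algebra.gamma_bijective_flip[OF left.commutant_acting pi_bijective_E(1) fin_dim_A]
  by simp_all

lemma fin_dim_E: "fin_dim E"
  by (rule acting_algebra.fin_dim_H[OF left.commutant_acting pi_bijective_E(1) fin_dim_A])

lemma commutant_galois:
  assumes "module_algebra E \<Delta> \<epsilon> S s (\<lambda>f a. f a)"
  shows "galois E \<Delta> \<epsilon> S s (\<lambda>f a. f a)"
  using assms fin_dim_E pi_bijective_E gamma_bijective_E
    represented_algebra.galois_maps_iff[OF represented.commutant_represented left.algebra_product_axioms]
  by (simp add: galois_def galois_axioms_def)

text \<open>For \<open>f\<close> in \<open>E\<close> the element \<open>f(1)\<close> is \<open>H\<close>-invariant, and an invariant \<open>c\<close> is a scalar: \<open>c \<otimes> 1\<close> and \<open>1 \<otimes> c\<close>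
  have the same image \<open>h \<mapsto> \<epsilon>(h) c\<close> under \<open>\<gamma>\<close>.\<close>

lemma value_at_one:
  assumes f: "f \<in> vcarrier E"
  shows "\<exists>c. f 1 = s c 1"
proof -
  obtain \<tau> where \<tau>: "Vector_Spaces.linear s (*) \<tau>" "\<tau> 1 = 1"
    using unit_functional[OF represented.vector_space_axioms] .
  interpret \<tau>: Vector_Spaces.linear s "(*)" \<tau> by fact
  have bil: "bilinear_map A A A (\<lambda>u v. s (\<tau> u) v)"
    by (rule bilinear_mapI) (simp_all add: \<tau>.add \<tau>.scale represented.scale_left_distrib
        represented.scale_right_distrib mult.commute)
  have "pair_sum [(f 1, 1)] (\<lambda>u v. s (\<tau> u) v) = pair_sum [(1, f 1)] (\<lambda>u v. s (\<tau> u) v)"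
  proof (rule left.gamma_unique[OF _ represented.vspace_A bil])
    show "faithful_family A A (vcarrier H) (\<lambda>h a b. a * act h b)"
      using galois_bijective(3) by (simp add: gamma_bijective_def)
    fix h assume h: "h \<in> vcarrier H"
    have "act h (f 1) = f (s (counit h) 1)"
      using represented.E_act[OF f h, of 1] act_unit[OF h] by simp
    then show "pair_sum [(f 1, 1)] (\<lambda>a b. a * act h b) = pair_sum [(1, f 1)] (\<lambda>a b. a * act h b)"
      using act_unit[OF h] by (simp add: represented.E_scale[OF f] left.m_scale_right)
  qed
  then have "f 1 = s (\<tau> (f 1)) 1" using \<tau>(2) by simp
  then show ?thesis ..
qed

text \<open>With \<open>f(x y) = \<Sum> a\<^sub>e(x) e(y)\<close>, apply \<open>f\<close> to \<open>h(x) y = \<Sum> p(x (q y))\<close>. As \<open>f\<close> and all \<open>e\<close> commute with \<open>H\<close>, the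
  result is \<open>\<Sum> a\<^sub>e(h x) e(y) = \<Sum> h(a\<^sub>e(x)) e(y)\<close> for all \<open>y\<close>, and the coefficients of the \<open>e\<close> are unique.\<close>

lemma coefficient_in_E:
  assumes Bd: "dual_bases E B d"
    and T: "\<And>e f. \<lbrakk>e \<in> B; f \<in> vcarrier E\<rbrakk> \<Longrightarrow> pair_sum (T e) (\<lambda>u v. f v * u) = s (d e f) 1"
    and e: "e \<in> B" and f: "f \<in> vcarrier E"
  shows "(\<lambda>x. pair_sum (T e) (\<lambda>u v. f (x * v) * u)) \<in> vcarrier E"
proof -
  interpret RE: acting_algebra E s "\<lambda>f a. f a" "\<lambda>a b. b * a" by (rule right.commutant_acting)
  have B: "\<And>e. e \<in> B \<Longrightarrow> e \<in> vcarrier E" and fin: "finite B" using dual_basesD[OF Bd] by blast+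
  have faith: "faithful_family A A (vcarrier E) (\<lambda>f a b. f b * a)"
    using gamma_bijective_E(2) by (simp add: gamma_bijective_def)
  define a where "a e x = pair_sum (T e) (\<lambda>u v. f (x * v) * u)" for e x
  have expansion: "(\<Sum>e\<in>B. a e x * e y) = f (x * y)" for x y
  proof -
    have "bilinear_map A A A (\<lambda>a b. f (x * b) * a)"
      by (rule bilinear_mapI) (simp_all add: represented.E_add[OF f] represented.E_scale[OF f]
          distrib_left distrib_right left.m_scale_left left.m_scale_right)
    from RE.gamma_expansion[OF faith Bd T represented.vspace_A this] show ?thesis
      by (simp add: a_def left.m_pair_sum left.m_assoc)
  qed
  \<comment> \<open>\<open>T e\<close> reads off the coefficient of \<open>e\<close>, as \<open>d e\<close> is the coordinate functional.\<close>
  have recover: "c e = pair_sum (T e) (\<lambda>u v. (\<Sum>e'\<in>B. c e' * e' v) * u)" for c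
  proof -
    have "pair_sum (T e) (\<lambda>u v. (\<Sum>e'\<in>B. c e' * e' v) * u) = (\<Sum>e'\<in>B. c e' * pair_sum (T e) (\<lambda>u v. e' v * u))"
      by (simp add: sum_distrib_right pair_sum_sum left.m_pair_sum mult.assoc)
    also have "\<dots> = (\<Sum>e'\<in>B. if e' = e then c e else 0)"
      using T[OF e B] dual_bases_delta[OF Bd e]
      by (intro sum.cong refl) (simp add: left.m_scale_right)
    finally show ?thesis using fin e by simp
  qed
  have scaled: "a e (s c x) = s c (a e x)" for c x
  proof -
    have "s c (a e x) = pair_sum (T e) (\<lambda>u v. s c (f (x * v) * u))"
      unfolding a_def by (rule pair_sum_hom) (simp_all add: represented.scale_right_distrib)
    then show ?thesis by (simp add: a_def left.m_scale_left represented.E_scale[OF f])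
  qed
  have "a e (act h x) = act h (a e x)" if h: "h \<in> vcarrier H" for h x
  proof -
    obtain ps where ps: "set ps \<subseteq> vcarrier H \<times> vcarrier H"
      "\<And>x y. pair_sum ps (\<lambda>p q. act p (x * act q y)) = act h x * y"
      using untwisting_list[OF h] by blast
    have "(\<Sum>e\<in>B. a e (act h x) * e y) = (\<Sum>e\<in>B. act h (a e x) * e y)" for y
    proof -
      have f0: "f 0 = 0" using represented.E_add[OF f, of 0 0] by simp
      have "(\<Sum>e\<in>B. a e (act h x) * e y) = f (pair_sum ps (\<lambda>p q. act p (x * act q y)))"
        by (simp add: expansion ps(2))
      also have "\<dots> = pair_sum ps (\<lambda>p q. f (act p (x * act q y)))"
        by (rule pair_sum_hom) (simp_all add: f0 represented.E_add[OF f])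
      also have "\<dots> = pair_sum ps (\<lambda>p q. \<Sum>e\<in>B. act p (a e x * act q (e y)))"
      proof (rule pair_sum_cong)
        fix p q assume "(p, q) \<in> set ps"
        then have pq: "p \<in> vcarrier H" "q \<in> vcarrier H" using ps(1) by auto
        have "f (act p (x * act q y)) = act p (\<Sum>e\<in>B. a e x * e (act q y))"
          by (simp add: represented.E_act[OF f pq(1)] expansion)
        also have "\<dots> = (\<Sum>e\<in>B. act p (a e x * act q (e y)))"
          using represented.E_act[OF B pq(2)] by (simp add: represented.act_sum[OF pq(1)])
        finally show "f (act p (x * act q y)) = (\<Sum>e\<in>B. act p (a e x * act q (e y)))" .
      qed
      also have "\<dots> = (\<Sum>e\<in>B. act h (a e x) * e y)"
        by (simp add: pair_sum_sum ps(2))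
      finally show ?thesis .
    qed
    then show ?thesis
      using recover[of "\<lambda>e. a e (act h x)"] recover[of "\<lambda>e. act h (a e x)"] by simp
  qed
  then have "a e \<in> vcarrier E"
    using scaled by (intro represented.EI)
      (simp_all add: a_def distrib_right represented.E_add[OF f] pair_sum_add)
  then show ?thesis by (simp add: a_def[abs_def])
qed

text \<open>With \<open>f(x) y = \<Sum> b\<^sub>e(x e(y))\<close>, apply \<open>h\<close> and use \<open>h(x y) = \<Sum> p(x) q(y)\<close>. As \<open>f\<close> and all \<open>e\<close> commute with \<open>H\<close>,
  the operators \<open>h b\<^sub>e\<close> and \<open>b\<^sub>e h\<close> have the same sum over \<open>e\<close> at all arguments \<open>x e(y)\<close>; such operators are
  unique, because \<open>\<gamma>\<close> for \<open>E\<close> is surjective.\<close>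

lemma twisted_coefficient_in_E:
  assumes Bd: "dual_bases E B d"
    and T: "\<And>e f. \<lbrakk>e \<in> B; f \<in> vcarrier E\<rbrakk> \<Longrightarrow> pair_sum (T e) (\<lambda>u v. u * f v) = s (d e f) 1"
    and e: "e \<in> B" and f: "f \<in> vcarrier E"
  shows "(\<lambda>x. pair_sum (T e) (\<lambda>u v. f (x * u) * v)) \<in> vcarrier E"
proof -
  interpret LE: acting_algebra E s "\<lambda>f a. f a" "(*)" by (rule left.commutant_acting)
  have B: "\<And>e. e \<in> B \<Longrightarrow> e \<in> vcarrier E" and fin: "finite B" using dual_basesD[OF Bd] by blast+
  have faith: "faithful_family A A (vcarrier E) (\<lambda>f a b. a * f b)"
    using gamma_bijective_E(1) by (simp add: gamma_bijective_def)
  define a where "a e x = pair_sum (T e) (\<lambda>u v. f (x * u) * v)" for e x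
  have add: "a e (x + y) = a e x + a e y" for e x y
    by (simp add: a_def distrib_right represented.E_add[OF f] pair_sum_add)
  have zero: "a e 0 = 0" for e using add[of e 0 0] by simp
  have scaled: "a e (s c x) = s c (a e x)" for e c x
  proof -
    have "s c (a e x) = pair_sum (T e) (\<lambda>u v. s c (f (x * u) * v))"
      unfolding a_def by (rule pair_sum_hom) (simp_all add: represented.scale_right_distrib)
    then show ?thesis by (simp add: a_def left.m_scale_left represented.E_scale[OF f])
  qed
  have expansion: "(\<Sum>e\<in>B. a e (x * e y)) = f x * y" for x y
  proof -
    have "bilinear_map A A A (\<lambda>a b. f (x * a) * b)"
      by (rule bilinear_mapI) (simp_all add: represented.E_add[OF f] represented.E_scale[OF f]
          distrib_left distrib_right left.m_scale_left left.m_scale_right)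
    from LE.gamma_expansion[OF faith Bd T represented.vspace_A this] show ?thesis
      by (simp add: a_def mult.assoc)
  qed
  \<comment> \<open>Substituting \<open>x = z u\<close>, \<open>y = v\<close> and summing over \<open>T e\<close> isolates the operator belonging to \<open>e\<close>.\<close>
  have recover: "\<psi> e z = pair_sum (T e) (\<lambda>u v. \<Sum>e'\<in>B. \<psi> e' (z * u * e' v))"
    if add: "\<And>e x y. \<psi> e (x + y) = \<psi> e x + \<psi> e y" for \<psi> :: "('a \<Rightarrow> 'a) \<Rightarrow> 'a \<Rightarrow> 'a" and z
  proof -
    have zero: "\<psi> e 0 = 0" for e using add[of e 0 0] by simp
    have "pair_sum (T e) (\<lambda>u v. \<Sum>e'\<in>B. \<psi> e' (z * u * e' v)) =
        (\<Sum>e'\<in>B. \<psi> e' (z * pair_sum (T e) (\<lambda>u v. u * e' v)))"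
      by (simp add: pair_sum_sum left.m_pair_sum pair_sum_hom[where \<phi> = "\<psi> _"] zero add mult.assoc)
    also have "\<dots> = (\<Sum>e'\<in>B. if e' = e then \<psi> e z else 0)"
      using T[OF e B] dual_bases_delta[OF Bd e]
      by (intro sum.cong refl) (simp add: left.m_scale_right zero)
    finally show ?thesis using fin e by simp
  qed
  have "a e (act h x) = act h (a e x)" if h: "h \<in> vcarrier H" for h x
  proof -
    obtain ps where ps: "set ps \<subseteq> vcarrier H \<times> vcarrier H"
      "\<And>x y. pair_sum ps (\<lambda>p q. act p x * act q y) = act h (x * y)"
      using leibniz_list[OF h] by blast
    have "(\<Sum>e\<in>B. act h (a e (x * e y))) = (\<Sum>e\<in>B. a e (act h (x * e y)))" for x y
    proof -
      have "(\<Sum>e\<in>B. act h (a e (x * e y))) = pair_sum ps (\<lambda>p q. act p (f x) * act q y)"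
        by (simp add: represented.act_sum[OF h, symmetric] expansion ps(2))
      also have "\<dots> = pair_sum ps (\<lambda>p q. \<Sum>e\<in>B. a e (act p x * act q (e y)))"
      proof (rule pair_sum_cong)
        fix p q assume "(p, q) \<in> set ps"
        then have pq: "p \<in> vcarrier H" "q \<in> vcarrier H" using ps(1) by auto
        have "act p (f x) * act q y = (\<Sum>e\<in>B. a e (act p x * e (act q y)))"
          by (simp add: represented.E_act[OF f pq(1), symmetric] expansion)
        then show "act p (f x) * act q y = (\<Sum>e\<in>B. a e (act p x * act q (e y)))"
          using represented.E_act[OF B pq(2)] by simp
      qed
      also have "\<dots> = (\<Sum>e\<in>B. a e (act h (x * e y)))"
        by (simp add: pair_sum_sum ps(2)[symmetric] pair_sum_hom[where \<phi> = "a _"] zero add)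
      finally show ?thesis .
    qed
    then show ?thesis
      using recover[of "\<lambda>e x. act h (a e x)"] recover[of "\<lambda>e x. a e (act h x)"]
      by (simp add: add represented.act_add[OF h])
  qed
  then have "a e \<in> vcarrier E"
    using scaled add by (intro represented.EI) simp_all
  then show ?thesis by (simp add: a_def[abs_def])
qed

lemma galois_operators_E: "\<exists>B d T T'. galois_operators E s B d T T'"
proof -
  interpret LE: acting_algebra E s "\<lambda>f a. f a" "(*)" by (rule left.commutant_acting)
  interpret RE: acting_algebra E s "\<lambda>f a. f a" "\<lambda>a b. b * a" by (rule right.commutant_acting)
  obtain B d where Bd: "dual_bases E B d"
    using fin_dim_dual_bases[OF represented.vspace_E fin_dim_E] .
  obtain T where T: "\<forall>e\<in>B. \<forall>f\<in>vcarrier E. pair_sum (T e) (\<lambda>u v. u * f v) = s (d e f) 1"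
    using LE.gamma_dual_lists[OF _ Bd] gamma_bijective_E(1) by (auto simp: gamma_bijective_def)
  obtain T' where T': "\<forall>e\<in>B. \<forall>f\<in>vcarrier E. pair_sum (T' e) (\<lambda>u v. f v * u) = s (d e f) 1"
    using RE.gamma_dual_lists[OF _ Bd] gamma_bijective_E(2) by (auto simp: gamma_bijective_def)
  have "galois_operators E s B d T T'"
  proof
    show "faithful_family A A (vcarrier E) (\<lambda>f a b. a * f b)"
      "faithful_family A A (vcarrier E) (\<lambda>f a b. f b * a)"
      "faithful_family A E UNIV (\<lambda>b a f. f b * a)"
      using gamma_bijective_E pi_bijective_E(2) by (simp_all add: gamma_bijective_def pi_bijective_def)
    fix e f assume e: "e \<in> B" and f: "f \<in> vcarrier E"
    show "(\<lambda>x. pair_sum (T' e) (\<lambda>u v. f (x * v) * u)) \<in> vcarrier E"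
      by (rule coefficient_in_E[OF Bd _ e f]) (use T' in simp)
    show "(\<lambda>x. pair_sum (T e) (\<lambda>u v. f (x * u) * v)) \<in> vcarrier E"
      by (rule twisted_coefficient_in_E[OF Bd _ e f]) (use T in simp)
  qed (use T T' Bd in \<open>simp_all add: represented.E_simps left.algebra_product_axioms value_at_one\<close>)
  then show ?thesis by blast
qed

end

theorem theorem1p6:
  fixes H :: "('k::field, 'h::ab_group_add) kalg"
    and comult :: "'h \<Rightarrow> (('h \<Rightarrow> 'h \<Rightarrow> 'k) \<Rightarrow> 'k)"
    and counit :: "'h \<Rightarrow> 'k"
    and antipode :: "'h \<Rightarrow> 'h"
    and s :: "'k \<Rightarrow> 'a \<Rightarrow> 'a::ring_1"
    and act :: "'h \<Rightarrow> 'a \<Rightarrow> 'a"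
    and E :: "('k, 'a \<Rightarrow> 'a) kalg"
  assumes "hopf_algebra H comult counit antipode" and "fin_dim H"
    and "module_algebra H comult counit antipode s act"
    and "galois H comult counit antipode s act"
    and "E = module_endo H s act"
  shows "(\<exists>!\<Delta>. \<Delta> \<in> extensional (vcarrier E) \<and>
            (\<exists>\<epsilon> S. hopf_algebra E \<Delta> \<epsilon> S \<and> module_algebra E \<Delta> \<epsilon> S s (\<lambda>f a. f a))) \<and>
         (\<forall>\<Delta> \<epsilon> S. hopf_algebra E \<Delta> \<epsilon> S \<and> module_algebra E \<Delta> \<epsilon> S s (\<lambda>f a. f a) \<longrightarrow>
            galois E \<Delta> \<epsilon> S s (\<lambda>f a. f a)) \<and>
         bij_betw act (vcarrier H) (vcarrier (module_endo E s (\<lambda>f a. f a)))"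
proof -
  interpret galois H comult counit antipode s act by fact
  obtain B d T T' where "galois_operators E s B d T T'"
    using galois_operators_E assms(5) by blast
  then interpret O: galois_operators E s B d T T' .
  have "\<exists>!\<Delta>. \<Delta> \<in> extensional (vcarrier E) \<and>
      (\<exists>\<epsilon> S. hopf_algebra E \<Delta> \<epsilon> S \<and> module_algebra E \<Delta> \<epsilon> S s (\<lambda>f a. f a))"
  proof (rule ex1I)
    show "O.comult \<in> extensional (vcarrier E) \<and>
        (\<exists>\<epsilon> S. hopf_algebra E O.comult \<epsilon> S \<and> module_algebra E O.comult \<epsilon> S s (\<lambda>f a. f a))"
      using O.operators_hopf O.operators_module_algebra[OF A.k_algebra_axioms] by (auto simp: O.comult_def)
    fix \<Delta>
    assume \<Delta>: "\<Delta> \<in> extensional (vcarrier E) \<and>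
        (\<exists>\<epsilon> S. hopf_algebra E \<Delta> \<epsilon> S \<and> module_algebra E \<Delta> \<epsilon> S s (\<lambda>f a. f a))"
    show "\<Delta> = O.comult"
    proof (rule extensionalityI)
      show "\<Delta> \<in> extensional (vcarrier E)" "O.comult \<in> extensional (vcarrier E)"
        using \<Delta> by (simp_all add: O.comult_def)
      show "\<Delta> f = O.comult f" if "f \<in> vcarrier E" for f
        using O.comult_unique[OF _ that] \<Delta> by blast
    qed
  qed
  moreover have "bij_betw act (vcarrier H) (vcarrier (module_endo E s (\<lambda>f a. f a)))"
    unfolding assms(5) by (rule left.double_commutant[OF galois_bijective(1) gamma_bijective_E(1)])
  ultimately show ?thesis
    using commutant_galois assms(5) by blast
qed

end
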